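(* For every positive integer $n$ the following identities hold: \[ W_1(n)=\frac{5}{12}\sigma_3(n)-\frac{n}{2}\sigma_1(n)+\frac{1}{12}\sigma_1(n), \] \[ W_2(n)=\frac{1}{12}\sigma_3(n)+\frac{1}{3}\sigma_3\left(\frac{n}{2}\right)-\frac{1}{8}n\sigma_1(n)-\frac{1}{4}n\sigma_1\left(\frac{n}{2}\right)+\frac{1}{24}\sigma_1(n)+\frac{1}{24}\sigma_1\left(\frac{n}{2}\right), \] \[ W_3(n)=\frac{1}{24}\sigma_3(n)+\frac{3}{8}\sigma_3\left(\frac{n}{3}\right)-\frac{1}{12}n\sigma_1(n)-\frac{1}{4}n\sigma_1\left(\frac{n}{3}\right)+\frac{1}{24}\sigma_1(n)+\frac{1}{24}\sigma_1\left(\frac{n}{3}\right), \] \[ W_4(n)=\frac{1}{48}\sigma_3(n)+\frac{1}{16}\sigma_3\left(\frac{n}{2}\right)+\frac{1}{3}\sigma_3\left(\frac{n}{4}\right)-\frac{1}{16}n\sigma_1(n)-\frac{1}{4}n\sigma_1\left(\frac{n}{4}\right)+\frac{1}{24}\sigma_1(n)+\frac{1}{24}\sigma_1\left(\frac{n}{4}\right), \] \[ W_5(n)=\frac{5}{312}\sigma_3(n)+\frac{125}{312}\sigma_3\left(\frac{n}{5}\right)-\frac{1}{20}n\sigma_1(n)-\frac{1}{4}n\sigma_1\left(\frac{n}{5}\right)+\frac{1}{24}\sigma_1(n)+\frac{1}{24}\sigma_1\left(\frac{n}{5}\right)-\frac{1}{130}\tau_{4,5}(n), \] \[ W_6(n)=\frac{1}{120}\sigma_3(n)+\frac{1}{30}\sigma_3\left(\frac{n}{2}\right)+\frac{3}{40}\sigma_3\left(\frac{n}{3}\right)+\frac{3}{10}\sigma_3\left(\frac{n}{6}\right)-\frac{1}{24}n\sigma_1(n)-\frac{1}{4}n\sigma_1\left(\frac{n}{6}\right)+\frac{1}{24}\sigma_1(n)+\frac{1}{24}\sigma_1\left(\frac{n}{6}\right)-\frac{1}{120}\tau_{4,6}(n),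 \] \[ W_7(n)=\frac{1}{120}\sigma_3(n)+\frac{49}{120}\sigma_3\left(\frac{n}{7}\right)-\frac{1}{28}n\sigma_1(n)-\frac{1}{4}n\sigma_1\left(\frac{n}{7}\right)+\frac{1}{24}\sigma_1(n)+\frac{1}{24}\sigma_1\left(\frac{n}{7}\right)-\frac{1}{70}\tau_{4,7}(n), \] \[ W_8(n)=\frac{1}{192}\sigma_3(n)+\frac{1}{64}\sigma_3\left(\frac{n}{2}\right)+\frac{1}{16}\sigma_3\left(\frac{n}{4}\right)+\frac{1}{3}\sigma_3\left(\frac{n}{8}\right)-\frac{1}{32}n\sigma_1(n)-\frac{1}{4}n\sigma_1\left(\frac{n}{8}\right)+\frac{1}{24}\sigma_1(n)+\frac{1}{24}\sigma_1\left(\frac{n}{8}\right)-\frac{1}{64}\tau_{4,8}(n), \] \[ W_9(n)=\frac{1}{216}\sigma_3(n)+\frac{1}{27}\sigma_3\left(\frac{n}{3}\right)+\frac{3}{8}\sigma_3\left(\frac{n}{9}\right)-\frac{1}{36}n\sigma_1(n)-\frac{1}{4}n\sigma_1\left(\frac{n}{9}\right)+\frac{1}{24}\sigma_1(n)+\frac{1}{24}\sigma_1\left(\frac{n}{9}\right)-\frac{1}{54}\tau_{4,9}(n), \] \[ W_{10}(n)=\frac{1}{312}\sigma_3(n)+\frac{1}{78}\sigma_3\left(\frac{n}{2}\right)+\frac{25}{312}\sigma_3\left(\frac{n}{5}\right)+\frac{25}{78}\sigma_3\left(\frac{n}{10}\right)-\frac{1}{40}n\sigma_1(n)-\frac{1}{4}n\sigma_1\left(\frac{n}{10}\right)+\frac{1}{24}\sigma_1(n)+\frac{1}{24}\sigma_1\left(\frac{n}{10}\right)-\frac{1}{120}\tau_{4,10}(n)-\frac{3}{260}\tau_{4,5}(n)-\frac{3}{65}\tau_{4,5}\left(\frac{n}{2}\right).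 \]
   Context: For positive integers $j,n$ let $\sigma_j(n)=\sum_{d\mid n}d^j$ (sum over positive divisors); for $x\notin\mathbb{N}^*=\{1,2,\dots\}$ set $\sigma_j(x)=0$, and likewise every arithmetic function $\tau_{\ast}$ below is extended by $\tau_\ast(x)=0$ for $x\notin\mathbb{N}^*$. For $N\in\mathbb{N}^*$ define the convolution $W_N(n)=\sum_{m}\sigma_1(m)\sigma_1(n-Nm)$, the sum over positive integers $m<n/N$. Write $q=e^{2\pi i z}$ for $z$ in the upper half plane and $\Gamma_0(N)=\{\begin{pmatrix}a&b\\c&d\end{pmatrix}\in \mathrm{SL}(2,\mathbb{Z}) : N\mid c\}$. For $N\in\{5,6,7,8,9\}$ the space of cusp forms of weight $4$ on $\Gamma_0(N)$ is one-dimensional; let $\Delta_{4,N}$ be its unique element with Fourier expansion $q+O(q^2)$ and write $\Delta_{4,N}=\sum_{n\ge1}\tau_{4,N}(n)q^n$. Let $\Delta_{4,10}=\sum_{n\geq 1}\tau_{4,10}(n)q^n$ be the unique primitive form (normalized newform, Hecke eigenform with first coefficient $1$) of weight $4$ on $\Gamma_0(10)$; its expansion begins $q+2q^2-8q^3+4q^4+5q^5+\cdots$. *)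

theory Defs
  imports "HOL-Analysis.Analysis"
begin

definition extend_zero :: "(nat \<Rightarrow> complex) \<Rightarrow> real \<Rightarrow> complex" where
  "extend_zero f x = (if x \<in> \<nat> \<and> x > 0 then f (nat \<lfloor>x\<rfloor>) else 0)"

definition divisor_sigma :: "nat \<Rightarrow> real \<Rightarrow> complex" (\<open>\<sigma>\<close>) where
  "divisor_sigma j = extend_zero (\<lambda>n. \<Sum>d | d dvd n. of_nat d ^ j)"

definition conv_sum :: "nat \<Rightarrow> nat \<Rightarrow> complex" (\<open>W\<close>) where
  "conv_sum N n =
     (\<Sum>m | 0 < m \<and> real m < real n / real N. \<sigma> 1 (real m) * \<sigma> 1 (real n - real N * real m))"

definition upper_half_plane :: "complex set" (\<open>\<H>\<close>) where
  "upper_half_plane = {z. Im z > 0}"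

definition SL2Z :: "(int^2^2) set" where
  "SL2Z = {A. det A = 1}"

definition Gamma0 :: "nat \<Rightarrow> (int^2^2) set" where
  "Gamma0 N = {A \<in> SL2Z. int N dvd A $ 2 $ 1}"

definition slash :: "nat \<Rightarrow> (complex \<Rightarrow> complex) \<Rightarrow> int^2^2 \<Rightarrow> complex \<Rightarrow> complex" where
  "slash k f A z =
     f ((of_int (A $ 1 $ 1) * z + of_int (A $ 1 $ 2)) / (of_int (A $ 2 $ 1) * z + of_int (A $ 2 $ 2)))
       / (of_int (A $ 2 $ 1) * z + of_int (A $ 2 $ 2)) ^ k"

(* Forms are functions on the upper half plane, represented as functions on all of the complex
   numbers that are 0 elsewhere, so that equality of forms is equality of functions.
   For A in SL(2,Z), f|A is invariant under z -> z + N because the principal congruence subgroup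
   of level N is normal and contained in Gamma0 N; hence the expansion in exp(2 pi i z / N)
   at every cusp. *)
definition cusp_forms :: "nat \<Rightarrow> nat \<Rightarrow> (complex \<Rightarrow> complex) set" where
  "cusp_forms k N = {f.
     f holomorphic_on \<H> \<and>
     (\<forall>z. z \<notin> \<H> \<longrightarrow> f z = 0) \<and>
     (\<forall>A\<in>Gamma0 N. \<forall>z\<in>\<H>. slash k f A z = f z) \<and>
     (\<forall>A\<in>SL2Z. \<exists>a :: nat \<Rightarrow> complex. a 0 = 0 \<and>
        (\<forall>z\<in>\<H>. (\<lambda>n. a n * exp (2 * of_real pi * \<i> * of_nat n * z / of_nat N)) sums slash k f A z))}"

definition fourier_coeff :: "(complex \<Rightarrow> complex) \<Rightarrow> nat \<Rightarrow> complex" where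
  "fourier_coeff f =
     (THE a. \<forall>z\<in>\<H>. (\<lambda>n. a n * exp (2 * of_real pi * \<i> * z) ^ n) sums f z)"

definition \<Delta>4 :: "nat \<Rightarrow> complex \<Rightarrow> complex" where
  "\<Delta>4 N = (THE f. f \<in> cusp_forms 4 N \<and> fourier_coeff f 0 = 0 \<and> fourier_coeff f 1 = 1)"

definition \<tau>4 :: "nat \<Rightarrow> real \<Rightarrow> complex" where
  "\<tau>4 N = extend_zero (fourier_coeff (\<Delta>4 N))"

inductive_set oldforms :: "nat \<Rightarrow> nat \<Rightarrow> (complex \<Rightarrow> complex) set" for k N :: nat where
  zero: "(\<lambda>z. 0) \<in> oldforms k N"
| add_lift: "\<lbrakk>h \<in> oldforms k N; M dvd N; M \<noteq> N; d dvd N div M; g \<in> cusp_forms k M\<rbrakk>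
    \<Longrightarrow> (\<lambda>z. h z + c * g (of_nat d * z)) \<in> oldforms k N"

definition modular_fundamental_domain :: "complex set" where
  "modular_fundamental_domain = {z \<in> \<H>. \<bar>Re z\<bar> \<le> 1 / 2 \<and> norm z \<ge> 1}"

definition Gamma0_cosets :: "nat \<Rightarrow> (int^2^2) set set" where
  "Gamma0_cosets N = (\<lambda>A. (\<lambda>G. G ** A) ` Gamma0 N) ` SL2Z"

(* The integral of f(z) cnj(g(z)) y^k dx dy / y^2 over Gamma0(N)\H, where the quotient is cut into
   the translates of the modular fundamental domain by representatives of Gamma0(N)\SL(2,Z).
   The summand does not depend on the representative chosen. *)
definition petersson ::
    "nat \<Rightarrow> nat \<Rightarrow> (complex \<Rightarrow> complex) \<Rightarrow> (complex \<Rightarrow> complex) \<Rightarrow> complex" where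
  "petersson k N f g =
     (\<Sum>C\<in>Gamma0_cosets N. let A = (SOME A. A \<in> C) in
        LINT z:modular_fundamental_domain|lborel.
          slash k f A z * cnj (slash k g A z) * of_real (Im z ^ k / Im z ^ 2))"

definition newspace :: "nat \<Rightarrow> nat \<Rightarrow> (complex \<Rightarrow> complex) set" where
  "newspace k N = {f \<in> cusp_forms k N. \<forall>g\<in>oldforms k N. petersson k N f g = 0}"

(* The Hecke operator T_m on weight k forms for Gamma0(N), all m > 0 (for a prime m dividing N
   this is the operator often written U_m). *)
definition hecke ::
    "nat \<Rightarrow> nat \<Rightarrow> nat \<Rightarrow> (complex \<Rightarrow> complex) \<Rightarrow> complex \<Rightarrow> complex" where
  "hecke k N m f z =
     of_nat m ^ k / of_nat m *
       (\<Sum>a | a dvd m \<and> coprime a N. \<Sum>b<m div a.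
          f ((of_nat a * z + of_nat b) / of_nat (m div a)) / of_nat (m div a) ^ k)"

definition primitive_form :: "nat \<Rightarrow> nat \<Rightarrow> (complex \<Rightarrow> complex) \<Rightarrow> bool" where
  "primitive_form k N f \<longleftrightarrow>
     f \<in> newspace k N \<and>
     (\<forall>m>0. \<exists>c. \<forall>z\<in>\<H>. hecke k N m f z = c * f z) \<and>
     fourier_coeff f 1 = 1"

end

theory Submission
  imports Defs "HOL-Complex_Analysis.Complex_Analysis"
begin

text \<open>
  Put \<open>G\<^sub>N(z) = E\<^sub>2(z) - N E\<^sub>2(N z)\<close>. By Ramanujan's identity \<open>12 q dE\<^sub>2/dq = E\<^sub>2\<^sup>2 - E\<^sub>4\<close>, which is the formula for
  \<open>W\<^sub>1\<close> and is proved by Liouville's elementary argument, the \<open>n\<close>-th coefficient of \<open>G\<^sub>N\<^sup>2\<close> is a combination of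
  \<open>W\<^sub>N(n)\<close>, \<open>n \<sigma>\<^sub>1(n)\<close>, \<open>n \<sigma>\<^sub>1(n/N)\<close>, \<open>\<sigma>\<^sub>1\<close> and \<open>\<sigma>\<^sub>3\<close>. The quasimodularity of \<open>E\<^sub>2\<close>, obtained by comparing the two
  orders of summation in the lattice sum, makes \<open>G\<^sub>N\<close> a modular form of weight 2 for \<open>\<Gamma>\<^sub>0(N)\<close>, and subtracting
  the combination of the \<open>E\<^sub>4(\<delta> z)\<close>, \<open>\<delta> \<bar> N\<close>, with the same constant terms at all cusps turns \<open>G\<^sub>N\<^sup>2\<close> into a cusp form
  of weight 4.

  Cusp forms are compared through finitely many coefficients. The product \<open>P\<close> of all \<open>f|A\<close>, \<open>A\<close> running
  over bottom rows modulo \<open>N\<close>, has an \<open>SL\<^sub>2(\<int>)\<close>-invariant absolute value after multiplication by a power of \<open>Im z\<close>;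
  the maximum principle at a maximum of this function bounds the order of vanishing of \<open>P\<close> at infinity.

  For \<open>N = 10\<close> a primitive form is a combination of the cusp form coming from \<open>G\<^sub>1\<^sub>0\<^sup>2\<close>, \<open>\<Delta>\<^sub>4\<^sub>,\<^sub>5(z)\<close> and \<open>\<Delta>\<^sub>4\<^sub>,\<^sub>5(2 z)\<close>. Its
  being an eigenform of \<open>T\<^sub>3\<close> leaves two possibilities; one of them is an oldform, which is excluded because
  the Petersson product is positive definite.
\<close>

section \<open>Liouville's convolution identity\<close>

text \<open>Each identity compares two infinite sequences, so everything depends on fixing a cusp
  form of weight 4 by very few coefficients: none for levels 2 to 4, one for levels 5 to 9, three
  for level 10. Counting zeros at infinity alone is too weak for this. The zeros forced at the other
  cusps have to be counted as well, and this is why the product runs over all translates of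
  \<open>f\<close>, each factor contributing its own order of vanishing. The maximum principle
  yields the constant 5.4 where the valence formula has 6. Level 7 is the tightest case; after
  removal of common factors it rests on 160 < 162.

  Only the weight 2 lattice sum is ever transformed directly. The weight 4 law of \<open>E4\<close>
  is obtained by differentiating the law of \<open>E2\<close> and eliminating the derivatives with
  Ramanujan's identity. The elementary formula for W_1 is thus used twice, for the coefficients of
  the squares of E_2 and for the modularity of E_4.\<close>

definition quads :: "nat \<Rightarrow> (nat \<times> nat \<times> nat \<times> nat) set" where
  "quads n = {(a, b, x, y). a > 0 \<and> b > 0 \<and> x > 0 \<and> y > 0 \<and> a * x + b * y = n}"

lemma finite_quads: "finite (quads n)"
proof (rule finite_subset)
  show "quads n \<subseteq> {..n} \<times> {..n} \<times> {..n} \<times> {..n}"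
  proof (clarsimp simp: quads_def)
    fix a b x y :: nat assume "0 < a" "0 < b" "0 < x" "0 < y"
    then have "a * 1 \<le> a * x" "b * 1 \<le> b * y" "1 * x \<le> a * x" "1 * y \<le> b * y"
      by (intro mult_le_mono; simp)+
    then show "a \<le> a * x + b * y \<and> b \<le> a * x + b * y \<and> x \<le> a * x + b * y \<and> y \<le> a * x + b * y"
      by linarith
  qed
qed auto

abbreviation qsum :: "nat \<Rightarrow> (nat \<Rightarrow> nat \<Rightarrow> nat \<Rightarrow> nat \<Rightarrow> bool) \<Rightarrow>
    (nat \<Rightarrow> nat \<Rightarrow> nat \<Rightarrow> nat \<Rightarrow> int) \<Rightarrow> int" where
  "qsum n P f \<equiv> (\<Sum>(a, b, x, y)\<in>{(a, b, x, y) \<in> quads n. P a b x y}. f a b x y)"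

lemma qsum_split3:
  fixes u v :: "nat \<Rightarrow> nat \<Rightarrow> nat \<Rightarrow> nat \<Rightarrow> nat"
  shows "qsum n (\<lambda>_ _ _ _. True) f = qsum n (\<lambda>a b x y. u a b x y < v a b x y) f
           + qsum n (\<lambda>a b x y. v a b x y < u a b x y) f + qsum n (\<lambda>a b x y. u a b x y = v a b x y) f"
proof -
  let ?A = "{(a, b, x, y) \<in> quads n. u a b x y < v a b x y}"
  let ?B = "{(a, b, x, y) \<in> quads n. v a b x y < u a b x y}"
  let ?C = "{(a, b, x, y) \<in> quads n. u a b x y = v a b x y}"
  have fin: "finite ?A" "finite ?B" "finite ?C"
    by (auto intro: finite_subset[OF _ finite_quads])
  have disj: "?A \<inter> ?B = {}" "(?A \<union> ?B) \<inter> ?C = {}"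
    by auto
  have "{(a, b, x, y) \<in> quads n. True} = (?A \<union> ?B) \<union> ?C"
    by auto
  then show ?thesis
    by (simp only: sum.union_disjoint[OF _ fin(3) disj(2)] sum.union_disjoint[OF fin(1,2) disj(1)] fin finite_Un simp_thms)
qed

lemma qsum_swap: "qsum n P f = qsum n (\<lambda>a b x y. P b a y x) (\<lambda>a b x y. f b a y x)"
  by (rule sum.reindex_bij_witness[where i = "\<lambda>(a, b, x, y). (b, a, y, x)" and j = "\<lambda>(a, b, x, y). (b, a, y, x)"])
     (auto simp: quads_def)

lemma slide_nat_eq:
  assumes "y < (x::nat)"
  shows "a * (x - y) + (a + b) * y = a * x + b * y"
proof -
  obtain k where "x = y + k" using assms less_imp_add_positive by blast
  then show ?thesis by (simp add: algebra_simps)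
qed

text \<open>The value of the form is kept because a x + b y = a (x + y) + (b - a) y. The condition
  \<open>a < b\<close> keeps the new coefficient b - a positive, and it becomes \<open>y < x\<close>
  since the new first variable x + y exceeds y.\<close>

lemma qsum_slide:
  "qsum n (\<lambda>a b x y. a < b) f = qsum n (\<lambda>a b x y. y < x) (\<lambda>a b x y. f a (a + b) (x - y) y)"
proof (rule sum.reindex_bij_witness[where i = "\<lambda>(a, b, x, y). (a, a + b, x - y, y)"
      and j = "\<lambda>(a, b, x, y). (a, b - a, x + y, y)"], goal_cases)
  case (2 t)
  obtain a b x y where t: "t = (a, b, x, y)" by (cases t)
  with 2 have "a < b" "(a, b, x, y) \<in> quads n" by auto
  then obtain k where "b = a + k" "k > 0" using less_imp_add_positive by blast
  then show ?case using 2 unfolding t by (auto simp: quads_def algebra_simps)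
next
  case (4 t)
  then show ?case by (auto simp: quads_def slide_nat_eq)
qed (auto simp: quads_def)

text \<open>With a = b the equation reads a (x + y) = n, so a = d is a divisor of n and x takes the
  n div d - 1 positive values below n div d.\<close>

lemma qsum_diag_ab:
  assumes "n > 0"
  shows "qsum n (\<lambda>a b x y. a = b) (\<lambda>a b x y. f a) = (\<Sum>d | d dvd n. (int (n div d) - 1) * f d)"
proof -
  have "qsum n (\<lambda>a b x y. a = b) (\<lambda>a b x y. f a) = (\<Sum>(d, x)\<in>(SIGMA d:{d. d dvd n}. {0<..<n div d}). f d)"
    by (rule sum.reindex_bij_witness[where i = "\<lambda>(d, x). (d, d, x, n div d - x)" and j = "\<lambda>(a, b, x, y). (a, x)"])
       (use assms in \<open>auto simp: quads_def add_mult_distrib2[symmetric] dvd_imp_le dest: dvd_pos_nat\<close>)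
  also have "\<dots> = (\<Sum>d | d dvd n. \<Sum>x\<in>{0<..<n div d}. f d)"
    using assms by (subst sum.Sigma) auto
  also have "\<dots> = (\<Sum>d | d dvd n. (int (n div d) - 1) * f d)"
  proof (intro sum.cong refl)
    fix d assume "d \<in> {d. d dvd n}"
    then have "n div d > 0" using assms by (auto elim!: dvdE)
    then show "(\<Sum>x\<in>{0<..<n div d}. f d) = (int (n div d) - 1) * f d"
      by (simp add: of_nat_diff)
  qed
  finally show ?thesis .
qed

text \<open>With x = y the equation reads (a + b) x = n; the divisor is now d = a + b.\<close>

lemma qsum_diag_xy:
  assumes "n > 0"
  shows "qsum n (\<lambda>a b x y. x = y) (\<lambda>a b x y. f a b) = (\<Sum>d | d dvd n. \<Sum>a\<in>{0<..<d}. f a (d - a))"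
proof -
  have "qsum n (\<lambda>a b x y. x = y) (\<lambda>a b x y. f a b) = (\<Sum>(d, a)\<in>(SIGMA d:{d. d dvd n}. {0<..<d}). f a (d - a))"
    by (rule sum.reindex_bij_witness[where i = "\<lambda>(d, a). (a, d - a, n div d, n div d)" and j = "\<lambda>(a, b, x, y). (a + b, a)"])
       (use assms in \<open>auto simp: quads_def add_mult_distrib[symmetric] div_greater_zero_iff dvd_imp_le\<close>)
  also have "\<dots> = (\<Sum>d | d dvd n. \<Sum>a\<in>{0<..<d}. f a (d - a))"
    using assms by (subst sum.Sigma) (auto intro: finite_subset[OF _ finite_atMost[of n]] dvd_imp_le)
  finally show ?thesis .
qed

lemma sum_squares_less: "6 * (\<Sum>a\<in>{0<..<d}. (int a)\<^sup>2) = (int d - 1) * int d * (2 * int d - 1)"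
proof (induction d)
  case (Suc d)
  show ?case
  proof (cases "d = 0")
    case False
    then have "{0<..<Suc d} = insert d {0<..<d}" by auto
    then show ?thesis using Suc by (simp add: algebra_simps power2_eq_square)
  qed auto
qed auto

text \<open>Liouville's argument: write \<open>4 a b = (a + b)\<^sup>2 - (a - b)\<^sup>2\<close> and apply the substitution
  \<open>(a, b, x, y) \<mapsto> (a, b - a, x + y, y)\<close> of the solutions of \<open>a x + b y = n\<close>.\<close>
lemma sum_quads_ab:
  assumes "n > 0"
  shows "12 * qsum n (\<lambda>_ _ _ _. True) (\<lambda>a b x y. int a * int b)
    = 5 * (\<Sum>d | d dvd n. int d ^ 3) - 6 * int n * (\<Sum>d | d dvd n. int d) + (\<Sum>d | d dvd n. int d)"
proof -
  let ?all = "\<lambda>_ _ _ _ :: nat. True"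
  have 1: "4 * qsum n ?all (\<lambda>a b x y. int a * int b) =
      qsum n ?all (\<lambda>a b x y. (int a + int b)\<^sup>2) - qsum n ?all (\<lambda>a b x y. (int a - int b)\<^sup>2)"
    unfolding sum_distrib_left sum_subtractf[symmetric]
    by (intro sum.cong refl) (auto simp: power2_eq_square algebra_simps)
  have sub: "qsum n (\<lambda>a b x y. b < a) (\<lambda>a b x y. (int a)\<^sup>2) = qsum n (\<lambda>a b x y. a < b) (\<lambda>a b x y. (int b)\<^sup>2)"
    by (rule qsum_swap)
  have sl1: "qsum n (\<lambda>a b x y. a < b) (\<lambda>a b x y. (int b)\<^sup>2) = qsum n (\<lambda>a b x y. y < x) (\<lambda>a b x y. (int a + int b)\<^sup>2)"
    by (subst qsum_slide) simp
  have sw1: "qsum n (\<lambda>a b x y. x < y) (\<lambda>a b x y. (int a + int b)\<^sup>2) = qsum n (\<lambda>a b x y. y < x) (\<lambda>a b x y. (int a + int b)\<^sup>2)"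
    by (subst qsum_swap) (simp add: add.commute)
  \<comment> \<open>Splitting by x against y, the two off-diagonal parts agree by symmetry. The
    slide identifies the part \<open>y < x\<close> of (a + b)^2 with the part \<open>a < b\<close>
    of b^2, since the slid second coefficient is a + b.\<close>
  have 2: "qsum n ?all (\<lambda>a b x y. (int a + int b)\<^sup>2) =
      2 * qsum n (\<lambda>a b x y. b < a) (\<lambda>a b x y. (int a)\<^sup>2) + (\<Sum>d | d dvd n. (int d - 1) * (int d)\<^sup>2)"
  proof -
    have "qsum n (\<lambda>a b x y. x = y) (\<lambda>a b x y. (int a + int b)\<^sup>2) = (\<Sum>d | d dvd n. \<Sum>a\<in>{0<..<d}. (int a + int (d - a))\<^sup>2)"
      by (rule qsum_diag_xy[OF assms])
    also have "\<dots> = (\<Sum>d | d dvd n. \<Sum>a\<in>{0<..<d}. (int d)\<^sup>2)"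
      by (intro sum.cong refl) (auto simp: of_nat_diff)
    also have "\<dots> = (\<Sum>d | d dvd n. (int d - 1) * (int d)\<^sup>2)"
    proof (intro sum.cong refl)
      fix d assume "d \<in> {d. d dvd n}"
      then have "d > 0" using assms by (auto dest: dvd_pos_nat)
      then show "(\<Sum>a\<in>{0<..<d}. (int d)\<^sup>2) = (int d - 1) * (int d)\<^sup>2" by (simp add: of_nat_diff)
    qed
    finally show ?thesis
      using qsum_split3[where n = n and f = "\<lambda>a b x y. (int a + int b)\<^sup>2" and u = "\<lambda>a b x y. x" and v = "\<lambda>a b x y. y"] sub sl1 sw1 by simp
  qed
  have sl2: "qsum n (\<lambda>a b x y. a < b) (\<lambda>a b x y. (int a - int b)\<^sup>2) = qsum n (\<lambda>a b x y. y < x) (\<lambda>a b x y. (int b)\<^sup>2)"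
    by (subst qsum_slide) simp
  have sw2: "qsum n (\<lambda>a b x y. b < a) (\<lambda>a b x y. (int a - int b)\<^sup>2) = qsum n (\<lambda>a b x y. a < b) (\<lambda>a b x y. (int a - int b)\<^sup>2)"
    by (subst qsum_swap) (simp add: power2_commute)
  have sw3: "qsum n (\<lambda>a b x y. y < x) (\<lambda>a b x y. (int b)\<^sup>2) = qsum n (\<lambda>a b x y. x < y) (\<lambda>a b x y. (int a)\<^sup>2)"
    by (rule qsum_swap)
  have z: "qsum n (\<lambda>a b x y. a = b) (\<lambda>a b x y. (int a - int b)\<^sup>2) = 0"
    by (intro sum.neutral) auto
  have 3: "qsum n ?all (\<lambda>a b x y. (int a - int b)\<^sup>2) = 2 * qsum n (\<lambda>a b x y. x < y) (\<lambda>a b x y. (int a)\<^sup>2)"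
    using qsum_split3[where n = n and f = "\<lambda>a b x y. (int a - int b)\<^sup>2" and u = "\<lambda>a b x y. a" and v = "\<lambda>a b x y. b"] sl2 sw2 sw3 z by simp
  have sl3: "qsum n (\<lambda>a b x y. a < b) (\<lambda>a b x y. (int a)\<^sup>2) = qsum n (\<lambda>a b x y. y < x) (\<lambda>a b x y. (int a)\<^sup>2)"
    by (rule qsum_slide)
  \<comment> \<open>The sum of a^2 over all solutions is split twice, by a against b and by x
    against y. The slide makes the parts \<open>a < b\<close> and \<open>y < x\<close> equal, so
    they cancel. What remains is exactly the difference of off-diagonal sums occurring in 2 and 3,
    expressed by the two diagonals.\<close>
  have 4: "qsum n (\<lambda>a b x y. x < y) (\<lambda>a b x y. (int a)\<^sup>2) - qsum n (\<lambda>a b x y. b < a) (\<lambda>a b x y. (int a)\<^sup>2)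
      = (\<Sum>d | d dvd n. (int (n div d) - 1) * (int d)\<^sup>2) - (\<Sum>d | d dvd n. \<Sum>a\<in>{0<..<d}. (int a)\<^sup>2)"
    using qsum_split3[where n = n and f = "\<lambda>a b x y. (int a)\<^sup>2" and u = "\<lambda>a b x y. a" and v = "\<lambda>a b x y. b"]
      qsum_split3[where n = n and f = "\<lambda>a b x y. (int a)\<^sup>2" and u = "\<lambda>a b x y. x" and v = "\<lambda>a b x y. y"] sl3
      qsum_diag_ab[OF assms, of "\<lambda>a. (int a)\<^sup>2"] qsum_diag_xy[OF assms, of "\<lambda>a b. (int a)\<^sup>2"] by simp
  have 5: "12 * qsum n ?all (\<lambda>a b x y. int a * int b) =
     (\<Sum>d | d dvd n. 6 * (\<Sum>a\<in>{0<..<d}. (int a)\<^sup>2) - 6 * (int (n div d) - 1) * (int d)\<^sup>2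
       + 3 * ((int d - 1) * (int d)\<^sup>2))"
    using 1 2 3 4 unfolding sum.distrib sum_subtractf sum_distrib_left[symmetric] mult.assoc by linarith
  also have "\<dots> = (\<Sum>d | d dvd n. 5 * int d ^ 3 - 6 * int n * int d + int d)"
  proof (intro sum.cong refl)
    fix d assume "d \<in> {d. d dvd n}"
    then have "int n = int d * int (n div d)" by (simp flip: of_nat_mult)
    then show "6 * (\<Sum>a\<in>{0<..<d}. (int a)\<^sup>2) - 6 * (int (n div d) - 1) * (int d)\<^sup>2 + 3 * ((int d - 1) * (int d)\<^sup>2)
       = 5 * int d ^ 3 - 6 * int n * int d + int d"
      unfolding sum_squares_less by (simp add: power2_eq_square power3_eq_cube algebra_simps)
  qed
  also have "\<dots> = 5 * (\<Sum>d | d dvd n. int d ^ 3) - 6 * int n * (\<Sum>d | d dvd n. int d) + (\<Sum>d | d dvd n. int d)"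
    by (simp add: sum.distrib sum_subtractf sum_distrib_left)
  finally show ?thesis .
qed

text \<open>A solution of a x + b y = n amounts to a value i = a x together with a divisor a of i
  and a divisor b of n - i. The sum of a b is therefore W_1(n).\<close>

lemma sum_quads_ab_conv:
  "qsum n (\<lambda>_ _ _ _. True) (\<lambda>a b x y. int a * int b) =
     (\<Sum>i\<in>{0<..<n}. (\<Sum>d | d dvd i. int d) * (\<Sum>d | d dvd (n - i). int d))"
proof -
  have "qsum n (\<lambda>_ _ _ _. True) (\<lambda>a b x y. int a * int b) =
     (\<Sum>(i, a, b)\<in>(SIGMA i:{0<..<n}. {a. a dvd i} \<times> {b. b dvd n - i}). int a * int b)"
    by (rule sum.reindex_bij_witness[where i = "\<lambda>(i, a, b). (a, b, i div a, (n - i) div b)" and j = "\<lambda>(a, b, x, y). (a * x, a, b)"])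
       (auto simp: quads_def dvd_div_eq_0_iff intro!: Nat.gr0I)
  also have "\<dots> = (\<Sum>i\<in>{0<..<n}. \<Sum>(a, b)\<in>{a. a dvd i} \<times> {b. b dvd n - i}. int a * int b)"
    by (subst sum.Sigma) auto
  also have "\<dots> = (\<Sum>i\<in>{0<..<n}. (\<Sum>d | d dvd i. int d) * (\<Sum>d | d dvd (n - i). int d))"
    by (simp add: sum_product sum.cartesian_product)
  finally show ?thesis .
qed

section \<open>Lattice sums and the inversion of the weight 2 Eisenstein series\<close>

lemma finite_int_set_bounded:
  assumes "finite (X :: int set)"
  shows "\<exists>K::nat. \<forall>x\<in>X. \<bar>x\<bar> < int K"
proof -
  obtain b where "\<forall>x\<in>X. \<bar>x\<bar> \<le> b"
    using bdd_above_finite[of "abs ` X"] assms by (auto simp: bdd_above_def)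
  then show ?thesis by (intro exI[of _ "nat (b + 1)"]) auto
qed

text \<open>Turns unconditional sums into limits of explicit partial sums. The half-open intervals
  suit telescoping in d; the symmetric ones without 0 pair c with -c, which is what makes the sum of
  1/(c z + d) over c converge.\<close>

lemma filterlim_symmetric_intervals:
  "filterlim (\<lambda>M::nat. {- int M..<int M}) (finite_subsets_at_top UNIV) sequentially"
  "filterlim (\<lambda>M::nat. {- int M..int M} - {0}) (finite_subsets_at_top (UNIV - {0})) sequentially"
proof -
  have "eventually (\<lambda>M. X \<subseteq> {- int M..<int M} \<and> X \<subseteq> {- int M..int M}) sequentially"
    if X: "finite X" for X
  proof -
    obtain K where K: "\<forall>x\<in>X. \<bar>x\<bar> < int K"
      using finite_int_set_bounded[OF X] by blast
    show ?thesis
      using eventually_ge_at_top[of K] by eventually_elim (use K in force)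
  qed
  note * = this
  show "filterlim (\<lambda>M::nat. {- int M..<int M}) (finite_subsets_at_top UNIV) sequentially"
    unfolding filterlim_finite_subsets_at_top by (auto elim!: eventually_mono dest!: *)
  show "filterlim (\<lambda>M::nat. {- int M..int M} - {0}) (finite_subsets_at_top (UNIV - {0})) sequentially"
    unfolding filterlim_finite_subsets_at_top
  proof safe
    fix X :: "int set" assume X: "finite X" "X \<subseteq> UNIV - {0}"
    show "\<forall>\<^sub>F y in sequentially. finite ({- int y..int y} - {0}) \<and> X \<subseteq> {- int y..int y} - {0} \<and>
             {- int y..int y} - {0} \<subseteq> UNIV - {0}"
      using *[OF X(1)] by eventually_elim (use X in auto)
  qed
qed

lemma has_sum_int_split:
  fixes f :: "int \<Rightarrow> 'a :: {topological_comm_monoid_add, t2_space}"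
  assumes "((\<lambda>n::nat. f (int n)) has_sum A) UNIV" "((\<lambda>n::nat. f (- 1 - int n)) has_sum B) UNIV"
  shows "(f has_sum (A + B)) UNIV"
proof -
  have b1: "bij_betw int UNIV {0..}"
    by (rule bij_betwI[where g = nat]) auto
  have b2: "bij_betw (\<lambda>n. - 1 - int n) UNIV {..<0}"
    by (rule bij_betwI[where g = "\<lambda>x. nat (- 1 - x)"]) auto
  have "(f has_sum A) {0..}" "(f has_sum B) {..<0}"
    using assms has_sum_reindex_bij_betw[OF b1, of f] has_sum_reindex_bij_betw[OF b2, of f] by auto
  then have "(f has_sum (A + B)) ({0..} \<union> {..<0})"
    by (rule has_sum_Un_disjoint) auto
  also have "{0..} \<union> {..<0} = (UNIV :: int set)"
    by auto
  finally show ?thesis .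
qed

lemma summable_on_int_powr:
  assumes "p > 1"
  shows "(\<lambda>d::int. (1 + real_of_int \<bar>d\<bar>) powr (- p)) summable_on UNIV"
proof -
  have *: "summable (\<lambda>n. real n powr (- p))"
    using assms by (simp add: summable_real_powr_iff)
  have 1: "summable (\<lambda>n. (1 + real n) powr (- p))"
    using summable_ignore_initial_segment[OF *, of 1] by (simp add: add.commute)
  have 2: "summable (\<lambda>n. (2 + real n) powr (- p))"
    using summable_ignore_initial_segment[OF *, of 2] by (simp add: add.commute)
  have "(\<lambda>n. (1 + real n) powr (- p)) summable_on UNIV" "(\<lambda>n. (2 + real n) powr (- p)) summable_on UNIV"
    using 1 2 by (auto intro!: summable_nonneg_imp_summable_on)
  then obtain A B where "((\<lambda>n. (1 + real n) powr (- p)) has_sum A) UNIV" "((\<lambda>n. (2 + real n) powr (- p)) has_sum B) UNIV"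
    by (auto simp: summable_on_def)
  then have "((\<lambda>d::int. (1 + real_of_int \<bar>d\<bar>) powr (- p)) has_sum (A + B)) UNIV"
    by (intro has_sum_int_split) (simp_all add: add_ac abs_if)
  then show ?thesis
    by (auto simp: summable_on_def)
qed

section \<open>Reflection formulas for the digamma and trigamma functions, and the Lipschitz
  sum\<close>

lemma Digamma_reflection:
  fixes z :: complex
  assumes "z \<notin> \<int>"
  shows "Digamma (1 - z) - Digamma z = of_real pi * cot (of_real pi * z)"
proof -
  have z: "z \<notin> \<int>\<^sub>\<le>\<^sub>0" "1 - z \<notin> \<int>\<^sub>\<le>\<^sub>0"
    using assms nonpos_Ints_Int Ints_diff[OF Ints_1, of "1 - z"] by auto
  \<comment> \<open>Both sides of the reflection formula for the reciprocal Gamma function are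
    differentiated. Dividing the derivative by the function gives the digamma difference on one side
    and pi cot(pi z) on the other.\<close>
  have "((\<lambda>z. rGamma z * rGamma (1 - z)) has_field_derivative
      rGamma z * rGamma (1 - z) * (Digamma (1 - z) - Digamma z)) (at z)"
    using z by (auto intro!: derivative_eq_intros has_field_derivative_rGamma_no_nonpos_int
        has_field_derivative_rGamma_no_nonpos_int[THEN DERIV_chain2] simp: algebra_simps)
  moreover have "((\<lambda>z. sin (of_real pi * z) / of_real pi) has_field_derivative cos (of_real pi * z)) (at z)"
    by (auto intro!: derivative_eq_intros)
  ultimately have "sin (of_real pi * z) / of_real pi * (Digamma (1 - z) - Digamma z) = cos (of_real pi * z)"
    unfolding rGamma_reflection_complex by (rule DERIV_unique)
  moreover have "sin (of_real pi * z) \<noteq> 0"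
    using assms by (auto simp: sin_eq_0 mult.commute)
  ultimately show ?thesis
    by (simp add: cot_def field_simps)
qed

text \<open>The limit formulas for \<open>Digamma (1 - z)\<close> and \<open>Digamma z\<close> are
  subtracted: the logarithms cancel and the remaining terms pair up c with -c.\<close>

lemma cot_partial_fractions:
  fixes z :: complex
  assumes "z \<notin> \<int>"
  shows "(\<lambda>n. \<Sum>c=1..n. 1 / (z + of_nat c) + 1 / (z - of_nat c)) \<longlonglongrightarrow> of_real pi * cot (of_real pi * z) - 1 / z"
proof -
  have nz: "z \<noteq> of_int k" for k using assms by auto
  have "z \<noteq> 0" "1 - z \<noteq> 0" using nz[of 0] nz[of 1] by auto
  then have "(\<lambda>m. (of_real (ln (real m)) - (\<Sum>n<m. inverse (1 - z + of_nat n)))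
       - (of_real (ln (real m)) - (\<Sum>n<m. inverse (z + of_nat n)))) \<longlonglongrightarrow> Digamma (1 - z) - Digamma z"
    by (intro tendsto_diff Digamma_LIMSEQ)
  then have "(\<lambda>m. (\<Sum>n<Suc m. inverse (z + of_nat n)) - (\<Sum>n<Suc m. inverse (1 - z + of_nat n))) \<longlonglongrightarrow> Digamma (1 - z) - Digamma z"
    by (subst (asm) filterlim_sequentially_Suc[symmetric]) (simp add: algebra_simps)
  note lim1 = this
  \<comment> \<open>The second sum reaches the term c = m + 1, the first only c = m. This leaves one
    unpaired term, which tends to 0.\<close>
  have eq: "(\<Sum>n<Suc m. inverse (z + of_nat n)) - (\<Sum>n<Suc m. inverse (1 - z + of_nat n)) =
     1 / z + (\<Sum>c=1..m. 1 / (z + of_nat c) + 1 / (z - of_nat c)) - inverse (of_nat (Suc m) - z)" for m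
  proof (induction m)
    case (Suc m)
    have "1 / (z - of_nat (Suc m)) = - inverse (of_nat (Suc m) - z)"
      by (metis inverse_eq_divide inverse_minus_eq minus_diff_eq)
    then show ?case using Suc by (simp add: inverse_eq_divide algebra_simps)
  qed (simp add: inverse_eq_divide)
  have lim0: "(\<lambda>m. inverse (of_nat (Suc m) - z)) \<longlonglongrightarrow> 0"
  proof (rule filterlim_compose[OF tendsto_inverse_0])
    have "filterlim (\<lambda>m. of_nat (Suc m) + - z) at_infinity sequentially"
      by (rule tendsto_add_filterlim_at_infinity'[OF filterlim_compose[OF tendsto_of_nat filterlim_Suc] tendsto_const])
    then show "filterlim (\<lambda>m. of_nat (Suc m) - z) at_infinity sequentially" by simp
  qed
  note tendsto_diff[OF tendsto_add[OF lim1[unfolded eq] lim0] tendsto_const[of "1 / z"]]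
  then show ?thesis
    by (simp add: Digamma_reflection[OF assms])
qed

text \<open>The derivative of the digamma reflection formula. Its left side is the sum of 1/(z +
  d)^2 over all integers d, cut into d >= 0 and d <= -1.\<close>

lemma Polygamma_1_reflection:
  fixes z :: complex
  assumes "z \<notin> \<int>"
  shows "Polygamma 1 z + Polygamma 1 (1 - z) = (of_real pi)\<^sup>2 / (sin (of_real pi * z))\<^sup>2"
proof -
  have z: "z \<notin> \<int>\<^sub>\<le>\<^sub>0" "1 - z \<notin> \<int>\<^sub>\<le>\<^sub>0"
    using assms nonpos_Ints_Int Ints_diff[OF Ints_1, of "1 - z"] by auto
  have s: "sin (of_real pi * z) \<noteq> 0"
    using assms by (auto simp: sin_eq_0 mult.commute)
  have "((\<lambda>z. Digamma (1 - z) - Digamma z) has_field_derivative - Polygamma 1 (1 - z) - Polygamma 1 z) (at z)"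
    using z by (auto intro!: derivative_eq_intros has_field_derivative_Polygamma[THEN DERIV_chain2] has_field_derivative_Polygamma)
  then have "((\<lambda>z. of_real pi * cot (of_real pi * z)) has_field_derivative - Polygamma 1 (1 - z) - Polygamma 1 z) (at z)"
    by (rule has_field_derivative_transform_within_open[where S = "- \<int>"])
       (use assms in \<open>auto simp: Digamma_reflection\<close>)
  moreover have "((\<lambda>z. of_real pi * cot (of_real pi * z)) has_field_derivative
      of_real pi * (- inverse ((sin (of_real pi * z))\<^sup>2) * of_real pi)) (at z)"
    using s by (auto intro!: derivative_eq_intros DERIV_cot[THEN DERIV_chain2])
  ultimately have "- Polygamma 1 (1 - z) - Polygamma 1 z = of_real pi * (- inverse ((sin (of_real pi * z))\<^sup>2) * of_real pi)"
    by (rule DERIV_unique)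
  then have "Polygamma 1 z + Polygamma 1 (1 - z) = of_real pi * (inverse ((sin (of_real pi * z))\<^sup>2) * of_real pi)"
    by (simp add: algebra_simps minus_equation_iff eq_neg_iff_add_eq_0)
  then show ?thesis
    by (simp add: power2_eq_square field_simps)
qed

text \<open>The function pi^2 / sin^2(pi z) written in q = exp(2 pi i z); it is the value of the sum
  of 1/(z + d)^2 over the integers d.\<close>

definition lip :: "complex \<Rightarrow> complex" where
  "lip z = - 4 * of_real pi ^ 2 * (exp (2 * of_real pi * \<i> * z) / (1 - exp (2 * of_real pi * \<i> * z))\<^sup>2)"

text \<open>The imaginary part of c z + d controls c, and then the triangle inequality controls
  d.\<close>

lemma lattice_lower_bound:
  assumes "Im z > 0"
  shows "\<exists>K>0. \<forall>c d. real_of_int \<bar>c\<bar> + real_of_int \<bar>d\<bar> \<le> K * norm (of_int c * z + of_int d)"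
proof (intro exI conjI allI)
  show "0 < 1 / Im z + 1 + norm z / Im z"
    using assms by (intro add_pos_nonneg) (auto intro!: divide_nonneg_nonneg)
  fix c d :: int
  let ?w = "of_int c * z + of_int d"
  have "\<bar>Im ?w\<bar> \<le> norm ?w" by (rule abs_Im_le_cmod)
  then have 1: "real_of_int \<bar>c\<bar> \<le> norm ?w / Im z"
    using assms by (simp add: abs_mult field_simps)
  have "real_of_int \<bar>d\<bar> = norm (?w - of_int c * z)"
    by simp
  also have "\<dots> \<le> norm ?w + real_of_int \<bar>c\<bar> * norm z"
    using norm_triangle_ineq4[of ?w "of_int c * z"] by (simp add: norm_mult)
  also have "\<dots> \<le> norm ?w + norm ?w / Im z * norm z"
    using 1 by (intro add_left_mono mult_right_mono) auto
  finally show "real_of_int \<bar>c\<bar> + real_of_int \<bar>d\<bar> \<le> (1 / Im z + 1 + norm z / Im z) * norm ?w"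
    using 1 by (simp add: algebra_simps)
qed

lemma lattice_nonzero:
  assumes "Im z > 0" "c \<noteq> 0 \<or> d \<noteq> 0"
  shows "of_int c * z + of_int d \<noteq> 0"
proof
  assume "of_int c * z + of_int d = 0"
  then have "Im (of_int c * z + of_int d) = 0" "Re (of_int c * z + of_int d) = 0" by simp_all
  then show False using assms by auto
qed

lemma lipschitz_formula:
  assumes z: "Im z > 0"
  shows "((\<lambda>d::int. 1 / (z + of_int d)\<^sup>2) has_sum lip z) UNIV"
proof -
  have zi: "z \<notin> \<int>" using z by (auto elim!: Ints_cases)
  obtain K where K: "K > 0" "\<And>c d. real_of_int \<bar>c\<bar> + real_of_int \<bar>d\<bar> \<le> K * norm (of_int c * z + of_int d)"
    using lattice_lower_bound[OF z] by blast
  have "(\<lambda>d::int. norm (1 / (z + of_int d)\<^sup>2)) summable_on UNIV"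
  proof (rule Infinite_Sum.abs_summable_on_comparison_test')
    show "(\<lambda>d::int. K\<^sup>2 * (1 + real_of_int \<bar>d\<bar>) powr (- 2)) summable_on UNIV"
      by (intro summable_on_cmult_right summable_on_int_powr) auto
    fix d :: int
    have "1 + real_of_int \<bar>d\<bar> \<le> K * norm (z + of_int d)"
      using K(2)[of 1 d] by simp
    then have "(1 + real_of_int \<bar>d\<bar>)\<^sup>2 \<le> (K * norm (z + of_int d))\<^sup>2"
      by (intro power_mono) auto
    moreover have "norm (z + of_int d) > 0"
      using lattice_nonzero[OF z, of 1 d] by simp
    ultimately have "1 / (norm (z + of_int d))\<^sup>2 \<le> K\<^sup>2 / (1 + real_of_int \<bar>d\<bar>)\<^sup>2"
      by (simp add: field_simps power_mult_distrib)
    then show "norm (1 / (z + of_int d)\<^sup>2) \<le> K\<^sup>2 * (1 + real_of_int \<bar>d\<bar>) powr (- 2)"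
      by (simp add: norm_divide norm_power powr_minus divide_simps powr_numeral)
  qed
  then have summ: "(\<lambda>d::int. 1 / (z + of_int d)\<^sup>2) summable_on UNIV"
    by (rule abs_summable_summable)
  have b1: "bij_betw int UNIV {0..}"
    by (rule bij_betwI[where g = nat]) auto
  have b2: "bij_betw (\<lambda>n. - 1 - int n) UNIV {..<0}"
    by (rule bij_betwI[where g = "\<lambda>x. nat (- 1 - x)"]) auto
  have "(\<lambda>n. 1 / (z + of_int (int n))\<^sup>2) summable_on UNIV"
    using summable_on_subset[OF summ, of "{0..}"] summable_on_reindex_bij_betw[OF b1, of "\<lambda>d. 1 / (z + of_int d)\<^sup>2"] by blast
  then obtain A where A: "((\<lambda>n. 1 / (z + of_int (int n))\<^sup>2) has_sum A) UNIV"
    by (auto simp: summable_on_def)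
  have "(\<lambda>n. 1 / (z + of_int (- 1 - int n))\<^sup>2) summable_on UNIV"
    using summable_on_subset[OF summ, of "{..<0}"] summable_on_reindex_bij_betw[OF b2, of "\<lambda>d. 1 / (z + of_int d)\<^sup>2"] by blast
  then obtain B where B: "((\<lambda>n. 1 / (z + of_int (- 1 - int n))\<^sup>2) has_sum B) UNIV"
    by (auto simp: summable_on_def)
  have "z \<noteq> 0" "1 - z \<noteq> 0" using z by (auto simp: complex_eq_iff)
  then have P: "(\<lambda>n. inverse ((z + of_nat n)\<^sup>2)) sums Polygamma 1 z" "(\<lambda>n. inverse ((1 - z + of_nat n)\<^sup>2)) sums Polygamma 1 (1 - z)"
    using Polygamma_LIMSEQ[of z 1] Polygamma_LIMSEQ[of "1 - z" 1] by (auto simp: numeral_2_eq_2)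
  have "A = Polygamma 1 z"
    by (rule sums_unique2[OF has_sum_imp_sums[OF A]]) (use P(1) in \<open>simp add: inverse_eq_divide\<close>)
  moreover have "1 / (z + of_int (- 1 - int n))\<^sup>2 = inverse ((1 - z + of_nat n)\<^sup>2)" for n
  proof -
    have "z + of_int (- 1 - int n) = - (1 - z + of_nat n)" by simp
    then show ?thesis by (simp only: power2_minus inverse_eq_divide)
  qed
  then have "B = Polygamma 1 (1 - z)"
    using has_sum_imp_sums[OF B] P(2) by (simp add: sums_unique2)
  ultimately have AB: "A + B = (of_real pi)\<^sup>2 / (sin (of_real pi * z))\<^sup>2"
    using Polygamma_1_reflection[OF zi] by simp
  define e where "e = exp (of_real pi * \<i> * z)"
  have e: "e \<noteq> 0" "exp (2 * of_real pi * \<i> * z) = e\<^sup>2"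
    unfolding e_def by (auto simp: exp_double[symmetric] mult_ac)
  have sin: "sin (of_real pi * z) = (e - 1 / e) / (2 * \<i>)"
    unfolding sin_exp_eq e_def by (simp add: exp_minus mult_ac inverse_eq_divide)
  have "sin (of_real pi * z) \<noteq> 0"
    using zi by (auto simp: sin_eq_0 mult.commute)
  then have "e - 1 / e \<noteq> 0" using sin by auto
  then have e2: "e\<^sup>2 \<noteq> 1" using e by (auto simp: power2_eq_square field_simps)
  have "(e - 1 / e)\<^sup>2 = (1 - e\<^sup>2)\<^sup>2 / e\<^sup>2"
    using e by (simp add: field_simps power2_eq_square)
  then have "A + B = lip z"
    unfolding AB sin lip_def e(2) using e e2 by (simp add: power_divide power_mult_distrib field_simps)
  then show ?thesis
    using has_sum_int_split[OF A B] by simp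
qed

lemma lipschitz_formula_int:
  assumes z: "Im z > 0" and c: "c \<noteq> 0"
  shows "((\<lambda>d::int. 1 / (of_int c * z + of_int d)\<^sup>2) has_sum lip (of_int \<bar>c\<bar> * z)) UNIV"
proof (cases "c > 0")
  case True
  then show ?thesis using lipschitz_formula[of "of_int c * z"] z by simp
next
  case False
  then have "((\<lambda>d::int. 1 / (of_int (- c) * z + of_int d)\<^sup>2) has_sum lip (of_int (- c) * z)) UNIV"
    using z c by (intro lipschitz_formula) (simp add: mult_neg_pos)
  then have "((\<lambda>d::int. 1 / (of_int (- c) * z + of_int (- d))\<^sup>2) has_sum lip (of_int (- c) * z)) UNIV"
    using has_sum_reindex_bij_betw[of uminus "UNIV::int set" UNIV "\<lambda>d::int. 1 / (of_int (- c) * z + of_int d)\<^sup>2"]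
    by (auto intro: bij_uminus)
  moreover have "(of_int (- c) * z + of_int (- d))\<^sup>2 = (of_int c * z + of_int d)\<^sup>2" for d :: int
    by (simp add: power2_eq_square algebra_simps)
  ultimately show ?thesis using False by simp
qed

lemma has_sum_int_nonzero_even:
  fixes f :: "nat \<Rightarrow> complex"
  assumes "((\<lambda>c::int. f (nat \<bar>c\<bar>)) has_sum S) (UNIV - {0})"
  shows "f summable_on {1..}" "S = 2 * infsum f {1..}"
proof -
  have b1: "bij_betw int {1..} {1..}"
    by (rule bij_betwI[where g = nat]) auto
  have b2: "bij_betw (\<lambda>n. - int n) {1..} {..-1}"
    by (rule bij_betwI[where g = "\<lambda>x. nat (- x)"]) auto
  have summ: "(\<lambda>c::int. f (nat \<bar>c\<bar>)) summable_on (UNIV - {0})"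
    using assms by (auto simp: summable_on_def)
  then have "(\<lambda>c::int. f (nat \<bar>c\<bar>)) summable_on {1..}"
    by (rule summable_on_subset) auto
  then show f: "f summable_on {1..}"
    using summable_on_reindex_bij_betw[OF b1, of "\<lambda>c::int. f (nat \<bar>c\<bar>)"] by simp
  then have "(f has_sum infsum f {1..}) {1..}" by simp
  then have "((\<lambda>c::int. f (nat \<bar>c\<bar>)) has_sum infsum f {1..}) {1..}" "((\<lambda>c::int. f (nat \<bar>c\<bar>)) has_sum infsum f {1..}) {..-1}"
    using has_sum_reindex_bij_betw[OF b1, of "\<lambda>c::int. f (nat \<bar>c\<bar>)"] has_sum_reindex_bij_betw[OF b2, of "\<lambda>c::int. f (nat \<bar>c\<bar>)"]
    by auto
  then have "((\<lambda>c::int. f (nat \<bar>c\<bar>)) has_sum (infsum f {1..} + infsum f {1..})) ({1..} \<union> {..-1})"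
    by (rule has_sum_Un_disjoint) auto
  also have "{1..} \<union> {..-1} = UNIV - {0::int}" by auto
  finally show "S = 2 * infsum f {1..}"
    using has_sum_unique[OF assms] by simp
qed

section \<open>The conditionally convergent weight 2 lattice sum in both orders\<close>

lemma Im_neg_inverse_pos: "Im z > 0 \<Longrightarrow> Im (- 1 / z) > 0"
  by (auto simp: Im_divide intro!: divide_pos_pos add_nonneg_pos)

text \<open>Eisenstein's device. For w = c z + d the terms 1/w^2 and 1/(w^2 (w + 1)) differ by a
  difference of neighbours in d. The cubic terms are absolutely summable over the lattice, whereas
  the sum of 1/w^2 depends on the order of summation.\<close>

lemma telescope_identity:
  fixes w :: complex
  assumes "w \<noteq> 0" "w + 1 \<noteq> 0"
  shows "1 / w\<^sup>2 - 1 / (w\<^sup>2 * (w + 1)) = 1 / w - 1 / (w + 1)"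
  using assms by (simp add: divide_simps) (simp add: power2_eq_square)

text \<open>By the lower bound for c z + d the terms are of cubic order in |c| + |d|. Sharing the
  exponent 3 equally between the variables bounds the series by a product of two convergent series
  with exponent 3/2.\<close>

lemma lattice_double_summable:
  assumes z: "Im z > 0"
  shows "(\<lambda>(c, d). 1 / ((of_int c * z + of_int d)\<^sup>2 * (of_int c * z + of_int (d + 1)))) summable_on ((UNIV - {0}) \<times> (UNIV :: int set))"
proof -
  obtain K where K: "K > 0" "\<And>c d. real_of_int \<bar>c\<bar> + real_of_int \<bar>d\<bar> \<le> K * norm (of_int c * z + of_int d)"
    using lattice_lower_bound[OF z] by blast
  define X where "X = (\<lambda>c::int. 1 + real_of_int \<bar>c\<bar>)"
  have X1: "X c \<ge> 1" for c by (simp add: X_def)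
  define C where "C = 2 * K ^ 3 * 4 powr (3/2)"
  have s: "(\<lambda>d. X d powr (- (3/2))) summable_on UNIV"
    unfolding X_def by (rule summable_on_int_powr) auto
  then obtain S where S: "((\<lambda>d. X d powr (- (3/2))) has_sum S) UNIV"
    by (auto simp: summable_on_def)
  have "(\<lambda>x. norm (case x of (c, d) \<Rightarrow> 1 / ((of_int c * z + of_int d)\<^sup>2 * (of_int c * z + of_int (d + 1)))))
      summable_on ((UNIV - {0}) \<times> (UNIV :: int set))"
  proof (rule Infinite_Sum.abs_summable_on_comparison_test')
    show "(\<lambda>(c, d). C * X c powr (- (3/2)) * X d powr (- (3/2))) summable_on ((UNIV - {0}) \<times> (UNIV :: int set))"
    proof (rule summable_on_SigmaI)
      show "((\<lambda>d. case (c, d) of (c, d) \<Rightarrow> C * X c powr (- (3/2)) * X d powr (- (3/2))) has_sum (C * X c powr (- (3/2)) * S)) UNIV" for c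
        using has_sum_cmult_right[OF S] by simp
      have "(\<lambda>d. X d powr (- (3/2))) summable_on UNIV - {0}"
        using s by (rule summable_on_subset) auto
      then show "(\<lambda>c. C * X c powr (- (3/2)) * S) summable_on UNIV - {0}"
        by (intro summable_on_cmult_left summable_on_cmult_right)
    qed (use K in \<open>auto simp: C_def\<close>)
    fix x :: "int \<times> int" assume "x \<in> (UNIV - {0}) \<times> UNIV"
    then obtain c d where x: "x = (c, d)" "c \<noteq> 0" by auto
    define w where "w = norm (of_int c * z + of_int d)"
    define w' where "w' = norm (of_int c * z + of_int (d + 1))"
    define a where "a = real_of_int \<bar>c\<bar> + real_of_int \<bar>d\<bar>"
    have c1: "\<bar>c\<bar> \<ge> 1" using x by auto
    then have c1': "real_of_int \<bar>c\<bar> \<ge> 1" by linarith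
    \<comment> \<open>Here X c + X d = 2 + |c| + |d|, and the 2 is absorbed because |c| >=
      1.\<close>
    then have a: "a > 0" "a \<ge> (X c + X d) / 3"
      unfolding a_def X_def by (auto simp: field_simps)
    have w: "a \<le> K * w" unfolding a_def w_def by (rule K)
    have "a / 2 \<le> real_of_int \<bar>c\<bar> + real_of_int \<bar>d + 1\<bar>"
    proof -
      have "\<bar>c\<bar> + \<bar>d\<bar> \<le> 2 * (\<bar>c\<bar> + \<bar>d + 1\<bar>)"
      proof -
        have "\<bar>d\<bar> \<le> \<bar>d + 1\<bar> + 1" by (simp add: abs_if)
        moreover have "a \<le> b + 1 \<Longrightarrow> 1 \<le> e \<Longrightarrow> 0 \<le> b \<Longrightarrow> e + a \<le> 2 * (e + b)" for a b e :: int
          by simp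
        ultimately show ?thesis using c1 abs_ge_zero by blast
      qed
      then have "real_of_int (\<bar>c\<bar> + \<bar>d\<bar>) \<le> real_of_int (2 * (\<bar>c\<bar> + \<bar>d + 1\<bar>))"
        by (simp only: of_int_le_iff)
      then show ?thesis by (simp add: a_def)
    qed
    also have "\<dots> \<le> K * w'" unfolding w'_def by (rule K)
    finally have w': "a / 2 \<le> K * w'" .
    have wpos: "w > 0" "w' > 0"
      using w w' a K(1) by (smt (verit) divide_pos_pos mult_nonneg_nonpos)+
    have "a\<^sup>2 * (a / 2) \<le> (K * w)\<^sup>2 * (K * w')"
      using a w w' by (intro mult_mono power_mono) auto
    then have 1: "1 / (w\<^sup>2 * w') \<le> 2 * K ^ 3 / a ^ 3"
      using a wpos K(1) by (simp add: field_simps power2_eq_square power3_eq_cube)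
    have "X c * X d / 4 \<le> ((X c + X d) / 3)\<^sup>2"
    proof -
      have "0 \<le> (X c - X d)\<^sup>2" by simp
      moreover have "0 \<le> X c * X d" using X1[of c] X1[of d] by simp
      moreover have "((X c + X d) / 3)\<^sup>2 - X c * X d / 4 = (X c - X d)\<^sup>2 / 9 + 7 / 36 * (X c * X d)"
        by (simp add: power2_eq_square field_simps)
      ultimately show ?thesis by linarith
    qed
    also have "\<dots> \<le> a\<^sup>2"
      using a X1[of c] X1[of d] by (intro power_mono) auto
    finally have "(X c * X d / 4) powr (3/2) \<le> (a\<^sup>2) powr (3/2)"
      using X1[of c] X1[of d] by (intro powr_mono2) auto
    also have "(a\<^sup>2) powr (3/2) = a ^ 3"
    proof -
      have "(a\<^sup>2) powr (3/2) = (a powr 2) powr (3/2)"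
        using a by (simp add: powr_numeral)
      also have "\<dots> = a powr 3" by (subst powr_powr) simp
      finally show ?thesis using a by (simp add: powr_numeral)
    qed
    finally have 2: "(X c * X d / 4) powr (3/2) \<le> a ^ 3" .
    have "2 * K ^ 3 / a ^ 3 \<le> 2 * K ^ 3 / (X c * X d / 4) powr (3/2)"
      using 2 K(1) a X1[of c] X1[of d] by (intro divide_left_mono) auto
    also have "\<dots> = C * X c powr (- (3/2)) * X d powr (- (3/2))"
      using X1[of c] X1[of d] by (simp add: C_def powr_divide powr_mult powr_minus divide_simps)
    finally show "norm (case x of (c, d) \<Rightarrow> 1 / ((of_int c * z + of_int d)\<^sup>2 * (of_int c * z + of_int (d + 1)))) \<le>
        (case x of (c, d) \<Rightarrow> C * X c powr (- (3/2)) * X d powr (- (3/2)))"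
      using 1 by (simp add: x norm_divide norm_mult norm_power w_def w'_def del: of_int_add)
  qed
  then show ?thesis by (rule abs_summable_summable)
qed

lemma has_sum_inverse_squares_int:
  "((\<lambda>d::int. 1 / (of_int d)\<^sup>2 :: complex) has_sum (of_real pi ^ 2 / 3)) (UNIV - {0})"
proof -
  have s: "((\<lambda>n. 1 / (real n + 1)\<^sup>2) has_sum (pi\<^sup>2 / 6)) UNIV"
    using inverse_squares_sums by (intro norm_summable_imp_has_sum) (auto simp: sums_iff add.commute)
  have s': "((\<lambda>n. of_real (1 / (real n + 1)\<^sup>2) :: complex) has_sum of_real (pi\<^sup>2 / 6)) UNIV"
    by (rule has_sum_of_real[OF s])
  have b1: "bij_betw (\<lambda>n. int n + 1) UNIV {1..}"
    by (rule bij_betwI[where g = "\<lambda>x. nat (x - 1)"]) auto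
  have b2: "bij_betw (\<lambda>n. - int n - 1) UNIV {..-1}"
    by (rule bij_betwI[where g = "\<lambda>x. nat (- x - 1)"]) auto
  let ?f = "\<lambda>d::int. 1 / (of_int d)\<^sup>2 :: complex"
  have "(of_int (- int n - 1))\<^sup>2 = (of_nat n + 1 :: complex)\<^sup>2" for n
    by (simp add: power2_eq_square algebra_simps)
  then have "(?f has_sum of_real (pi\<^sup>2 / 6)) {1..}" "(?f has_sum of_real (pi\<^sup>2 / 6)) {..-1}"
    using s' has_sum_reindex_bij_betw[OF b1, of ?f] has_sum_reindex_bij_betw[OF b2, of ?f] by simp_all
  then have "(?f has_sum (of_real (pi\<^sup>2 / 6) + of_real (pi\<^sup>2 / 6))) ({1..} \<union> {..-1})"
    by (rule has_sum_Un_disjoint) auto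
  also have "{1..} \<union> {..-1} = UNIV - {0::int}" by auto
  finally show ?thesis by (simp add: field_simps)
qed

text \<open>The part c >= 1 of the weight 2 Eisenstein series, summed with d innermost. Twice this
  value plus pi^2/3 is the full series, where pi^2/3 comes from the row c = 0.\<close>

definition lip_sum :: "complex \<Rightarrow> complex" where
  "lip_sum z = infsum (\<lambda>n::nat. lip (of_nat n * z)) {1..}"

text \<open>For fixed c the telescoping part summed over d vanishes, as 1/(c z + d) tends to 0 at
  both ends. The cubic series therefore has the same value as the iterated sum of 1/(c z + d)^2, and
  by absolute convergence it may also be summed in the opposite order, which is the second
  conclusion.\<close>

lemma lip_sum_swap_aux:
  assumes z: "Im z > 0"
  obtains U where
    "((\<lambda>c::int. lip (of_int \<bar>c\<bar> * z)) has_sum U) (UNIV - {0})"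
    "((\<lambda>(d, c). 1 / ((of_int c * z + of_int d)\<^sup>2 * (of_int c * z + of_int (d + 1)))) has_sum U) (UNIV \<times> (UNIV - {0}))"
proof -
  let ?u = "\<lambda>(c, d). 1 / ((of_int c * z + of_int d)\<^sup>2 * (of_int c * z + of_int (d + 1)))"
  obtain U where U: "(?u has_sum U) ((UNIV - {0}) \<times> UNIV)"
    using lattice_double_summable[OF z] by (auto simp: summable_on_def)
  have inner: "((\<lambda>d. ?u (c, d)) has_sum lip (of_int \<bar>c\<bar> * z)) UNIV" if c: "c \<in> UNIV - {0}" for c
  proof -
    let ?w = "\<lambda>d::int. of_int c * z + of_int d"
    have nz: "?w d \<noteq> 0" for d using lattice_nonzero[OF z] c by auto
    have L: "((\<lambda>d. 1 / (?w d)\<^sup>2) has_sum lip (of_int \<bar>c\<bar> * z)) UNIV"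
      using lipschitz_formula_int[OF z] c by simp
    have "(\<lambda>d. ?u (c, d)) summable_on UNIV"
      using summable_on_SigmaD1[of "\<lambda>x y. ?u (x, y)" "UNIV - {0}" "\<lambda>_. UNIV" c] lattice_double_summable[OF z] c by (simp add: case_prod_unfold)
    then obtain V where V: "((\<lambda>d. ?u (c, d)) has_sum V) UNIV"
      by (auto simp: summable_on_def)
    have "((\<lambda>d. 1 / (?w d)\<^sup>2 - ?u (c, d)) has_sum (lip (of_int \<bar>c\<bar> * z) - V)) UNIV"
      using has_sum_add[OF L has_sum_uminusI[OF V]] by simp
    moreover have "1 / (?w d)\<^sup>2 - ?u (c, d) = 1 / ?w d - 1 / ?w (d + 1)" for d
      using telescope_identity[of "?w d"] nz[of d] nz[of "d + 1"] by (simp add: add.assoc)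
    ultimately have "((\<lambda>d. 1 / ?w d - 1 / ?w (d + 1)) has_sum (lip (of_int \<bar>c\<bar> * z) - V)) UNIV"
      by simp
    then have "(\<lambda>M. \<Sum>d\<in>{- int M..<int M}. 1 / ?w d - 1 / ?w (d + 1)) \<longlonglongrightarrow> lip (of_int \<bar>c\<bar> * z) - V"
      unfolding has_sum_def by (rule filterlim_compose[OF _ filterlim_symmetric_intervals(1)])
    moreover have "(\<Sum>d\<in>{- int M..<int M}. 1 / ?w d - 1 / ?w (d + 1)) = 1 / ?w (- int M) - 1 / ?w (int M)" for M
    proof (induction M)
      case (Suc M)
      have "{- int (Suc M)..<int (Suc M)} = insert (- int M - 1) (insert (int M) {- int M..<int M})"
        by auto
      then show ?case using Suc by (simp add: algebra_simps)
    qed simp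
    moreover have "(\<lambda>M. 1 / ?w (- int M) - 1 / ?w (int M)) \<longlonglongrightarrow> 0 - 0"
    proof (intro tendsto_diff tendsto_divide_0[OF tendsto_const])
      have *: "filterlim (\<lambda>M. of_int c * z + of_nat M) at_infinity sequentially" for c
        by (rule tendsto_add_filterlim_at_infinity[OF tendsto_const tendsto_of_nat])
      show "filterlim (\<lambda>M. ?w (int M)) at_infinity sequentially" using * by simp
      have "filterlim (\<lambda>M. (- 1) * (of_int (- c) * z + of_nat M)) at_infinity sequentially"
        by (rule tendsto_mult_filterlim_at_infinity[OF tendsto_const _ *]) simp
      then show "filterlim (\<lambda>M. ?w (- int M)) at_infinity sequentially" by simp
    qed
    ultimately have "lip (of_int \<bar>c\<bar> * z) - V = 0 - 0"
      by (simp only: LIMSEQ_unique)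
    then show ?thesis using V by simp
  qed
  have "((\<lambda>c::int. lip (of_int \<bar>c\<bar> * z)) has_sum U) (UNIV - {0})"
    by (rule has_sum_SigmaD[OF U inner])
  moreover have "((\<lambda>(d, c). 1 / ((of_int c * z + of_int d)\<^sup>2 * (of_int c * z + of_int (d + 1)))) has_sum U) (UNIV \<times> (UNIV - {0}))"
    using U by (subst (asm) has_sum_swap) (simp add: case_prod_unfold)
  ultimately show thesis by (rule that)
qed

lemma lip_sum:
  assumes z: "Im z > 0"
  shows "(\<lambda>n::nat. lip (of_nat n * z)) summable_on {1..}"
    and "((\<lambda>c::int. lip (of_int \<bar>c\<bar> * z)) has_sum (2 * lip_sum z)) (UNIV - {0})"
proof -
  obtain U where U: "((\<lambda>c::int. lip (of_int \<bar>c\<bar> * z)) has_sum U) (UNIV - {0})"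
    using lip_sum_swap_aux[OF z] .
  then have "((\<lambda>c::int. lip (of_nat (nat \<bar>c\<bar>) * z)) has_sum U) (UNIV - {0})"
    by simp
  from has_sum_int_nonzero_even[OF this] U
  show "(\<lambda>n::nat. lip (of_nat n * z)) summable_on {1..}"
    "((\<lambda>c::int. lip (of_int \<bar>c\<bar> * z)) has_sum (2 * lip_sum z)) (UNIV - {0})"
    by (auto simp: lip_sum_def)
qed

lemma norm_exp_2pi_i: "norm (exp (2 * of_real pi * \<i> * w)) = exp (- 2 * pi * Im w)"
  by simp

text \<open>With q = exp(-2 pi i / z), of modulus below 1, the cotangent equals i (1 + q^M) / (1 -
  q^M). The limit is the boundary value of the telescoping sum in the opposite order of
  summation.\<close>

lemma cot_multiple_limit:
  assumes z: "Im z > 0"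
  shows "(\<lambda>M. cot (of_real pi * (of_nat M / z))) \<longlonglongrightarrow> \<i>"
proof -
  define q where "q = exp (2 * of_real pi * \<i> * (- 1 / z))"
  have "Im (- 1 / z) > 0" using z by (rule Im_neg_inverse_pos)
  then have q: "norm q < 1" unfolding q_def norm_exp_2pi_i by (simp add: mult_pos_neg)
  have cot: "cot (of_real pi * (of_nat M / z)) = \<i> * (1 + q ^ M) / (1 - q ^ M)" for M
  proof -
    define e where "e = exp (\<i> * (of_real pi * (of_nat M / z)))"
    have "q ^ M = exp (of_nat M * (2 * of_real pi * \<i> * (- 1 / z)))"
      unfolding q_def by (rule exp_of_nat_mult[symmetric])
    also have "of_nat M * (2 * of_real pi * \<i> * (- 1 / z)) = - (2 * (\<i> * (of_real pi * (of_nat M / z))))"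
      by simp
    finally have qM: "q ^ M = 1 / e\<^sup>2"
      by (simp only: e_def exp_minus exp_double inverse_eq_divide)
    have e: "e \<noteq> 0" "exp (- (\<i> * (of_real pi * (of_nat M / z)))) = 1 / e"
      by (auto simp: e_def exp_minus inverse_eq_divide)
    show ?thesis
    \<comment> \<open>For e^2 = 1, as at M = 0, both sides are quotients by zero and have the
      default value 0.\<close>
    proof (cases "e\<^sup>2 = 1")
      case True
      then have "e = 1 / e" using e by (simp add: field_simps power2_eq_square)
      then show ?thesis
        unfolding cot_def sin_exp_eq cos_exp_eq e(2) qM e_def[symmetric] using True by simp
    next
      case False
      then show ?thesis
        unfolding cot_def sin_exp_eq cos_exp_eq e(2) qM e_def[symmetric] using e
        by (simp add: divide_simps) (simp add: algebra_simps power2_eq_square)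
    qed
  qed
  have "(\<lambda>M. \<i> * (1 + q ^ M) / (1 - q ^ M)) \<longlonglongrightarrow> \<i> * (1 + 0) / (1 - 0)"
    by (intro tendsto_intros LIMSEQ_power_zero q) auto
  then show ?thesis unfolding cot by simp
qed

text \<open>In the opposite order, with d fixed, the sum of 1/(c z + d)^2 over c is again a
  Lipschitz sum, now at -1/z and without its term c = 0. The telescoping part no longer vanishes:
  its boundary values tend to pi i / z at d = M and to the negative of this at d = -M, and together
  they produce the defect 2 pi i / z.\<close>

lemma lip_sum_transformation:
  assumes z: "Im z > 0"
  shows "2 * lip_sum z + of_real pi ^ 2 / 3 =
    (2 * lip_sum (- 1 / z) + of_real pi ^ 2 / 3) / z\<^sup>2 + 2 * of_real pi * \<i> / z"
proof -
  define z' where "z' = - 1 / z"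
  have z': "Im z' > 0" unfolding z'_def using z by (rule Im_neg_inverse_pos)
  have z0: "z \<noteq> 0" using z by auto
  let ?A = "UNIV - {0::int}"
  let ?u = "\<lambda>(d, c). 1 / ((of_int c * z + of_int d)\<^sup>2 * (of_int c * z + of_int (d + 1)))"
  obtain U where U: "((\<lambda>c::int. lip (of_int \<bar>c\<bar> * z)) has_sum U) ?A" "(?u has_sum U) (UNIV \<times> ?A)"
    using lip_sum_swap_aux[OF z] .
  have U_eq: "U = 2 * lip_sum z"
    using has_sum_unique[OF U(1) lip_sum(2)[OF z]] .
  \<comment> \<open>\<open>L d\<close> is the sum of 1/(c z + d)^2 over nonzero c: the whole line
    minus the term c = 0 if d is nonzero, and 2 zeta(2) / z^2 if d = 0. \<open>T d\<close> below is
    the sum of 1/(c z + d) over nonzero c in symmetric order, which is 0 at d = 0.\<close>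
  define L where "L = (\<lambda>d::int. if d = 0 then of_real pi ^ 2 / 3 / z\<^sup>2 else lip (of_int \<bar>d\<bar> * z') / z\<^sup>2 - 1 / (of_int d)\<^sup>2)"
  define T where "T = (\<lambda>d::int. if d = 0 then 0 else (of_real pi * cot (of_real pi * (of_int d / z)) - z / of_int d) / z)"
  have nz: "of_int c * z + of_int d \<noteq> 0" if "c \<in> ?A" for c d :: int
    using lattice_nonzero[OF z] that by auto
  have L: "((\<lambda>c. 1 / (of_int c * z + of_int d)\<^sup>2) has_sum L d) ?A" for d
  proof (cases "d = 0")
    case True
    then show ?thesis
      using has_sum_cmult_right[OF has_sum_inverse_squares_int, of "1 / z\<^sup>2"] by (simp add: L_def power_mult_distrib mult.commute)
  next
    case False
    have "((\<lambda>c::int. 1 / z\<^sup>2 * (1 / (of_int (- d) * z' + of_int c)\<^sup>2)) has_sum (1 / z\<^sup>2 * lip (of_int \<bar>- d\<bar> * z'))) UNIV"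
      using False by (intro has_sum_cmult_right lipschitz_formula_int z') auto
    moreover have "of_int c * z + of_int d = z * (of_int (- d) * z' + of_int c)" for c
      using z0 by (simp add: z'_def field_simps)
    then have "1 / z\<^sup>2 * (1 / (of_int (- d) * z' + of_int c)\<^sup>2) = 1 / (of_int c * z + of_int d)\<^sup>2" for c
      by (simp add: power_mult_distrib)
    ultimately have "((\<lambda>c. 1 / (of_int c * z + of_int d)\<^sup>2) has_sum (lip (of_int \<bar>d\<bar> * z') / z\<^sup>2)) UNIV"
      by simp
    from has_sum_Diff[OF this has_sum_finite[of "{0::int}"]] show ?thesis
      using False by (simp add: L_def)
  qed
  have T_lim: "(\<lambda>C. \<Sum>c\<in>{- int C..int C} - {0}. 1 / (of_int c * z + of_int d)) \<longlonglongrightarrow> T d" for d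
  proof -
    have eq: "(\<Sum>c\<in>{- int C..int C} - {0}. 1 / (of_int c * z + of_int d)) =
        (\<Sum>c=1..C. 1 / (of_nat c * z + of_int d) + 1 / (- of_nat c * z + of_int d))" for C
    proof (induction C)
      case (Suc C)
      have "{- int (Suc C)..int (Suc C)} - {0} = insert (- int C - 1) (insert (int C + 1) ({- int C..int C} - {0}))"
        by auto
      then show ?case using Suc by (simp add: algebra_simps)
    qed simp
    show ?thesis
    proof (cases "d = 0")
      case True
      then show ?thesis unfolding eq by (simp add: T_def)
    next
      case False
      define w where "w = of_int d / z"
      have w: "w \<notin> \<int>"
      proof
        assume "w \<in> \<int>"
        then obtain k where "w = of_int k" by (auto elim: Ints_cases)
        then have "of_int (- k) * z + of_int d = 0" using z0 by (simp add: w_def field_simps)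
        then show False using lattice_nonzero[OF z, of "- k" d] False by auto
      qed
      have 1: "1 / (of_nat c * z + of_int d) + 1 / (- of_nat c * z + of_int d) = (1 / (w + of_nat c) + 1 / (w - of_nat c)) / z" for c
      proof -
        have "of_nat c * z + of_int d = z * (w + of_nat c)" "- of_nat c * z + of_int d = z * (w - of_nat c)"
          using z0 by (simp_all add: w_def field_simps)
        then show ?thesis by (simp add: add_divide_distrib mult.commute)
      qed
      have "(\<lambda>C. (\<Sum>c=1..C. 1 / (w + of_nat c) + 1 / (w - of_nat c)) / z) \<longlonglongrightarrow> (of_real pi * cot (of_real pi * w) - 1 / w) / z"
        by (intro tendsto_divide cot_partial_fractions w tendsto_const z0)
      then show ?thesis
        using False by (simp only: eq 1 T_def if_False w_def sum_divide_distrib) simp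
    qed
  qed
  have inner: "((\<lambda>c. ?u (d, c)) has_sum (L d - (T d - T (d + 1)))) ?A" for d
  proof -
    have "(\<lambda>c. ?u (d, c)) summable_on ?A"
      using summable_on_SigmaD1[of "\<lambda>x y. ?u (x, y)" UNIV "\<lambda>_. ?A" d] U(2) by (auto simp: case_prod_unfold summable_on_def)
    then obtain V where V: "((\<lambda>c. ?u (d, c)) has_sum V) ?A"
      by (auto simp: summable_on_def)
    have H1: "((\<lambda>c. 1 / (of_int c * z + of_int d)\<^sup>2 - ?u (d, c)) has_sum (L d - V)) ?A"
      using has_sum_add[OF L has_sum_uminusI[OF V]] by simp
    have H2: "1 / (of_int c * z + of_int d)\<^sup>2 - ?u (d, c) = 1 / (of_int c * z + of_int d) - 1 / (of_int c * z + of_int (d + 1))" if "c \<in> ?A" for c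
      using telescope_identity[of "of_int c * z + of_int d"] nz[OF that, of d] nz[OF that, of "d + 1"] by (simp add: add.assoc)
    have "((\<lambda>c. 1 / (of_int c * z + of_int d) - 1 / (of_int c * z + of_int (d + 1))) has_sum (L d - V)) ?A"
      by (rule iffD1[OF has_sum_cong[OF H2] H1])
    then have "(\<lambda>C. \<Sum>c\<in>{- int C..int C} - {0}. 1 / (of_int c * z + of_int d) - 1 / (of_int c * z + of_int (d + 1))) \<longlonglongrightarrow> L d - V"
      unfolding has_sum_def by (rule filterlim_compose[OF _ filterlim_symmetric_intervals(2)])
    moreover have "(\<lambda>C. \<Sum>c\<in>{- int C..int C} - {0}. 1 / (of_int c * z + of_int d) - 1 / (of_int c * z + of_int (d + 1))) \<longlonglongrightarrow> T d - T (d + 1)"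
      unfolding sum_subtractf by (intro tendsto_diff T_lim)
    ultimately have "L d - V = T d - T (d + 1)"
      by (rule LIMSEQ_unique)
    then have "V = L d - (T d - T (d + 1))" by (simp add: algebra_simps)
    then show ?thesis using V by simp
  qed
  have "((\<lambda>d. L d - (T d - T (d + 1))) has_sum U) UNIV"
    by (rule has_sum_SigmaD[OF U(2) inner])
  then have lim1: "(\<lambda>M. \<Sum>d\<in>{- int M..<int M}. L d - (T d - T (d + 1))) \<longlonglongrightarrow> U"
    unfolding has_sum_def by (rule filterlim_compose[OF _ filterlim_symmetric_intervals(1)])
  have tel: "(\<Sum>d\<in>{- int M..<int M}. L d - (T d - T (d + 1))) = (\<Sum>d\<in>{- int M..<int M}. L d) + 2 * T (int M)" for M
  proof -
    have "(\<Sum>d\<in>{- int M..<int M}. T d - T (d + 1)) = T (- int M) - T (int M)"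
    proof (induction M)
      case (Suc M)
      have "{- int (Suc M)..<int (Suc M)} = insert (- 1 - int M) (insert (int M) {- int M..<int M})"
        by auto
      then show ?case using Suc by (simp add: algebra_simps)
    qed simp
    moreover have "T (- int M) = - T (int M)"
      by (simp add: T_def diff_divide_distrib)
    ultimately show ?thesis by (simp add: sum_subtractf)
  qed
  have "(\<lambda>M. (of_real pi * cot (of_real pi * (of_nat M / z)) - z / of_nat M) / z) \<longlonglongrightarrow> (of_real pi * \<i> - 0) / z"
    by (intro tendsto_intros cot_multiple_limit z z0 tendsto_divide_0[OF tendsto_const] tendsto_of_nat)
  moreover have "\<forall>\<^sub>F M in sequentially. (of_real pi * cot (of_real pi * (of_nat M / z)) - z / of_nat M) / z = T (int M)"
    using eventually_gt_at_top[of 0] by eventually_elim (simp add: T_def)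
  ultimately have "(\<lambda>M. T (int M)) \<longlonglongrightarrow> of_real pi * \<i> / z"
    by (simp only: Lim_transform_eventually diff_zero)
  then have lim2: "(\<lambda>M. 2 * T (int M)) \<longlonglongrightarrow> 2 * (of_real pi * \<i> / z)"
    by (intro tendsto_intros)
  have "((\<lambda>d. lip (of_int \<bar>d\<bar> * z') / z\<^sup>2 - 1 / (of_int d)\<^sup>2) has_sum (2 * lip_sum z' / z\<^sup>2 - of_real pi ^ 2 / 3)) ?A"
    using has_sum_add[OF has_sum_divide_const[OF lip_sum(2)[OF z']] has_sum_uminusI[OF has_sum_inverse_squares_int]] by simp
  then have "(L has_sum (2 * lip_sum z' / z\<^sup>2 - of_real pi ^ 2 / 3)) ?A"
    by (rule has_sum_cong[THEN iffD1, rotated]) (simp add: L_def)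
  then have "(L has_sum (L 0 + (2 * lip_sum z' / z\<^sup>2 - of_real pi ^ 2 / 3))) (insert 0 ?A)"
    by (intro has_sum_insert) auto
  also have "insert 0 ?A = UNIV" by auto
  finally have "(\<lambda>M. \<Sum>d\<in>{- int M..<int M}. L d) \<longlonglongrightarrow> L 0 + (2 * lip_sum z' / z\<^sup>2 - of_real pi ^ 2 / 3)"
    unfolding has_sum_def by (rule filterlim_compose[OF _ filterlim_symmetric_intervals(1)])
  from tendsto_add[OF this lim2] lim1
  have "U = L 0 + (2 * lip_sum z' / z\<^sup>2 - of_real pi ^ 2 / 3) + 2 * (of_real pi * \<i> / z)"
    unfolding tel using LIMSEQ_unique by blast
  then show ?thesis
    unfolding U_eq z'_def[symmetric] by (simp add: L_def add_divide_distrib algebra_simps)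
qed

section \<open>Expansions in powers of q\<close>

definition qpar :: "nat \<Rightarrow> complex \<Rightarrow> complex" where
  "qpar N z = exp (2 * of_real pi * \<i> * z / of_nat N)"

lemma qpar_nonzero [simp]: "qpar N z \<noteq> 0"
  by (simp add: qpar_def)

lemma norm_qpar: "norm (qpar N z) = exp (- 2 * pi * Im z / real N)"
proof -
  have "2 * of_real pi * \<i> * z / of_nat N = of_real (2 * pi / real N) * (\<i> * z)"
    by simp
  then show ?thesis
    unfolding qpar_def norm_exp_eq_Re by (simp only: Re_complex_of_real times_complex.sel) simp
qed

lemma norm_qpar_less_1: "Im z > 0 \<Longrightarrow> N > 0 \<Longrightarrow> norm (qpar N z) < 1"
  by (simp add: norm_qpar field_simps)

lemma qpar_power: "qpar N z ^ n = exp (2 * of_real pi * \<i> * of_nat n * z / of_nat N)"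
  unfolding qpar_def exp_of_nat_mult[symmetric] by (rule arg_cong[where f = exp]) simp

lemma qpar_surj:
  assumes "w \<noteq> 0" "norm w < 1" "N > 0"
  obtains z where "Im z > 0" "qpar N z = w"
proof
  let ?z = "of_nat N * Ln w / (2 * of_real pi * \<i>)"
  show q: "qpar N ?z = w"
    using assms by (simp add: qpar_def)
  then have "exp (- 2 * pi * Im ?z / real N) < 1"
    using norm_qpar[of N ?z] assms by simp
  then have "pi * Im ?z > 0"
    using assms by (simp add: field_simps del: Im_divide_of_nat)
  then show "Im ?z > 0"
    using pi_gt_zero by (simp only: zero_less_mult_pos)
qed

text \<open>A formal series is carried along with the function so that products, dilations and
  comparisons of coefficients take place in \<open>complex fps\<close>. The level N selects the
  parameter exp(2 pi i z / N), which is needed at cusps other than infinity.\<close>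

definition has_qexp :: "nat \<Rightarrow> complex fps \<Rightarrow> (complex \<Rightarrow> complex) \<Rightarrow> bool" where
  "has_qexp N F f \<longleftrightarrow> fps_conv_radius F \<ge> 1 \<and> (\<forall>z. Im z > 0 \<longrightarrow> f z = eval_fps F (qpar N z))"

lemma has_qexp_cong: "has_qexp N F f \<Longrightarrow> (\<And>z. Im z > 0 \<Longrightarrow> f z = g z) \<Longrightarrow> has_qexp N F g"
  by (simp add: has_qexp_def)

lemma less_fps_conv_radiusI: "fps_conv_radius F \<ge> 1 \<Longrightarrow> norm w < 1 \<Longrightarrow> ereal (norm w) < fps_conv_radius F"
  by (metis ereal_less(3) less_le_trans one_ereal_def)

lemma has_qexp_const: "has_qexp N (fps_const c) (\<lambda>_. c)"
  by (simp add: has_qexp_def)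

lemma has_qexp_add:
  assumes "N > 0" "has_qexp N F f" "has_qexp N G g"
  shows "has_qexp N (F + G) (\<lambda>z. f z + g z)"
  using assms unfolding has_qexp_def
  by (auto simp: eval_fps_add less_fps_conv_radiusI norm_qpar_less_1 intro: order.trans[OF _ fps_conv_radius_add])

lemma has_qexp_diff:
  assumes "N > 0" "has_qexp N F f" "has_qexp N G g"
  shows "has_qexp N (F - G) (\<lambda>z. f z - g z)"
  using assms unfolding has_qexp_def
  by (auto simp: eval_fps_diff less_fps_conv_radiusI norm_qpar_less_1 intro: order.trans[OF _ fps_conv_radius_diff])

lemma has_qexp_mult:
  assumes "N > 0" "has_qexp N F f" "has_qexp N G g"
  shows "has_qexp N (F * G) (\<lambda>z. f z * g z)"
  using assms unfolding has_qexp_def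
  by (auto simp: eval_fps_mult less_fps_conv_radiusI norm_qpar_less_1 intro: order.trans[OF _ fps_conv_radius_mult])

lemma has_qexp_cmult:
  assumes "N > 0" "has_qexp N F f"
  shows "has_qexp N (fps_const c * F) (\<lambda>z. c * f z)"
  by (rule has_qexp_mult[OF assms(1) has_qexp_const assms(2)])

lemma has_qexp_power:
  assumes "N > 0" "has_qexp N F f"
  shows "has_qexp N (F ^ k) (\<lambda>z. f z ^ k)"
proof (induction k)
  case 0
  then show ?case using has_qexp_const[of N 1] by simp
next
  case (Suc k)
  then show ?case using has_qexp_mult[OF assms(1,2) Suc] by simp
qed

lemma has_qexp_sum:
  assumes "N > 0" "finite A" "\<And>x. x \<in> A \<Longrightarrow> has_qexp N (F x) (f x)"
  shows "has_qexp N (\<Sum>x\<in>A. F x) (\<lambda>z. \<Sum>x\<in>A. f x z)"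
  using assms(2,3)
proof (induction A rule: finite_induct)
  case empty
  then show ?case using has_qexp_const[of N 0] by simp
next
  case (insert x A)
  then show ?case using has_qexp_add[OF assms(1), of "F x" "f x"] by simp
qed

lemma has_qexp_sums:
  assumes "N > 0" "has_qexp N F f" "Im z > 0"
  shows "(\<lambda>n. fps_nth F n * exp (2 * of_real pi * \<i> * of_nat n * z / of_nat N)) sums f z"
  using sums_eval_fps[of "qpar N z" F] assms
  by (simp add: has_qexp_def qpar_power less_fps_conv_radiusI norm_qpar_less_1)

text \<open>The parameter takes every real value r between 0 and 1, so convergence on the half plane
  already forces radius of convergence at least 1.\<close>

lemma has_qexpI_sums:
  assumes N: "N > 0"
    and sums: "\<And>z. Im z > 0 \<Longrightarrow> (\<lambda>n. a n * exp (2 * of_real pi * \<i> * of_nat n * z / of_nat N)) sums f z"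
  shows "has_qexp N (Abs_fps a) f"
proof -
  have *: "ereal r \<le> conv_radius a" if r: "0 < r" "r < 1" for r :: real
  proof -
    obtain z where z: "Im z > 0" "qpar N z = of_real r"
      by (rule qpar_surj[of "of_real r" N]) (use r N in auto)
    from sums[OF z(1)] have "summable (\<lambda>n. a n * of_real r ^ n)"
      by (simp add: qpar_power[symmetric] z sums_iff)
    then show ?thesis
      using conv_radius_geI[of a "of_real r"] r by simp
  qed
  have "1 \<le> conv_radius a"
  proof (rule ccontr)
    assume "\<not> 1 \<le> conv_radius a"
    then obtain r where r: "max 0 (conv_radius a) < ereal r" "ereal r < 1"
      using ereal_dense2[of "max 0 (conv_radius a)" 1] by (auto simp: not_le)
    then show False using *[of r] by (auto simp: one_ereal_def zero_ereal_def)
  qed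
  then show ?thesis
    using sums by (auto simp: has_qexp_def fps_conv_radius_def eval_fps_def qpar_power sums_iff)
qed

text \<open>The parameter fills the punctured unit disc, so the two series agree there; they agree
  at 0 by continuity.\<close>

lemma has_qexp_unique:
  assumes N: "N > 0" and F: "has_qexp N F f" and G: "has_qexp N G g" and eq: "\<And>z. Im z > 0 \<Longrightarrow> f z = g z"
  shows "F = G"
proof (rule eval_fps_eqD)
  have r: "fps_conv_radius F \<ge> 1" "fps_conv_radius G \<ge> 1"
    using F G by (auto simp: has_qexp_def)
  then show pos: "fps_conv_radius F > 0" "fps_conv_radius G > 0"
    by (auto intro: less_le_trans[of 0 1])
  have 1: "eval_fps F w = eval_fps G w" if "w \<noteq> 0" "norm w < 1" for w
    using qpar_surj[OF that N] F G eq unfolding has_qexp_def by metis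
  have cont: "isCont (eval_fps F) 0" "isCont (eval_fps G) 0"
    using pos by (auto intro!: continuous_eval_fps simp: zero_ereal_def)
  have ev: "eventually (\<lambda>w::complex. w \<noteq> 0 \<and> norm w < 1) (at 0)"
    using eventually_at_ball[of 1 "0::complex" UNIV] by (auto simp: eventually_at_filter elim: eventually_mono)
  have "(eval_fps G \<longlongrightarrow> eval_fps F 0) (at 0)"
    by (rule Lim_transform_eventually[OF cont(1)[unfolded isCont_def]])
       (use ev 1 in \<open>auto elim!: eventually_mono\<close>)
  then have 0: "eval_fps F 0 = eval_fps G 0"
    using cont(2) by (simp add: isCont_def LIM_unique)
  have "eventually (\<lambda>w::complex. w \<in> ball 0 1) (nhds 0)"
    by (rule eventually_nhds_in_open) auto
  then show "eventually (\<lambda>z. eval_fps F z = eval_fps G z) (nhds 0)"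
  proof eventually_elim
    case (elim w)
    then show ?case using 0 1[of w] by (cases "w = 0") auto
  qed
qed

lemma has_qexp_holomorphic:
  assumes "N > 0" "has_qexp N F f"
  shows "f holomorphic_on {z. Im z > 0}"
proof -
  have "(\<lambda>z. eval_fps F (qpar N z)) holomorphic_on {z. Im z > 0}"
  proof (rule holomorphic_on_compose_gen[where g = "eval_fps F" and f = "qpar N", unfolded o_def])
    show "qpar N holomorphic_on {z. Im z > 0}"
      unfolding qpar_def using assms by (intro holomorphic_intros) auto
    show "eval_fps F holomorphic_on ball 0 1"
      using assms(2) by (intro holomorphic_on_eval_fps) (auto simp: has_qexp_def less_fps_conv_radiusI)
    show "qpar N ` {z. Im z > 0} \<subseteq> ball 0 1"
      using norm_qpar_less_1[OF _ assms(1)] by auto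
  qed
  then show ?thesis
    by (rule holomorphic_transform) (use assms in \<open>auto simp: has_qexp_def\<close>)
qed

text \<open>The series F(c X^k). Dilations of z and changes of the level of the parameter contribute
  the power k, real translations the factor c of modulus 1.\<close>

definition fps_sub :: "complex \<Rightarrow> nat \<Rightarrow> complex fps \<Rightarrow> complex fps" where
  "fps_sub c k F = Abs_fps (\<lambda>n. if k dvd n then fps_nth F (n div k) * c ^ (n div k) else 0)"

lemma fps_sub_nth_0 [simp]: "fps_nth (fps_sub c k F) 0 = fps_nth F 0"
  by (simp add: fps_sub_def)

lemma sums_fps_sub:
  assumes "k > 0" "fps_conv_radius F \<ge> 1" "norm c = 1" "norm w < 1"
  shows "(\<lambda>n. fps_nth (fps_sub c k F) n * w ^ n) sums eval_fps F (c * w ^ k)"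
proof -
  have "norm (c * w ^ k) < 1"
    using assms by (simp add: norm_mult norm_power power_less_one_iff)
  then have "(\<lambda>n. fps_nth F n * (c * w ^ k) ^ n) sums eval_fps F (c * w ^ k)"
    using assms by (intro sums_eval_fps less_fps_conv_radiusI)
  also have "(\<lambda>n. fps_nth F n * (c * w ^ k) ^ n) = (\<lambda>n. fps_nth (fps_sub c k F) (n * k) * w ^ (n * k))"
    using assms by (auto simp: fps_sub_def power_mult_distrib power_mult[symmetric] mult_ac)
  finally show ?thesis
    by (subst (asm) sums_mono_reindex[where g = "\<lambda>n. n * k" and f = "\<lambda>n. fps_nth (fps_sub c k F) n * w ^ n"])
       (use assms in \<open>auto simp: strict_mono_def fps_sub_def elim!: dvdE\<close>)
qed

lemma has_qexp_subst:
  assumes N: "N > 0" and k: "k > 0" and F: "has_qexp M F f" and c: "norm c = 1"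
    and \<phi>: "\<And>z. Im z > 0 \<Longrightarrow> Im (\<phi> z) > 0" "\<And>z. Im z > 0 \<Longrightarrow> qpar M (\<phi> z) = c * qpar N z ^ k"
  shows "has_qexp N (fps_sub c k F) (\<lambda>z. f (\<phi> z))"
proof -
  have "has_qexp N (Abs_fps (fps_nth (fps_sub c k F))) (\<lambda>z. f (\<phi> z))"
  proof (rule has_qexpI_sums[OF N])
    fix z assume z: "Im z > 0"
    show "(\<lambda>n. fps_nth (fps_sub c k F) n * exp (2 * of_real pi * \<i> * of_nat n * z / of_nat N)) sums f (\<phi> z)"
      using sums_fps_sub[OF k _ c norm_qpar_less_1[OF z N], of F] F \<phi>[OF z]
      by (simp add: qpar_power has_qexp_def)
  qed
  then show ?thesis by (simp add: fps_nth_inverse)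
qed

section \<open>Divisor sums as Lambert series, and the Eisenstein series E_2 and E_4\<close>

definition sigma_fps :: "nat \<Rightarrow> complex fps" where
  "sigma_fps j = Abs_fps (\<lambda>n. if n = 0 then 0 else \<Sum>d | d dvd n. of_nat d ^ j)"

text \<open>The operator X d/dX is applied k times to the geometric series; differentiation does not
  shrink the radius.\<close>

lemma fps_conv_radius_powers: "fps_conv_radius (Abs_fps (\<lambda>n. of_nat n ^ k :: complex)) \<ge> 1"
proof (induction k)
  case 0
  have "conv_radius (\<lambda>n. 1 :: complex) \<ge> 1"
    by (rule conv_radius_geI_ex') (auto simp: one_ereal_def intro!: summable_geometric)
  then show ?case by (simp add: fps_conv_radius_def)
next
  case (Suc k)
  have "Abs_fps (\<lambda>n. of_nat n ^ Suc k :: complex) = fps_X * fps_deriv (Abs_fps (\<lambda>n. of_nat n ^ k))"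
  proof (rule fps_ext)
    fix n show "fps_nth (Abs_fps (\<lambda>n. of_nat n ^ Suc k :: complex)) n = fps_nth (fps_X * fps_deriv (Abs_fps (\<lambda>n. of_nat n ^ k))) n"
      by (cases n) auto
  qed
  moreover have "fps_conv_radius (fps_X * fps_deriv (Abs_fps (\<lambda>n. of_nat n ^ k :: complex))) \<ge> 1"
    using Suc fps_conv_radius_deriv[of "Abs_fps (\<lambda>n. of_nat n ^ k :: complex)"]
    by (intro order.trans[OF _ fps_conv_radius_mult]) auto
  ultimately show ?case by simp
qed

lemma norm_sigma_fps_le: "norm (fps_nth (sigma_fps j) n) \<le> real n ^ Suc j"
proof (cases "n = 0")
  case False
  have "norm (fps_nth (sigma_fps j) n) \<le> (\<Sum>d | d dvd n. norm (of_nat d ^ j :: complex))"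
    unfolding sigma_fps_def using False by (simp add: sum_norm_le)
  also have "\<dots> \<le> (\<Sum>d\<in>{1..n}. real n ^ j)"
    using False by (intro sum_le_included[where i = id])
      (auto simp: norm_power dvd_imp_le power_mono dest: dvd_pos_nat intro!: Suc_leI)
  also have "\<dots> = real n ^ Suc j" by simp
  finally show ?thesis .
qed (simp add: sigma_fps_def)

lemma fps_conv_radius_sigma: "fps_conv_radius (sigma_fps j) \<ge> 1"
  unfolding fps_conv_radius_def
proof (rule conv_radius_geI_ex')
  fix r :: real assume r: "0 < r" "ereal r < 1"
  then have "norm (of_real r :: complex) < 1" by (simp add: one_ereal_def)
  then have "norm (of_real r :: complex) < fps_conv_radius (Abs_fps (\<lambda>n. of_nat n ^ Suc j :: complex))"
    by (rule less_fps_conv_radiusI[OF fps_conv_radius_powers])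
  from norm_summable_fps[OF this] have "summable (\<lambda>n. real n ^ Suc j * r ^ n)"
    using r by (simp add: norm_mult norm_power)
  then show "summable (\<lambda>n. fps_nth (sigma_fps j) n * of_real r ^ n)"
    by (rule summable_comparison_test'[where N = 0])
       (use r norm_sigma_fps_le[of j] in \<open>auto simp: norm_mult norm_power intro!: mult_right_mono simp del: power_Suc\<close>)
qed

text \<open>The term q^c / (1 - q^c)^2 is the sum of m q^(c m), and collecting the pairs (c, m) by
  the product n = c m gives the divisor sums. Absolute summability is checked in the grouping by n,
  where it is that of a power series inside its disc.\<close>

lemma sigma_fps_Lambert:
  assumes z: "Im z > 0"
  shows "lip_sum z = - 4 * of_real pi ^ 2 * eval_fps (sigma_fps 1) (qpar 1 z)"
proof -
  define q where "q = qpar 1 z"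
  have q: "norm q < 1" "q \<noteq> 0" using norm_qpar_less_1[OF z] by (auto simp: q_def)
  let ?f = "\<lambda>(n, d). of_nat d * q ^ n :: complex"
  let ?S = "SIGMA n:{1..}. {d::nat. d dvd n}"
  have s1: "((\<lambda>d. ?f (n, d)) has_sum (fps_nth (sigma_fps 1) n * q ^ n)) {d. d dvd n}" if "n \<in> {1..}" for n
    using that by (intro has_sum_finiteI) (auto simp: sigma_fps_def sum_distrib_right)
  have rad: "norm q < fps_conv_radius (sigma_fps 1)"
    by (rule less_fps_conv_radiusI[OF fps_conv_radius_sigma q(1)])
  have "(\<lambda>x. norm (?f x)) summable_on ?S"
  proof (rule summable_on_SigmaI[where g = "\<lambda>n. norm (fps_nth (sigma_fps 1) n * q ^ n)"])
    show "((\<lambda>d. norm (?f (n, d))) has_sum norm (fps_nth (sigma_fps 1) n * q ^ n)) {d. d dvd n}" if n: "n \<in> {1..}" for n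
    proof (rule has_sum_finiteI)
      have "norm (\<Sum>d | d dvd n. of_nat d :: complex) = (\<Sum>d | d dvd n. real d)"
        unfolding of_nat_sum[symmetric] norm_of_nat by simp
      then show "norm (fps_nth (sigma_fps 1) n * q ^ n) = (\<Sum>d | d dvd n. norm (?f (n, d)))"
        using n by (simp add: sigma_fps_def norm_mult flip: sum_distrib_right)
    qed (use n in auto)
    have "(\<lambda>n. norm (fps_nth (sigma_fps 1) n * q ^ n)) summable_on UNIV"
      using norm_summable_fps[OF rad] by (intro summable_nonneg_imp_summable_on) auto
    then show "(\<lambda>n. norm (fps_nth (sigma_fps 1) n * q ^ n)) summable_on {1..}"
      by (rule summable_on_subset) auto
  qed auto
  then have "?f summable_on ?S" by (rule abs_summable_summable)
  moreover have "((\<lambda>n. fps_nth (sigma_fps 1) n * q ^ n) has_sum eval_fps (sigma_fps 1) q) {1..}"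
  proof -
    have "((\<lambda>n. fps_nth (sigma_fps 1) n * q ^ n) has_sum eval_fps (sigma_fps 1) q) UNIV"
      using norm_summable_fps[OF rad] sums_eval_fps[OF rad] by (rule norm_summable_imp_has_sum)
    then show ?thesis
      by (subst (asm) has_sum_cong_neutral[where T = "{1..}" and g = "\<lambda>n. fps_nth (sigma_fps 1) n * q ^ n"]) (auto simp: sigma_fps_def)
  qed
  ultimately have S: "(?f has_sum eval_fps (sigma_fps 1) q) ?S"
    using has_sum_SigmaI[where f = ?f, OF s1] by blast
  have bij: "bij_betw (\<lambda>(c, m). (c * m, m)) ({1..} \<times> {1..}) ?S"
    by (rule bij_betwI[where g = "\<lambda>(n, m). (n div m, m)"])
       (auto dest: dvd_pos_nat simp: div_greater_zero_iff dvd_imp_le Suc_le_eq)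
  have D: "((\<lambda>(c, m). of_nat m * q ^ (c * m)) has_sum eval_fps (sigma_fps 1) q) ({1..} \<times> {1..})"
    using S has_sum_reindex_bij_betw[OF bij, of ?f] by (simp add: case_prod_unfold)
  have inner: "((\<lambda>m. of_nat m * q ^ (c * m)) has_sum (lip (of_nat c * z) / (- 4 * of_real pi ^ 2))) {1..}" if c: "c \<in> {1..}" for c :: nat
  proof -
    have qc: "norm (q ^ c) < 1" using q c by (simp add: norm_power power_less_one_iff)
    have 1: "(\<lambda>m. of_nat m * (q ^ c) ^ m) sums (q ^ c / (1 - q ^ c)\<^sup>2)"
      using sums_mult[OF geometric_deriv_sums[OF qc], of "q ^ c"]
      by (subst sums_iff_shift'[of _ 1, symmetric]) (simp add: mult_ac field_simps)
    have "norm (norm (q ^ c)) < 1" using qc by simp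
    from sums_mult[OF geometric_deriv_sums[OF this], of "norm (q ^ c)"]
    have "summable (\<lambda>m. norm (q ^ c) * (of_nat (Suc m) * norm (q ^ c) ^ m))"
      by (simp only: sums_iff)
    moreover have "norm (of_nat (m + 1) * (q ^ c) ^ (m + 1)) = norm (q ^ c) * (of_nat (Suc m) * norm (q ^ c) ^ m)" for m
      by (simp add: norm_mult norm_power mult_ac del: of_nat_Suc)
    ultimately have "summable (\<lambda>m. norm (of_nat (m + 1) * (q ^ c) ^ (m + 1)))"
      by (simp only:)
    then have "summable (\<lambda>m. norm (of_nat m * (q ^ c) ^ m))"
      by (subst (asm) summable_iff_shift)
    then have "((\<lambda>m. of_nat m * (q ^ c) ^ m) has_sum (q ^ c / (1 - q ^ c)\<^sup>2)) UNIV"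
      using 1 by (rule norm_summable_imp_has_sum)
    then have "((\<lambda>m. of_nat m * (q ^ c) ^ m) has_sum (q ^ c / (1 - q ^ c)\<^sup>2)) {1..}"
      by (subst (asm) has_sum_cong_neutral[where T = "{1..}" and g = "\<lambda>m. of_nat m * (q ^ c) ^ m"]) auto
    moreover have "lip (of_nat c * z) = - 4 * of_real pi ^ 2 * (q ^ c / (1 - q ^ c)\<^sup>2)"
      unfolding lip_def q_def qpar_power by (simp add: mult_ac)
    ultimately show ?thesis by (simp add: power_mult)
  qed
  have "((\<lambda>c. lip (of_nat c * z) / (- 4 * of_real pi ^ 2)) has_sum eval_fps (sigma_fps 1) q) {1..}"
    by (rule has_sum_SigmaD[OF D]) (use inner in simp)
  then have "((\<lambda>c. - 4 * of_real pi ^ 2 * (lip (of_nat c * z) / (- 4 * of_real pi ^ 2))) has_sum (- 4 * of_real pi ^ 2 * eval_fps (sigma_fps 1) q)) {1..}"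
    by (rule has_sum_cmult_right)
  then show ?thesis
    unfolding lip_sum_def q_def by (simp add: infsumI)
qed

definition E2_fps :: "complex fps" where "E2_fps = 1 - fps_const 24 * sigma_fps 1"
definition E4_fps :: "complex fps" where "E4_fps = 1 + fps_const 240 * sigma_fps 3"
definition E2 :: "complex \<Rightarrow> complex" where "E2 z = eval_fps E2_fps (qpar 1 z)"
definition E4 :: "complex \<Rightarrow> complex" where "E4 z = eval_fps E4_fps (qpar 1 z)"

lemma has_qexp_sigma: "has_qexp 1 (sigma_fps j) (\<lambda>z. eval_fps (sigma_fps j) (qpar 1 z))"
  by (simp add: has_qexp_def fps_conv_radius_sigma)

lemma has_qexp_E2_aux: "has_qexp 1 E2_fps (\<lambda>z. 1 - 24 * eval_fps (sigma_fps 1) (qpar 1 z))"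
  unfolding E2_fps_def using has_qexp_diff[OF _ has_qexp_const[of 1 1] has_qexp_cmult[OF _ has_qexp_sigma[of 1], of 24]] by simp

lemma has_qexp_E2: "has_qexp 1 E2_fps E2"
  using has_qexp_E2_aux by (simp add: has_qexp_def E2_def)

lemma has_qexp_E4: "has_qexp 1 E4_fps E4"
  using has_qexp_add[OF _ has_qexp_const[of 1 1] has_qexp_cmult[OF _ has_qexp_sigma[of 3], of 240]]
  by (simp add: has_qexp_def E4_def E4_fps_def)

lemma E2_S:
  assumes z: "Im z > 0"
  shows "E2 (- 1 / z) = z\<^sup>2 * E2 z + 6 * z / (of_real pi * \<i>)"
proof -
  \<comment> \<open>The factor is -24 / (-4 pi^2) = 6 / pi^2, so pi^2/3 times \<open>E2 z\<close> is
    the lattice sum of the transformation formula.\<close>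
  have *: "E2 z = 1 + 6 / of_real pi ^ 2 * lip_sum z" if "Im z > 0" for z
    using has_qexp_E2_aux has_qexp_E2 that sigma_fps_Lambert[OF that] by (simp add: has_qexp_def)
  have z0: "z \<noteq> 0" using z by auto
  have "of_real pi ^ 2 / 3 * E2 z = of_real pi ^ 2 / 3 * E2 (- 1 / z) / z\<^sup>2 + 2 * of_real pi * \<i> / z"
    using lip_sum_transformation[OF z] *[OF z] *[OF Im_neg_inverse_pos[OF z]] by (simp add: field_simps)
  then have "of_real pi ^ 2 / 3 * z\<^sup>2 * E2 z = of_real pi ^ 2 / 3 * E2 (- 1 / z) + 2 * of_real pi * \<i> * z"
    using z0 by (simp add: field_simps power2_eq_square)
  then have "of_real pi ^ 2 * E2 (- 1 / z) = of_real pi ^ 2 * (z\<^sup>2 * E2 z - 6 * \<i> * z / of_real pi)"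
    by (simp add: field_simps power2_eq_square)
  then have "E2 (- 1 / z) = z\<^sup>2 * E2 z - 6 * \<i> * z / of_real pi"
    by (subst (asm) mult_left_cancel) auto
  then show ?thesis
    unfolding divide_divide_eq_left[symmetric] divide_i by simp
qed

lemma qpar_add_int: "qpar 1 (z + of_int k) = qpar 1 z"
proof -
  have "qpar 1 (z + of_int k) = exp (2 * of_real pi * \<i> * z + \<i> * (of_int k * (of_real pi * 2)))"
    unfolding qpar_def by (rule arg_cong[where f = exp]) (simp add: algebra_simps)
  also have "\<dots> = qpar 1 z"
    unfolding exp_plus_2pin by (simp add: qpar_def)
  finally show ?thesis .
qed

lemma E2_T: "E2 (z + of_int k) = E2 z"
  by (simp only: E2_def qpar_add_int)

lemma E4_T: "E4 (z + of_int k) = E4 z"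
  by (simp only: E4_def qpar_add_int)

text \<open>Coefficientwise this is the formula for W_1 multiplied by 576 = 24^2.\<close>

lemma Ramanujan_fps: "fps_const 12 * (fps_X * fps_deriv E2_fps) = E2_fps ^ 2 - E4_fps"
proof (rule fps_ext)
  fix n :: nat
  let ?s = "\<lambda>j. fps_nth (sigma_fps j)"
  have E2n: "fps_nth E2_fps n = (if n = 0 then 1 else 0) - 24 * ?s 1 n" for n
    by (simp add: E2_fps_def)
  have "fps_nth (E2_fps ^ 2 - E4_fps) n = - 48 * ?s 1 n + 576 * fps_nth (sigma_fps 1 * sigma_fps 1) n - 240 * ?s 3 n"
  proof -
    have "(1 - c * s)\<^sup>2 - (1 + e * t) = c * c * (s * s) - (c * s + c * s) - e * t" for c s e t :: "complex fps"
      by (simp add: power2_eq_square algebra_simps)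
    then have "E2_fps ^ 2 - E4_fps = fps_const 24 * fps_const 24 * (sigma_fps 1 * sigma_fps 1)
        - (fps_const 24 * sigma_fps 1 + fps_const 24 * sigma_fps 1) - fps_const 240 * sigma_fps 3"
      unfolding E2_fps_def E4_fps_def .
    then show ?thesis by simp
  qed
  moreover have "fps_nth (fps_const 12 * (fps_X * fps_deriv E2_fps)) n = - 288 * of_nat n * ?s 1 n"
    by (cases n) (auto simp: E2n algebra_simps)
  moreover have "576 * fps_nth (sigma_fps 1 * sigma_fps 1) n = 240 * ?s 3 n - 288 * of_nat n * ?s 1 n + 48 * ?s 1 n"
  proof (cases "n = 0")
    case False
    have "fps_nth (sigma_fps 1 * sigma_fps 1) n = (\<Sum>i\<in>{0<..<n}. ?s 1 i * ?s 1 (n - i))"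
      unfolding fps_mult_nth by (rule sum.mono_neutral_right) (auto simp: sigma_fps_def)
    also have "\<dots> = (\<Sum>i\<in>{0<..<n}. of_int ((\<Sum>d | d dvd i. int d) * (\<Sum>d | d dvd (n - i). int d)))"
      by (intro sum.cong refl) (auto simp: sigma_fps_def)
    also have "\<dots> = of_int (qsum n (\<lambda>_ _ _ _. True) (\<lambda>a b x y. int a * int b))"
      unfolding sum_quads_ab_conv by simp
    finally have "12 * fps_nth (sigma_fps 1 * sigma_fps 1) n = of_int (12 * qsum n (\<lambda>_ _ _ _. True) (\<lambda>a b x y. int a * int b))"
      by simp
    also have "\<dots> = 5 * ?s 3 n - 6 * of_nat n * ?s 1 n + ?s 1 n"
      unfolding sum_quads_ab[OF False[unfolded neq0_conv]] using False by (simp add: sigma_fps_def)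
    finally have "48 * (12 * fps_nth (sigma_fps 1 * sigma_fps 1) n) = 48 * (5 * ?s 3 n - 6 * of_nat n * ?s 1 n + ?s 1 n)"
      by (rule arg_cong)
    then show ?thesis by (simp add: algebra_simps)
  qed (simp add: sigma_fps_def)
  ultimately show "fps_nth (fps_const 12 * (fps_X * fps_deriv E2_fps)) n = fps_nth (E2_fps ^ 2 - E4_fps) n"
    by simp
qed

section \<open>From translation and inversion to all of SL(2,Z)\<close>

lemma moebius_Im:
  assumes "Im z > 0" "a * d - b * c = (1::int)"
  shows "Im ((of_int a * z + of_int b) / (of_int c * z + of_int d)) = Im z / (norm (of_int c * z + of_int d))\<^sup>2"
proof -
  have "Im ((of_int a * z + of_int b) / (of_int c * z + of_int d)) =
     (real_of_int (a * d - b * c) * Im z) / (norm (of_int c * z + of_int d))\<^sup>2"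
    unfolding Im_divide cmod_power2 by (rule arg_cong2[where f = divide]) (simp_all add: algebra_simps)
  then show ?thesis using assms by simp
qed

lemma SL2Z_row_nonzero:
  assumes "a * d - b * c = (1::int)"
  shows "a \<noteq> 0 \<or> b \<noteq> 0" "c \<noteq> 0 \<or> d \<noteq> 0"
  using assms by auto

lemma moebius_Im_pos:
  assumes "Im z > 0" "a * d - b * c = (1::int)"
  shows "Im ((of_int a * z + of_int b) / (of_int c * z + of_int d)) > 0"
proof -
  have "of_int c * z + of_int d \<noteq> 0"
    using lattice_nonzero[OF assms(1)] SL2Z_row_nonzero(2)[OF assms(2)] by blast
  then show ?thesis unfolding moebius_Im[OF assms] using assms by simp
qed

text \<open>Euclid's algorithm on the first column: the substitution \<open>A = T\<^sup>k S A'\<close> with \<open>\<bar>c'\<bar> < \<bar>c\<bar>\<close>.\<close>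
lemma SL2Z_induct:
  fixes P :: "int \<Rightarrow> int \<Rightarrow> int \<Rightarrow> int \<Rightarrow> bool"
  assumes det: "a * d - b * c = 1"
    and base: "\<And>a b d. a * d = 1 \<Longrightarrow> P a b 0 d"
    and step: "\<And>a b c d k. a * d - b * c = 1 \<Longrightarrow> P a b c d \<Longrightarrow> P (k * a - c) (k * b - d) a b"
  shows "P a b c d"
proof -
  have "\<forall>a b d. a * d - b * c = 1 \<longrightarrow> P a b c d"
  proof (induction "nat \<bar>c\<bar>" arbitrary: c rule: less_induct)
    case less
    show ?case
    proof (intro allI impI)
      fix a b d assume det: "a * d - b * c = 1"
      show "P a b c d"
      proof (cases "c = 0")
        case True
        then show ?thesis using det base by simp
      next
        case False
        define k where "k = a div c"
        define c' where "c' = k * c - a"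
        define d' where "d' = k * d - b"
        have "\<bar>c'\<bar> = \<bar>a mod c\<bar>"
          unfolding c'_def k_def by (simp add: minus_div_mult_eq_mod[symmetric] abs_minus_commute)
        also have "\<dots> < \<bar>c\<bar>" using False by (rule abs_mod_less)
        finally have lt: "nat \<bar>c'\<bar> < nat \<bar>c\<bar>" by simp
        have det': "c * d' - d * c' = 1"
          using det by (simp add: c'_def d'_def algebra_simps)
        have "P c d c' d'" using less[OF lt] det' by blast
        from step[OF det' this, of k] show ?thesis
          by (simp add: c'_def d'_def)
      qed
    qed
  qed
  then show ?thesis using det by blast
qed

lemma E2_SL2Z:
  assumes "a * d - b * c = 1" and z: "Im z > 0"
  shows "E2 ((of_int a * z + of_int b) / (of_int c * z + of_int d)) =
     (of_int c * z + of_int d)\<^sup>2 * E2 z + 6 * of_int c * (of_int c * z + of_int d) / (of_real pi * \<i>)"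
proof (rule SL2Z_induct[OF assms(1)], goal_cases)
  case (1 a b d)
  then have "(a = 1 \<and> d = 1) \<or> (a = - 1 \<and> d = - 1)"
    by (simp add: zmult_eq_1_iff)
  then show ?case
    using E2_T[of z b] E2_T[of z "- b"] by auto
next
  case (2 a b c d k)
  define w where "w = (of_int a * z + of_int b) / (of_int c * z + of_int d)"
  have j: "of_int a * z + of_int b \<noteq> 0" "of_int c * z + of_int d \<noteq> 0"
    using lattice_nonzero[OF z] SL2Z_row_nonzero[OF 2(1)] by blast+
  have w: "Im w > 0" "w \<noteq> 0" unfolding w_def using moebius_Im_pos[OF z 2(1)] j by auto
  have "(of_int (k * a - c) * z + of_int (k * b - d)) / (of_int a * z + of_int b) = - 1 / w + of_int k"
    unfolding w_def using j by (simp add: field_simps)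
  then have "E2 ((of_int (k * a - c) * z + of_int (k * b - d)) / (of_int a * z + of_int b)) = w\<^sup>2 * E2 w + 6 * w / (of_real pi * \<i>)"
    by (simp only: E2_T E2_S[OF w(1)])
  also have "E2 w = (of_int c * z + of_int d)\<^sup>2 * E2 z + 6 * of_int c * (of_int c * z + of_int d) / (of_real pi * \<i>)"
    unfolding w_def by (rule 2(2))
  also have "w\<^sup>2 * \<dots> + 6 * w / (of_real pi * \<i>) = (w * (of_int c * z + of_int d))\<^sup>2 * E2 z
      + 6 * (w * (w * (of_int c * z + of_int d) * of_int c + 1)) / (of_real pi * \<i>)"
    by (simp add: algebra_simps power2_eq_square add_divide_distrib)
  also have "w * (of_int c * z + of_int d) = of_int a * z + of_int b"
    unfolding w_def using j by simp
  \<comment> \<open>The correction terms coming from the inversion and from the induction hypothesis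
    merge, because (a z + b) c + 1 = a (c z + d) when a d - b c = 1.\<close>
  also have "w * ((of_int a * z + of_int b) * of_int c + 1) = of_int a * (of_int a * z + of_int b)"
  proof -
    have "(of_int a * z + of_int b) * of_int c + 1 = (of_int a * z + of_int b) * of_int c + of_int (a * d - b * c)"
      using 2(1) by simp
    also have "\<dots> = of_int a * (of_int c * z + of_int d)"
      by (simp add: algebra_simps)
    finally show ?thesis
      using j by (simp add: w_def)
  qed
  finally show ?case by (simp add: mult.assoc)
qed

lemma E2_has_derivative:
  assumes z: "Im z > 0"
  shows "(E2 has_field_derivative (2 * of_real pi * \<i> * ((E2 z)\<^sup>2 - E4 z) / 12)) (at z)"
proof -
  let ?q = "qpar 1 z"
  have q: "norm ?q < 1" using norm_qpar_less_1[OF z] by simp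
  have r: "fps_conv_radius E2_fps \<ge> 1" "fps_conv_radius E4_fps \<ge> 1"
    using has_qexp_E2 has_qexp_E4 by (auto simp: has_qexp_def)
  have rad: "norm ?q < fps_conv_radius E2_fps" "norm ?q < fps_conv_radius E4_fps"
    using r q by (auto intro: less_fps_conv_radiusI)
  have rd: "norm ?q < fps_conv_radius (fps_deriv E2_fps)"
    using rad(1) fps_conv_radius_deriv[of E2_fps] by (rule less_le_trans)
  have "(qpar 1 has_field_derivative (2 * of_real pi * \<i> * ?q)) (at z)"
    unfolding qpar_def by (auto intro!: derivative_eq_intros)
  then have "((\<lambda>z. eval_fps E2_fps (qpar 1 z)) has_field_derivative (eval_fps (fps_deriv E2_fps) ?q * (2 * of_real pi * \<i> * ?q))) (at z)"
    by (rule DERIV_chain2[where f = "eval_fps E2_fps" and g = "qpar 1", rotated])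
       (rule has_field_derivative_eval_fps[OF rad(1)])
  moreover have *: "12 * (?q * eval_fps (fps_deriv E2_fps) ?q) = (E2 z)\<^sup>2 - E4 z"
  proof -
    have "norm ?q < fps_conv_radius (fps_X * fps_deriv E2_fps)"
      using rd by (intro less_le_trans[OF _ fps_conv_radius_mult]) simp
    then have "12 * (?q * eval_fps (fps_deriv E2_fps) ?q) = eval_fps (fps_const 12 * (fps_X * fps_deriv E2_fps)) ?q"
      using rd by (simp add: eval_fps_mult)
    also have "\<dots> = eval_fps E2_fps ?q ^ 2 - eval_fps E4_fps ?q"
      unfolding Ramanujan_fps using rad
      by (subst eval_fps_diff) (auto simp: eval_fps_power intro: less_le_trans[OF _ fps_conv_radius_power])
    finally show ?thesis by (simp add: E2_def E4_def)
  qed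
  moreover have "eval_fps (fps_deriv E2_fps) ?q * (2 * of_real pi * \<i> * ?q) = 2 * of_real pi * \<i> * ((E2 z)\<^sup>2 - E4 z) / 12"
  proof -
    have "eval_fps (fps_deriv E2_fps) ?q * (2 * of_real pi * \<i> * ?q) = 2 * of_real pi * \<i> * (12 * (?q * eval_fps (fps_deriv E2_fps) ?q)) / 12"
      by (simp add: mult_ac)
    then show ?thesis using * by (simp only:)
  qed
  ultimately show ?thesis by (simp only: E2_def[abs_def])
qed

text \<open>Both sides of the inversion law of \<open>E2\<close> are differentiated and every
  derivative is replaced by Ramanujan's expression. All terms containing \<open>E2\<close> cancel,
  and what is left is the law of \<open>E4\<close>.\<close>

lemma E4_S:
  assumes z: "Im z > 0"
  shows "E4 (- 1 / z) = z ^ 4 * E4 z"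
proof -
  have z0: "z \<noteq> 0" using z by auto
  let ?p = "of_real pi * \<i> :: complex"
  let ?D = "\<lambda>z. 2 * of_real pi * \<i> * ((E2 z)\<^sup>2 - E4 z) / 12"
  have "((\<lambda>z. - 1 / z) has_field_derivative (1 / z\<^sup>2)) (at z)"
    using z0 by (auto intro!: derivative_eq_intros simp: power2_eq_square field_simps)
  then have 1: "((\<lambda>z. E2 (- 1 / z)) has_field_derivative (?D (- 1 / z) * (1 / z\<^sup>2))) (at z)"
    by (rule DERIV_chain2[where f = E2 and g = "\<lambda>z. - 1 / z", rotated])
       (rule E2_has_derivative[OF Im_neg_inverse_pos[OF z]])
  have 2: "((\<lambda>z. z\<^sup>2 * E2 z + 6 * z / ?p) has_field_derivative (2 * z * E2 z + z\<^sup>2 * ?D z + 6 / ?p)) (at z)"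
    by (auto intro!: derivative_eq_intros E2_has_derivative z)
  have "((\<lambda>z. E2 (- 1 / z)) has_field_derivative (2 * z * E2 z + z\<^sup>2 * ?D z + 6 / ?p)) (at z)"
  proof (rule has_field_derivative_transform_within_open[OF 2, where S = "{z. Im z > 0}"])
    show "x\<^sup>2 * E2 x + 6 * x / ?p = E2 (- 1 / x)" if "x \<in> {z. Im z > 0}" for x
      using that by (simp only: mem_Collect_eq E2_S)
  qed (use z in \<open>auto simp: open_halfspace_Im_gt\<close>)
  from DERIV_unique[OF 1 this]
  have "?D (- 1 / z) * (1 / z\<^sup>2) = 2 * z * E2 z + z\<^sup>2 * ?D z + 6 / ?p" .
  then have "?D (- 1 / z) = z\<^sup>2 * (2 * z * E2 z + z\<^sup>2 * ?D z + 6 / ?p)"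
    using z0 by (simp add: field_simps)
  moreover have "?D w = ?p / 6 * ((E2 w)\<^sup>2 - E4 w)" for w
    by (simp add: mult_ac)
  ultimately have eq: "?p / 6 * ((E2 (- 1 / z))\<^sup>2 - E4 (- 1 / z)) = z\<^sup>2 * (2 * z * E2 z + z\<^sup>2 * (?p / 6 * ((E2 z)\<^sup>2 - E4 z)) + 6 / ?p)"
    by (simp only:)
  \<comment> \<open>The elimination in plain variables: h is pi i / 6, u is 6 / (pi i), the letters
    e and f are the values of \<open>E2\<close> and \<open>E4\<close> at z, and primes denote the
    values at -1/z.\<close>
  have "f' = z ^ 4 * f"
    if a: "h * (e'\<^sup>2 - f') = z\<^sup>2 * (2 * z * e + z\<^sup>2 * (h * (e\<^sup>2 - f)) + u)" "e' = z\<^sup>2 * e + z * u" "u * h = 1"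
    for h u e e' f f' :: complex
  proof -
    have "u * (h * (e'\<^sup>2 - f')) = u * (z\<^sup>2 * (2 * z * e + z\<^sup>2 * (h * (e\<^sup>2 - f)) + u))"
      using a(1) by simp
    also have "u * (h * (e'\<^sup>2 - f')) = e'\<^sup>2 - f'"
      using a(3) by (simp add: mult.assoc[symmetric])
    also have "u * (z\<^sup>2 * (2 * z * e + z\<^sup>2 * (h * (e\<^sup>2 - f)) + u)) = z\<^sup>2 * (2 * z * e * u + z\<^sup>2 * ((u * h) * (e\<^sup>2 - f)) + u\<^sup>2)"
      by (simp add: algebra_simps power2_eq_square)
    also have "\<dots> = (z\<^sup>2 * e + z * u)\<^sup>2 - z ^ 4 * f"
      unfolding a(3) by (simp add: algebra_simps power2_eq_square eval_nat_numeral)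
    finally show "f' = z ^ 4 * f"
      by (simp add: a(2))
  qed
  from this[OF eq] E2_S[OF z] show ?thesis by (simp add: mult.commute)
qed

lemma E4_SL2Z:
  assumes "a * d - b * c = 1" and z: "Im z > 0"
  shows "E4 ((of_int a * z + of_int b) / (of_int c * z + of_int d)) = (of_int c * z + of_int d) ^ 4 * E4 z"
proof (rule SL2Z_induct[OF assms(1)], goal_cases)
  case (1 a b d)
  then have "(a = 1 \<and> d = 1) \<or> (a = - 1 \<and> d = - 1)"
    by (simp add: zmult_eq_1_iff)
  then show ?case
    using E4_T[of z b] E4_T[of z "- b"] by auto
next
  case (2 a b c d k)
  define w where "w = (of_int a * z + of_int b) / (of_int c * z + of_int d)"
  have j: "of_int a * z + of_int b \<noteq> 0" "of_int c * z + of_int d \<noteq> 0"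
    using lattice_nonzero[OF z] SL2Z_row_nonzero[OF 2(1)] by blast+
  have w: "Im w > 0" unfolding w_def using moebius_Im_pos[OF z 2(1)] j by auto
  have "(of_int (k * a - c) * z + of_int (k * b - d)) / (of_int a * z + of_int b) = - 1 / w + of_int k"
    unfolding w_def using j by (simp add: field_simps)
  then have "E4 ((of_int (k * a - c) * z + of_int (k * b - d)) / (of_int a * z + of_int b)) = w ^ 4 * E4 w"
    by (simp only: E4_T E4_S[OF w(1)])
  also have "E4 w = (of_int c * z + of_int d) ^ 4 * E4 z"
    unfolding w_def by (rule 2(2))
  also have "w ^ 4 * \<dots> = (w * (of_int c * z + of_int d)) ^ 4 * E4 z"
    by (simp add: power_mult_distrib)
  also have "w * (of_int c * z + of_int d) = of_int a * z + of_int b"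
    unfolding w_def using j by simp
  finally show ?case .
qed

section \<open>Cusp forms built from Eisenstein series\<close>

definition sl :: "nat \<Rightarrow> (complex \<Rightarrow> complex) \<Rightarrow> int \<Rightarrow> int \<Rightarrow> int \<Rightarrow> int \<Rightarrow> complex \<Rightarrow> complex" where
  "sl k f a b c d z = f ((of_int a * z + of_int b) / (of_int c * z + of_int d)) / (of_int c * z + of_int d) ^ k"

lemma slash_eq_sl: "slash k f A = sl k f (A $ 1 $ 1) (A $ 1 $ 2) (A $ 2 $ 1) (A $ 2 $ 2)"
  by (simp add: fun_eq_iff slash_def sl_def)

definition mat22 :: "int \<Rightarrow> int \<Rightarrow> int \<Rightarrow> int \<Rightarrow> int^2^2" where
  "mat22 a b c d = (\<chi> i j. if i = 1 then (if j = 1 then a else b) else (if j = 1 then c else d))"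

lemma mat22_nth [simp]:
  "mat22 a b c d $ 1 $ 1 = a" "mat22 a b c d $ 1 $ 2 = b" "mat22 a b c d $ 2 $ 1 = c" "mat22 a b c d $ 2 $ 2 = d"
  by (simp_all add: mat22_def)

lemma SL2Z_iff: "A \<in> SL2Z \<longleftrightarrow> A $ 1 $ 1 * A $ 2 $ 2 - A $ 1 $ 2 * A $ 2 $ 1 = 1"
  by (simp add: SL2Z_def det_2)

lemma upper_half_plane_iff [simp]: "z \<in> \<H> \<longleftrightarrow> Im z > 0"
  by (simp add: upper_half_plane_def)

lemma has_qexp_iff_sums:
  assumes "N > 0"
  shows "(\<exists>F. has_qexp N F f \<and> fps_nth F 0 = 0) \<longleftrightarrow>
    (\<exists>a :: nat \<Rightarrow> complex. a 0 = 0 \<and> (\<forall>z\<in>\<H>. (\<lambda>n. a n * exp (2 * of_real pi * \<i> * of_nat n * z / of_nat N)) sums f z))"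
proof
  assume "\<exists>F. has_qexp N F f \<and> fps_nth F 0 = 0"
  then obtain F where F: "has_qexp N F f" "fps_nth F 0 = 0" by blast
  then show "\<exists>a :: nat \<Rightarrow> complex. a 0 = 0 \<and> (\<forall>z\<in>\<H>. (\<lambda>n. a n * exp (2 * of_real pi * \<i> * of_nat n * z / of_nat N)) sums f z)"
    using has_qexp_sums[OF assms F(1)] by (intro exI[of _ "fps_nth F"]) auto
next
  assume "\<exists>a :: nat \<Rightarrow> complex. a 0 = 0 \<and> (\<forall>z\<in>\<H>. (\<lambda>n. a n * exp (2 * of_real pi * \<i> * of_nat n * z / of_nat N)) sums f z)"
  then obtain a :: "nat \<Rightarrow> complex" where "a 0 = 0" "\<forall>z\<in>\<H>. (\<lambda>n. a n * exp (2 * of_real pi * \<i> * of_nat n * z / of_nat N)) sums f z"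
    by blast
  then show "\<exists>F. has_qexp N F f \<and> fps_nth F 0 = 0"
    using has_qexpI_sums[OF assms, of a f] by (intro exI[of _ "Abs_fps a"]) auto
qed

lemma cusp_forms_iff:
  assumes "N > 0"
  shows "f \<in> cusp_forms k N \<longleftrightarrow>
     f holomorphic_on {z. Im z > 0} \<and> (\<forall>z. Im z \<le> 0 \<longrightarrow> f z = 0) \<and>
     (\<forall>a b c d z. a * d - b * c = 1 \<longrightarrow> int N dvd c \<longrightarrow> Im z > 0 \<longrightarrow> sl k f a b c d z = f z) \<and>
     (\<forall>a b c d. a * d - b * c = 1 \<longrightarrow> (\<exists>F. has_qexp N F (sl k f a b c d) \<and> fps_nth F 0 = 0))"
proof -
  have 1: "(\<forall>A\<in>Gamma0 N. \<forall>z\<in>\<H>. slash k f A z = f z) \<longleftrightarrow>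
      (\<forall>a b c d z. a * d - b * c = 1 \<longrightarrow> int N dvd c \<longrightarrow> Im z > 0 \<longrightarrow> sl k f a b c d z = f z)"
  proof safe
    fix a b c d :: int and z assume "\<forall>A\<in>Gamma0 N. \<forall>z\<in>\<H>. slash k f A z = f z" "a * d - b * c = 1" "int N dvd c" "Im z > 0"
    then show "sl k f a b c d z = f z"
      using bspec[of "Gamma0 N" "\<lambda>A. \<forall>z\<in>\<H>. slash k f A z = f z" "mat22 a b c d"]
      by (simp add: Gamma0_def SL2Z_iff slash_eq_sl)
  next
    fix A z assume "\<forall>a b c d z. a * d - b * c = 1 \<longrightarrow> int N dvd c \<longrightarrow> Im z > 0 \<longrightarrow> sl k f a b c d z = f z" "A \<in> Gamma0 N" "z \<in> \<H>"
    then show "slash k f A z = f z"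
      by (auto simp: Gamma0_def SL2Z_iff slash_eq_sl)
  qed
  have 2: "(\<forall>A\<in>SL2Z. P (slash k f A)) \<longleftrightarrow> (\<forall>a b c d. a * d - b * c = 1 \<longrightarrow> P (sl k f a b c d))" for P
  proof safe
    fix a b c d :: int assume "\<forall>A\<in>SL2Z. P (slash k f A)" "a * d - b * c = 1"
    then show "P (sl k f a b c d)"
      by (auto simp: SL2Z_iff slash_eq_sl dest!: bspec[where x = "mat22 a b c d"])
  next
    fix A assume "\<forall>a b c d. a * d - b * c = 1 \<longrightarrow> P (sl k f a b c d)" "A \<in> SL2Z"
    then show "P (slash k f A)"
      by (auto simp: SL2Z_iff slash_eq_sl)
  qed
  show ?thesis
    unfolding cusp_forms_def mem_Collect_eq 1
      2[where P = "\<lambda>g. \<exists>a :: nat \<Rightarrow> complex. a 0 = 0 \<and> (\<forall>z\<in>\<H>. (\<lambda>n. a n * exp (2 * of_real pi * \<i> * of_nat n * z / of_nat N)) sums g z)"]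
      has_qexp_iff_sums[OF assms]
    by (simp add: upper_half_plane_def not_less)
qed

text \<open>The product of diag(M, 1) with the given matrix is factored as the element of SL(2,Z)
  with rows (\<alpha>, \<beta>) and (\<gamma>, \<delta>) times the triangular matrix with rows (g,
  e) and (0, m). A dilated form thus behaves at any cusp like the form itself at an affine
  argument.\<close>

lemma moebius_dilation:
  fixes a b c d :: int and M :: nat
  assumes det: "a * d - b * c = 1" and M: "M > 0"
  obtains g m :: nat and \<alpha> \<delta> \<beta> \<gamma> e :: int where
    "int g = gcd c (int M)" "M = g * m" "\<alpha> * \<delta> - \<beta> * \<gamma> = 1" "c = \<gamma> * int g"
    "\<forall>z \<tau> :: complex. \<tau> = (of_nat g * z + of_int e) / of_nat m \<longrightarrow>
       of_int \<gamma> * \<tau> + of_int \<delta> = (of_int c * z + of_int d) / of_nat m"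
    "\<forall>z \<tau> :: complex. \<tau> = (of_nat g * z + of_int e) / of_nat m \<longrightarrow>
       of_nat M * ((of_int a * z + of_int b) / (of_int c * z + of_int d)) = (of_int \<alpha> * \<tau> + of_int \<beta>) / (of_int \<gamma> * \<tau> + of_int \<delta>)"
proof -
  define g where "g = nat (gcd c (int M))"
  have g: "int g = gcd c (int M)" by (simp add: g_def)
  have gpos: "g > 0" using M by (simp add: g_def)
  have "g dvd M" using g by (metis gcd_dvd2 int_dvd_int_iff)
  then obtain m where m: "M = g * m" by blast
  then have mpos: "m > 0" using M by auto
  obtain \<gamma> where \<gamma>: "c = int g * \<gamma>" using g by (metis dvdE gcd_dvd1)
  have "gcd (int g * \<gamma>) (int g * int m) = int g"
    using g \<gamma> m by simp
  then have "int g * gcd \<gamma> (int m) = int g * 1"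
    using gcd_mult_distrib_int[of "int g" \<gamma> "int m"] by simp
  then have "gcd \<gamma> (int m) = 1" using gpos by simp
  then obtain u v where uv: "u * \<gamma> + v * int m = 1"
    using bezout_int[of \<gamma> "int m"] by auto
  \<comment> \<open>With the Bezout coefficient u this e solves \<gamma> e = d modulo m, and
    \<delta> is the quotient.\<close>
  define e where "e = u * d"
  define \<delta> where "\<delta> = v * d"
  have "d = (u * \<gamma> + v * int m) * d" using uv by simp
  then have \<delta>: "d = \<gamma> * e + int m * \<delta>"
    by (simp add: e_def \<delta>_def algebra_simps)
  define \<alpha> where "\<alpha> = int m * a"
  define \<beta> where "\<beta> = int g * b - a * e"
  have det': "\<alpha> * \<delta> - \<beta> * \<gamma> = 1"
  proof -
    have "\<alpha> * \<delta> - \<beta> * \<gamma> = a * (\<gamma> * e + int m * \<delta>) - b * (int g * \<gamma>)"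
      unfolding \<alpha>_def \<beta>_def by (simp add: algebra_simps)
    then show ?thesis using det \<gamma> \<delta> by simp
  qed
  have j: "of_int \<gamma> * ((of_nat g * z + of_int e) / of_nat m) + of_int \<delta> = (of_int c * z + of_int d) / (of_nat m :: complex)" for z
  proof -
    have "complex_of_int c = of_nat g * of_int \<gamma>" "complex_of_int d = of_int \<gamma> * of_int e + of_nat m * of_int \<delta>"
      using arg_cong[OF \<gamma>, of complex_of_int] arg_cong[OF \<delta>, of complex_of_int] by simp_all
    then show ?thesis using mpos by (simp add: field_simps)
  qed
  show thesis
  proof (rule that[OF g m det'])
    show "c = \<gamma> * int g" using \<gamma> by simp
    show "\<forall>z \<tau> :: complex. \<tau> = (of_nat g * z + of_int e) / of_nat m \<longrightarrow>
       of_int \<gamma> * \<tau> + of_int \<delta> = (of_int c * z + of_int d) / of_nat m"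
      using j by blast
    show "\<forall>z \<tau> :: complex. \<tau> = (of_nat g * z + of_int e) / of_nat m \<longrightarrow>
       of_nat M * ((of_int a * z + of_int b) / (of_int c * z + of_int d)) = (of_int \<alpha> * \<tau> + of_int \<beta>) / (of_int \<gamma> * \<tau> + of_int \<delta>)"
    proof (intro allI impI)
      fix z \<tau> :: complex assume \<tau>: "\<tau> = (of_nat g * z + of_int e) / of_nat m"
      have num: "of_int \<alpha> * \<tau> + of_int \<beta> = of_nat g * (of_int a * z + of_int b)"
        unfolding \<alpha>_def \<beta>_def \<tau> using mpos by (simp add: field_simps)
      have "of_int \<gamma> * \<tau> + of_int \<delta> = (of_int c * z + of_int d) / of_nat m"
        unfolding \<tau> by (rule j)
      then show "of_nat M * ((of_int a * z + of_int b) / (of_int c * z + of_int d)) = (of_int \<alpha> * \<tau> + of_int \<beta>) / (of_int \<gamma> * \<tau> + of_int \<delta>)"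
        unfolding num m by (simp add: mult_ac)
    qed
  qed
qed

lemma affine_Im_pos:
  assumes "Im z > 0" "g > 0" "m > (0::nat)"
  shows "Im ((of_nat g * z + of_int e) / of_nat m) > 0"
proof -
  have "(of_nat g * z + of_int e) / of_nat m = of_real (1 / real m) * (of_real (real g) * z + of_int e)"
    by simp
  then have "Im ((of_nat g * z + of_int e) / of_nat m) = real g * Im z / real m"
    by (simp only: Im_complex_of_real times_complex.sel plus_complex.sel) simp
  then show ?thesis using assms by simp
qed

text \<open>The affine map turns the parameter of level L into a root of unity times a power of the
  parameter of level N, with an integral exponent because L m divides N. The constant term is not
  affected.\<close>

lemma has_qexp_affine:
  fixes g m L N :: nat and e :: int
  assumes F: "has_qexp L F f" and pos: "g > 0" "m > 0" "L > 0" "N > 0" and dvd: "L * m dvd N"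
  shows "\<exists>F'. has_qexp N F' (\<lambda>z. f ((of_nat g * z + of_int e) / of_nat m)) \<and> fps_nth F' 0 = fps_nth F 0"
proof -
  obtain k where k: "N = L * m * k" using dvd by blast
  then have kpos: "k > 0" using pos by auto
  define \<zeta> where "\<zeta> = exp (2 * of_real pi * \<i> * of_int e / of_nat (L * m))"
  have "2 * of_real pi * \<i> * of_int e / of_nat (L * m) = \<i> * of_real (2 * pi * of_int e / of_nat (L * m))"
    by simp
  then have \<zeta>: "norm \<zeta> = 1" unfolding \<zeta>_def by (simp only: norm_exp_i_times)
  have "has_qexp N (fps_sub \<zeta> (g * k) F) (\<lambda>z. f ((of_nat g * z + of_int e) / of_nat m))"
  proof (rule has_qexp_subst[OF pos(4) _ F \<zeta>])
    fix z assume z: "Im z > 0"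
    show "Im ((of_nat g * z + of_int e) / of_nat m) > 0"
      using z pos(1,2) by (rule affine_Im_pos)
    show "qpar L ((of_nat g * z + of_int e) / of_nat m) = \<zeta> * qpar N z ^ (g * k)"
      unfolding qpar_power unfolding qpar_def \<zeta>_def exp_add[symmetric]
      using pos kpos by (intro arg_cong[where f = exp]) (simp add: k field_simps)
  qed (use pos kpos in simp)
  then show ?thesis by (intro exI[of _ "fps_sub \<zeta> (g * k) F"]) simp
qed

definition GN :: "nat \<Rightarrow> complex \<Rightarrow> complex" where
  "GN N z = E2 z - of_nat N * E2 (of_nat N * z)"

lemma slash_dilated_E4:
  fixes M :: nat
  assumes det: "a * d - b * c = 1" and M: "M > 0"
  obtains g m :: nat and e :: int where "int g = gcd c (int M)" "M = g * m"
    "\<forall>z. Im z > 0 \<longrightarrow> sl 4 (\<lambda>z. E4 (of_nat M * z)) a b c d z =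
        (of_nat g / of_nat M) ^ 4 * E4 ((of_nat g * z + of_int e) / of_nat m)"
proof -
  obtain g m \<alpha> \<delta> \<beta> \<gamma> e where *: "int g = gcd c (int M)" "M = g * m" "\<alpha> * \<delta> - \<beta> * \<gamma> = 1" "c = \<gamma> * int g"
    "\<forall>z \<tau> :: complex. \<tau> = (of_nat g * z + of_int e) / of_nat m \<longrightarrow>
       of_int \<gamma> * \<tau> + of_int \<delta> = (of_int c * z + of_int d) / of_nat m"
    "\<forall>z \<tau> :: complex. \<tau> = (of_nat g * z + of_int e) / of_nat m \<longrightarrow>
       of_nat M * ((of_int a * z + of_int b) / (of_int c * z + of_int d)) = (of_int \<alpha> * \<tau> + of_int \<beta>) / (of_int \<gamma> * \<tau> + of_int \<delta>)"
    using moebius_dilation[OF det M] .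
  have pos: "g > 0" "m > 0" using M * by auto
  show thesis
  proof (rule that[OF *(1,2)], intro allI impI)
    fix z assume z: "Im z > 0"
    define \<tau> where "\<tau> = (of_nat g * z + of_int e) / of_nat m"
    have \<tau>: "Im \<tau> > 0" unfolding \<tau>_def using z pos by (rule affine_Im_pos)
    define J where "J = of_int c * z + of_int d"
    have J: "J \<noteq> 0" unfolding J_def using lattice_nonzero[OF z] SL2Z_row_nonzero[OF det] by blast
    have "sl 4 (\<lambda>z. E4 (of_nat M * z)) a b c d z = (J / of_nat m) ^ 4 * E4 \<tau> / J ^ 4"
      unfolding sl_def *(6)[rule_format, OF \<tau>_def] E4_SL2Z[OF *(3) \<tau>] unfolding *(5)[rule_format, OF \<tau>_def] J_def ..
    also have "\<dots> = (of_nat g / of_nat M) ^ 4 * E4 \<tau>"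
      using J pos by (simp add: *(2) power_divide)
    finally show "sl 4 (\<lambda>z. E4 (of_nat M * z)) a b c d z = (of_nat g / of_nat M) ^ 4 * E4 ((of_nat g * z + of_int e) / of_nat m)"
      unfolding \<tau>_def .
  qed
qed

text \<open>The defect 6 c (c z + d) / (pi i) of \<open>E2\<close> also arises from M times its
  dilation, since c = \<gamma> g. The two cancel in the difference, which is therefore modular of
  weight 2.\<close>

lemma slash_GN:
  fixes M :: nat
  assumes det: "a * d - b * c = 1" and M: "M > 0"
  obtains g m :: nat and e :: int where "int g = gcd c (int M)" "M = g * m"
    "\<forall>z. Im z > 0 \<longrightarrow> sl 2 (GN M) a b c d z =
        E2 z - of_nat g ^ 2 / of_nat M * E2 ((of_nat g * z + of_int e) / of_nat m)"
proof -
  obtain g m \<alpha> \<delta> \<beta> \<gamma> e where *: "int g = gcd c (int M)" "M = g * m" "\<alpha> * \<delta> - \<beta> * \<gamma> = 1" "c = \<gamma> * int g"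
    "\<forall>z \<tau> :: complex. \<tau> = (of_nat g * z + of_int e) / of_nat m \<longrightarrow>
       of_int \<gamma> * \<tau> + of_int \<delta> = (of_int c * z + of_int d) / of_nat m"
    "\<forall>z \<tau> :: complex. \<tau> = (of_nat g * z + of_int e) / of_nat m \<longrightarrow>
       of_nat M * ((of_int a * z + of_int b) / (of_int c * z + of_int d)) = (of_int \<alpha> * \<tau> + of_int \<beta>) / (of_int \<gamma> * \<tau> + of_int \<delta>)"
    using moebius_dilation[OF det M] .
  have pos: "g > 0" "m > 0" using M * by auto
  show thesis
  proof (rule that[OF *(1,2)], intro allI impI)
    fix z assume z: "Im z > 0"
    define \<tau> where "\<tau> = (of_nat g * z + of_int e) / of_nat m"
    have \<tau>: "Im \<tau> > 0" unfolding \<tau>_def using z pos by (rule affine_Im_pos)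
    define J where "J = of_int c * z + of_int d"
    have J: "J \<noteq> 0" unfolding J_def using lattice_nonzero[OF z] SL2Z_row_nonzero[OF det] by blast
    let ?p = "of_real pi * \<i> :: complex"
    have c: "of_int c = of_int \<gamma> * (of_nat g :: complex)" using *(4) by simp
    have "sl 2 (GN M) a b c d z = (J\<^sup>2 * E2 z + 6 * of_int c * J / ?p -
        of_nat M * ((J / of_nat m)\<^sup>2 * E2 \<tau> + 6 * of_int \<gamma> * (J / of_nat m) / ?p)) / J\<^sup>2"
      unfolding sl_def GN_def *(6)[rule_format, OF \<tau>_def] E2_SL2Z[OF *(3) \<tau>] E2_SL2Z[OF det z] unfolding *(5)[rule_format, OF \<tau>_def] J_def ..
    also have "of_nat M * ((J / of_nat m)\<^sup>2 * E2 \<tau> + 6 * of_int \<gamma> * (J / of_nat m) / ?p) =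
        of_nat g / of_nat m * (J\<^sup>2 * E2 \<tau>) + 6 * of_int c * J / ?p"
      unfolding c using pos by (simp add: *(2) field_simps power2_eq_square)
    also have "(J\<^sup>2 * E2 z + 6 * of_int c * J / ?p - (of_nat g / of_nat m * (J\<^sup>2 * E2 \<tau>) + 6 * of_int c * J / ?p)) / J\<^sup>2
        = E2 z - of_nat g / of_nat m * E2 \<tau>"
      using J by (simp add: diff_divide_distrib)
    also have "of_nat g / of_nat m = (of_nat g ^ 2 / of_nat M :: complex)"
      using pos by (simp add: *(2) field_simps power2_eq_square)
    finally show "sl 2 (GN M) a b c d z = E2 z - of_nat g ^ 2 / of_nat M * E2 ((of_nat g * z + of_int e) / of_nat m)"
      unfolding \<tau>_def .
  qed
qed

text \<open>The value 0 outside the upper half plane is the normalisation demanded by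
  \<open>cusp_forms\<close>. The weights e are free and get fixed level by level.\<close>

definition eis_comb :: "nat \<Rightarrow> (nat \<Rightarrow> complex) \<Rightarrow> complex \<Rightarrow> complex" where
  "eis_comb N e z = (if Im z > 0 then (GN N z)\<^sup>2 - (\<Sum>\<delta> | \<delta> dvd N. e \<delta> * E4 (of_nat \<delta> * z)) else 0)"

definition fps_dil :: "nat \<Rightarrow> complex fps \<Rightarrow> complex fps" where
  "fps_dil k F = Abs_fps (\<lambda>n. if k dvd n then fps_nth F (n div k) else 0)"

lemma has_qexp_dil:
  assumes "k > 0" "has_qexp 1 F f"
  shows "has_qexp 1 (fps_dil k F) (\<lambda>z. f (of_nat k * z))"
proof -
  have "has_qexp 1 (fps_sub 1 k F) (\<lambda>z. f (of_nat k * z))"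
    by (rule has_qexp_subst[OF _ assms(1,2)])
       (use assms in \<open>auto simp: qpar_power\<close>, simp add: qpar_def mult.assoc)
  moreover have "fps_sub 1 k F = fps_dil k F"
    by (simp add: fps_sub_def fps_dil_def fps_eq_iff)
  ultimately show ?thesis by simp
qed

definition eis_comb_fps :: "nat \<Rightarrow> (nat \<Rightarrow> complex) \<Rightarrow> complex fps" where
  "eis_comb_fps N e = (E2_fps - fps_const (of_nat N) * fps_dil N E2_fps)\<^sup>2
     - (\<Sum>\<delta> | \<delta> dvd N. fps_const (e \<delta>) * fps_dil \<delta> E4_fps)"

lemma has_qexp_eis_comb:
  assumes N: "N > 0"
  shows "has_qexp 1 (eis_comb_fps N e) (eis_comb N e)"
proof -
  have fin: "finite {\<delta>. \<delta> dvd N}" using N by simp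
  have "has_qexp 1 (eis_comb_fps N e) (\<lambda>z. (E2 z - of_nat N * E2 (of_nat N * z))\<^sup>2 - (\<Sum>\<delta> | \<delta> dvd N. e \<delta> * E4 (of_nat \<delta> * z)))"
    unfolding eis_comb_fps_def
    by (intro has_qexp_diff has_qexp_power has_qexp_cmult has_qexp_sum has_qexp_dil has_qexp_E2 has_qexp_E4 fin N)
       (use N in \<open>auto dest: dvd_pos_nat\<close>)
  then show ?thesis
    by (rule has_qexp_cong) (simp add: eis_comb_def GN_def)
qed

text \<open>At the cusp of a matrix with lower left entry c only g = gcd(c, N) matters: the constant
  term of \<open>GN\<close> is 1 - g^2/N there, and that of E_4(\<delta> z) is (gcd(g,
  \<delta>)/\<delta>)^4. One linear condition for each divisor g makes all constant terms
  vanish.\<close>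

lemma eis_comb_cusp_form:
  assumes N: "N > 0"
    and cond: "\<And>g. g dvd N \<Longrightarrow> (1 - of_nat g ^ 2 / of_nat N)\<^sup>2 = (\<Sum>\<delta> | \<delta> dvd N. e \<delta> * (of_nat (gcd g \<delta>) / of_nat \<delta>) ^ 4)"
  shows "eis_comb N e \<in> cusp_forms 4 N"
proof -
  have fin: "finite {\<delta>. \<delta> dvd N}" using N by simp
  have sl_comb: "sl 4 (eis_comb N e) a b c d z = (sl 2 (GN N) a b c d z)\<^sup>2 -
      (\<Sum>\<delta> | \<delta> dvd N. e \<delta> * sl 4 (\<lambda>z. E4 (of_nat \<delta> * z)) a b c d z)"
    if det: "a * d - b * c = 1" and z: "Im z > 0" for a b c d z
    using moebius_Im_pos[OF z det]
    by (simp add: sl_def eis_comb_def diff_divide_distrib power_divide sum_divide_distrib flip: power_mult)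
  have inv: "sl 4 (eis_comb N e) a b c d z = eis_comb N e z"
    if det: "a * d - b * c = 1" and c: "int N dvd c" and z: "Im z > 0" for a b c d z
  proof -
    have "sl 2 (GN N) a b c d z = GN N z"
    proof -
      obtain g m e where *: "int g = gcd c (int N)" "N = g * m"
        "\<forall>z. Im z > 0 \<longrightarrow> sl 2 (GN N) a b c d z = E2 z - of_nat g ^ 2 / of_nat N * E2 ((of_nat g * z + of_int e) / of_nat m)"
        using slash_GN[OF det N] .
      have "g = N" using *(1) c by (simp add: gcd_proj2_iff gcd.commute)
      then have "m = 1" using *(2) N by simp
      then show ?thesis
        using *(3)[rule_format, OF z] \<open>g = N\<close> N E2_T by (simp add: GN_def power2_eq_square)
    qed
    moreover have "sl 4 (\<lambda>z. E4 (of_nat \<delta> * z)) a b c d z = E4 (of_nat \<delta> * z)" if \<delta>: "\<delta> dvd N" for \<delta>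
    proof -
      have \<delta>pos: "\<delta> > 0" using \<delta> N by (auto dest: dvd_pos_nat)
      obtain g m e where *: "int g = gcd c (int \<delta>)" "\<delta> = g * m"
        "\<forall>z. Im z > 0 \<longrightarrow> sl 4 (\<lambda>z. E4 (of_nat \<delta> * z)) a b c d z = (of_nat g / of_nat \<delta>) ^ 4 * E4 ((of_nat g * z + of_int e) / of_nat m)"
        using slash_dilated_E4[OF det \<delta>pos] .
      have "int \<delta> dvd c" using \<delta> c by (meson dvd_trans int_dvd_int_iff)
      then have "g = \<delta>" using *(1) by (simp add: gcd_proj2_iff gcd.commute)
      then have "m = 1" using *(2) \<delta>pos by simp
      then show ?thesis
        using *(3)[rule_format, OF z] \<open>g = \<delta>\<close> \<delta>pos E4_T by simp
    qed
    ultimately show ?thesis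
      unfolding sl_comb[OF det z] using z by (simp add: eis_comb_def)
  qed
  have cusp: "\<exists>F. has_qexp N F (sl 4 (eis_comb N e) a b c d) \<and> fps_nth F 0 = 0" if det: "a * d - b * c = 1" for a b c d
  proof -
    define h where "h = nat (gcd c (int N))"
    have h: "int h = gcd c (int N)" by (simp add: h_def)
    have hN: "h dvd N" using h by (metis gcd_dvd2 int_dvd_int_iff)
    have E2N: "\<exists>F. has_qexp N F E2 \<and> fps_nth F 0 = 1"
      using has_qexp_affine[OF has_qexp_E2, of 1 1 N 0] N by (simp add: E2_fps_def sigma_fps_def)
    obtain F1 where F1: "has_qexp N F1 (sl 2 (GN N) a b c d)" "fps_nth F1 0 = 1 - of_nat h ^ 2 / of_nat N"
    proof -
      obtain g m e where *: "int g = gcd c (int N)" "N = g * m"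
        "\<forall>z. Im z > 0 \<longrightarrow> sl 2 (GN N) a b c d z = E2 z - of_nat g ^ 2 / of_nat N * E2 ((of_nat g * z + of_int e) / of_nat m)"
        using slash_GN[OF det N] .
      have pos: "g > 0" "m > 0" using N *(2) by auto
      have gh: "g = h" using *(1) h by simp
      obtain Fa where Fa: "has_qexp N Fa (\<lambda>z. E2 ((of_nat g * z + of_int e) / of_nat m))" "fps_nth Fa 0 = 1"
        using has_qexp_affine[OF has_qexp_E2 pos _ N, of e] *(2) by (auto simp: E2_fps_def sigma_fps_def)
      obtain Fb where Fb: "has_qexp N Fb E2" "fps_nth Fb 0 = 1" using E2N by blast
      have "has_qexp N (Fb - fps_const (of_nat g ^ 2 / of_nat N) * Fa) (sl 2 (GN N) a b c d)"
        by (rule has_qexp_cong[OF has_qexp_diff[OF N Fb(1) has_qexp_cmult[OF N Fa(1)]]]) (simp add: *(3))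
      then show thesis
        by (rule that) (simp add: Fa Fb gh)
    qed
    have "\<exists>F. has_qexp N F (sl 4 (\<lambda>z. E4 (of_nat \<delta> * z)) a b c d) \<and> fps_nth F 0 = (of_nat (gcd h \<delta>) / of_nat \<delta>) ^ 4"
      if \<delta>: "\<delta> dvd N" for \<delta>
    proof -
      have \<delta>pos: "\<delta> > 0" using \<delta> N by (auto dest: dvd_pos_nat)
      obtain g m e where *: "int g = gcd c (int \<delta>)" "\<delta> = g * m"
        "\<forall>z. Im z > 0 \<longrightarrow> sl 4 (\<lambda>z. E4 (of_nat \<delta> * z)) a b c d z = (of_nat g / of_nat \<delta>) ^ 4 * E4 ((of_nat g * z + of_int e) / of_nat m)"
        using slash_dilated_E4[OF det \<delta>pos] .
      have pos: "g > 0" "m > 0" using \<delta>pos *(2) by auto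
      have "gcd (int h) (int \<delta>) = gcd c (gcd (int N) (int \<delta>))"
        unfolding h by (rule gcd.assoc)
      also have "gcd (int N) (int \<delta>) = int \<delta>"
        using \<delta> by (simp add: gcd_proj2_iff)
      finally have gh: "g = gcd h \<delta>" using *(1) by (metis gcd_int_int_eq of_nat_eq_iff)
      have "m dvd N" using \<delta> *(2) by (meson dvd_trans dvd_triv_right)
      then obtain Fa where Fa: "has_qexp N Fa (\<lambda>z. E4 ((of_nat g * z + of_int e) / of_nat m))" "fps_nth Fa 0 = 1"
        using has_qexp_affine[OF has_qexp_E4 pos _ N, of e] by (auto simp: E4_fps_def sigma_fps_def)
      have "has_qexp N (fps_const ((of_nat g / of_nat \<delta>) ^ 4) * Fa) (sl 4 (\<lambda>z. E4 (of_nat \<delta> * z)) a b c d)"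
        by (rule has_qexp_cong[OF has_qexp_cmult[OF N Fa(1)]]) (simp add: *(3))
      then show ?thesis
        using Fa gh by (intro exI[of _ "fps_const ((of_nat g / of_nat \<delta>) ^ 4) * Fa"]) simp
    qed
    then obtain F where F: "\<And>\<delta>. \<delta> dvd N \<Longrightarrow> has_qexp N (F \<delta>) (sl 4 (\<lambda>z. E4 (of_nat \<delta> * z)) a b c d)"
      "\<And>\<delta>. \<delta> dvd N \<Longrightarrow> fps_nth (F \<delta>) 0 = (of_nat (gcd h \<delta>) / of_nat \<delta>) ^ 4"
      by metis
    have "has_qexp N (F1\<^sup>2 - (\<Sum>\<delta> | \<delta> dvd N. fps_const (e \<delta>) * F \<delta>))
       (\<lambda>z. (sl 2 (GN N) a b c d z)\<^sup>2 - (\<Sum>\<delta> | \<delta> dvd N. e \<delta> * sl 4 (\<lambda>z. E4 (of_nat \<delta> * z)) a b c d z))"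
      by (intro has_qexp_diff has_qexp_power has_qexp_cmult has_qexp_sum F1 F fin N) auto
    then have "has_qexp N (F1\<^sup>2 - (\<Sum>\<delta> | \<delta> dvd N. fps_const (e \<delta>) * F \<delta>)) (sl 4 (eis_comb N e) a b c d)"
      by (rule has_qexp_cong) (simp add: sl_comb[OF det])
    moreover have "fps_nth (F1\<^sup>2 - (\<Sum>\<delta> | \<delta> dvd N. fps_const (e \<delta>) * F \<delta>)) 0 = 0"
      using cond[OF hN] F1 F by (simp add: fps_sum_nth power2_eq_square)
    ultimately show ?thesis by blast
  qed
  have "eis_comb N e holomorphic_on {z. Im z > 0}"
    by (rule has_qexp_holomorphic[OF _ has_qexp_eis_comb[OF N]]) simp
  then show ?thesis
    using inv cusp by (subst cusp_forms_iff[OF N]) (auto simp: eis_comb_def)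
qed

section \<open>A bound for the order of vanishing\<close>

lemma sl_comp:
  assumes det: "a' * d' - b' * c' = 1" and z: "Im z > 0"
  shows "sl k (sl k f a b c d) a' b' c' d' z = sl k f (a * a' + b * c') (a * b' + b * d') (c * a' + d * c') (c * b' + d * d') z"
proof -
  define J where "J = of_int c' * z + of_int d'"
  define w where "w = (of_int a' * z + of_int b') / J"
  have J: "J \<noteq> 0" unfolding J_def using lattice_nonzero[OF z] SL2Z_row_nonzero[OF det] by blast
  have 1: "of_int x * w + of_int y = (of_int (x * a' + y * c') * z + of_int (x * b' + y * d')) / J" for x y :: int
    using J unfolding w_def by (simp add: J_def field_simps)
  have "sl k (sl k f a b c d) a' b' c' d' z = f ((of_int a * w + of_int b) / (of_int c * w + of_int d)) / ((of_int c * w + of_int d) * J) ^ k"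
    unfolding sl_def J_def[symmetric] w_def[symmetric] by (simp add: power_mult_distrib)
  also have "(of_int c * w + of_int d) * J = of_int (c * a' + d * c') * z + of_int (c * b' + d * d')"
    unfolding 1 using J by simp
  also have "(of_int a * w + of_int b) / (of_int c * w + of_int d) =
     (of_int (a * a' + b * c') * z + of_int (a * b' + b * d')) / (of_int (c * a' + d * c') * z + of_int (c * b' + d * d'))"
    unfolding 1 using J by simp
  finally show ?thesis unfolding sl_def .
qed

lemma sl_cong_fun:
  assumes "a * d - b * c = 1" "Im z > 0" "\<And>z. Im z > 0 \<Longrightarrow> f z = g z"
  shows "sl k f a b c d z = sl k g a b c d z"
  using assms(3)[OF moebius_Im_pos[OF assms(2,1)]] by (simp add: sl_def)

section \<open>Translates of a form indexed by bottom rows modulo N\<close>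

definition inv_level :: "nat \<Rightarrow> nat \<Rightarrow> (complex \<Rightarrow> complex) \<Rightarrow> bool" where
  "inv_level k N f \<longleftrightarrow> (\<forall>a b c d z. a * d - b * c = 1 \<longrightarrow> int N dvd c \<longrightarrow> Im z > 0 \<longrightarrow> sl k f a b c d z = f z)"

text \<open>If A and A' denote the two matrices, then A' A^(-1) has lower left entry c' d - d' c, so
  the congruence puts it into Gamma0(N). The numbers p, q, r, s are its entries.\<close>

lemma sl_cong_row:
  assumes inv: "inv_level k N f"
    and det: "a * d - b * c = 1" "a' * d' - b' * c' = 1" and N: "int N dvd c' * d - d' * c" and z: "Im z > 0"
  shows "sl k f a b c d z = sl k f a' b' c' d' z"
proof -
  define p where "p = a' * d - b' * c"
  define q where "q = b' * a - a' * b"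
  define r where "r = c' * d - d' * c"
  define s where "s = d' * a - c' * b"
  have "p * s - q * r = (a * d - b * c) * (a' * d' - b' * c')"
    by (simp add: p_def q_def r_def s_def algebra_simps)
  then have det2: "p * s - q * r = 1" using det by simp
  have rows: "p * a + q * c = a' * (a * d - b * c)" "p * b + q * d = b' * (a * d - b * c)"
     "r * a + s * c = c' * (a * d - b * c)" "r * b + s * d = d' * (a * d - b * c)"
    by (simp_all add: p_def q_def r_def s_def algebra_simps)
  have "sl k f a b c d z = sl k (sl k f p q r s) a b c d z"
    using inv det2 N by (intro sl_cong_fun[OF det(1) z]) (auto simp: inv_level_def r_def)
  also have "\<dots> = sl k f a' b' c' d' z"
    unfolding sl_comp[OF det(1) z] rows det(1) by simp
  finally show ?thesis .
qed

text \<open>Translates are indexed by residue pairs (c, d) instead of cosets, because z + 1 and -1/z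
  act on residues by explicit permutations. Each coset of Gamma0(N) occurs once for every unit
  modulo N, which merely raises the product of the translates to a power.\<close>

definition is_row :: "nat \<Rightarrow> int \<Rightarrow> int \<Rightarrow> int \<times> int \<times> int \<times> int \<Rightarrow> bool" where
  "is_row N c d = (\<lambda>(a, b, c', d'). a * d' - b * c' = 1 \<and> int N dvd c' - c \<and> int N dvd d' - d)"

definition rowf :: "nat \<Rightarrow> nat \<Rightarrow> (complex \<Rightarrow> complex) \<Rightarrow> int \<Rightarrow> int \<Rightarrow> complex \<Rightarrow> complex" where
  "rowf N k f c d = (case (SOME t. is_row N c d t) of (a, b, c', d') \<Rightarrow> sl k f a b c' d')"

lemma dvd_diff_mod: "int N dvd x - y mod int N \<longleftrightarrow> int N dvd x - y"
  by (metis mod_diff_right_eq dvd_eq_mod_eq_0)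

lemma rowf_mod: "rowf N k f (c mod int N) (d mod int N) = rowf N k f c d"
  by (simp add: rowf_def is_row_def dvd_diff_mod)

lemma rowf_eq:
  assumes inv: "inv_level k N f" and row: "is_row N c d (a, b, c', d')" and z: "Im z > 0"
  shows "rowf N k f c d z = sl k f a b c' d' z"
proof -
  obtain a1 b1 c1 d1 where t: "(SOME t. is_row N c d t) = (a1, b1, c1, d1)"
    by (cases "SOME t. is_row N c d t")
  have row1: "is_row N c d (a1, b1, c1, d1)"
    using someI[of "is_row N c d", OF row] t by simp
  obtain x y u v where *: "c' - c = int N * x" "d' - d = int N * y" "c1 - c = int N * u" "d1 - d = int N * v"
    using row row1 unfolding is_row_def by (auto elim!: dvdE)
  then have "c' = c + int N * x" "d' = d + int N * y" "c1 = c + int N * u" "d1 = d + int N * v"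
    by simp_all
  then have "c' * d1 - d' * c1 = int N * (c * v + x * d + int N * x * v - d * u - y * c - int N * y * u)"
    by (simp add: algebra_simps)
  then have "int N dvd c' * d1 - d' * c1" by simp
  then show ?thesis
    unfolding rowf_def t using sl_cong_row[OF inv _ _ _ z, of a1 d1 b1 c1 a d' b c'] row row1
    by (simp add: is_row_def)
qed

definition row_classes :: "nat \<Rightarrow> (int \<times> int) set" where
  "row_classes N = {(c, d). 0 \<le> c \<and> c < int N \<and> 0 \<le> d \<and> d < int N \<and> (\<exists>t. is_row N c d t)}"

lemma finite_row_classes: "finite (row_classes N)"
  by (rule finite_subset[of _ "{0..<int N} \<times> {0..<int N}"]) (auto simp: row_classes_def)

lemma ex_is_row_mod: "(\<exists>t. is_row N (c mod int N) (d mod int N) t) \<longleftrightarrow> (\<exists>t. is_row N c d t)"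
  by (simp add: is_row_def dvd_diff_mod)

lemma mod_in_rows:
  assumes "N > 0" "is_row N c d t"
  shows "(c mod int N, d mod int N) \<in> row_classes N"
proof -
  have "\<exists>t. is_row N (c mod int N) (d mod int N) t" using assms(2) ex_is_row_mod by blast
  then show ?thesis using assms(1) unfolding row_classes_def by simp
qed

lemma is_row_T: "is_row N c d (a, b, c', d') \<Longrightarrow> is_row N c (d + n * c) (a, b + n * a, c', d' + n * c')"
proof -
  assume "is_row N c d (a, b, c', d')"
  then have *: "a * d' - b * c' = 1" "int N dvd c' - c" "int N dvd d' - d" by (auto simp: is_row_def)
  have "int N dvd (d' - d) + n * (c' - c)" using * by (intro dvd_add dvd_mult)
  then show ?thesis using * by (simp add: is_row_def algebra_simps)
qed

lemma is_row_S: "is_row N c d (a, b, c', d') \<Longrightarrow> is_row N d (- c) (b, - a, d', - c')"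
  by (auto simp: is_row_def algebra_simps)

lemma bij_rows_T:
  assumes N: "N > 0"
  shows "bij_betw (\<lambda>(c, d). (c, (d + c) mod int N)) (row_classes N) (row_classes N)"
proof (rule bij_betwI[where g = "\<lambda>(c, d). (c, (d - c) mod int N)"])
  have "(c, (d + n * c) mod int N) \<in> row_classes N" if "(c, d) \<in> row_classes N" for c d n
  proof -
    from that obtain a b c' d' where "is_row N c d (a, b, c', d')" by (auto simp: row_classes_def)
    from mod_in_rows[OF N is_row_T[OF this, of n]] that show ?thesis by (auto simp: row_classes_def)
  qed
  from this[where n = 1] this[where n = "- 1"]
  show "(\<lambda>(c, d). (c, (d + c) mod int N)) \<in> row_classes N \<rightarrow> row_classes N" "(\<lambda>(c, d). (c, (d - c) mod int N)) \<in> row_classes N \<rightarrow> row_classes N"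
    by auto
qed (auto simp: row_classes_def mod_simps)

lemma bij_rows_S:
  assumes N: "N > 0"
  shows "bij_betw (\<lambda>(c, d). (d, (- c) mod int N)) (row_classes N) (row_classes N)"
proof (rule bij_betwI[where g = "\<lambda>(c, d). ((- d) mod int N, c)"])
  have *: "(d, (- c) mod int N) \<in> row_classes N" if "(c, d) \<in> row_classes N" for c d
  proof -
    from that obtain a b c' d' where "is_row N c d (a, b, c', d')" by (auto simp: row_classes_def)
    from mod_in_rows[OF N is_row_S[OF this]] that show ?thesis by (auto simp: row_classes_def)
  qed
  then show "(\<lambda>(c, d). (d, (- c) mod int N)) \<in> row_classes N \<rightarrow> row_classes N" by auto
  \<comment> \<open>The fourth power of the map is the identity, so its inverse is its cube.\<close>
  show "(\<lambda>(c, d). ((- d) mod int N, c)) \<in> row_classes N \<rightarrow> row_classes N"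
  proof clarsimp
    fix c d assume "(c, d) \<in> row_classes N"
    from *[OF *[OF *[OF this]]] \<open>(c, d) \<in> row_classes N\<close> show "((- d) mod int N, c) \<in> row_classes N"
      by (auto simp: row_classes_def mod_simps)
  qed
qed (auto simp: row_classes_def mod_simps)

lemma rowf_T:
  assumes inv: "inv_level k N f" and cd: "(c, d) \<in> row_classes N" and z: "Im z > 0"
  shows "rowf N k f c d (z + 1) = rowf N k f c ((d + c) mod int N) z"
proof -
  from cd obtain a b c' d' where row: "is_row N c d (a, b, c', d')" by (auto simp: row_classes_def)
  have "rowf N k f c d (z + 1) = sl k f a b c' d' (z + 1)"
    using z by (intro rowf_eq[OF inv row]) simp
  also have "\<dots> = sl k f a (b + 1 * a) c' (d' + 1 * c') z"
    by (simp add: sl_def algebra_simps)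
  also have "\<dots> = rowf N k f c (d + 1 * c) z"
    using rowf_eq[OF inv is_row_T[OF row, of 1] z] by simp
  also have "\<dots> = rowf N k f (c mod int N) ((d + c) mod int N) z"
    by (simp add: rowf_mod)
  also have "c mod int N = c" using cd by (auto simp: row_classes_def)
  finally show ?thesis .
qed

lemma rowf_S:
  assumes inv: "inv_level k N f" and cd: "(c, d) \<in> row_classes N" and z: "Im z > 0"
  shows "rowf N k f c d (- 1 / z) = z ^ k * rowf N k f d ((- c) mod int N) z"
proof -
  from cd obtain a b c' d' where row: "is_row N c d (a, b, c', d')" by (auto simp: row_classes_def)
  have z0: "z \<noteq> 0" using z by auto
  have 1: "of_int x * (- 1 / z) + of_int y = (of_int y * z + of_int (- x)) / z" for x y :: int
    using z0 by (simp add: field_simps)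
  have "rowf N k f c d (- 1 / z) = sl k f a b c' d' (- 1 / z)"
    using z by (intro rowf_eq[OF inv row] Im_neg_inverse_pos)
  also have "\<dots> = z ^ k * sl k f b (- a) d' (- c') z"
    unfolding sl_def 1 using z0 by (simp add: power_divide)
  also have "\<dots> = z ^ k * rowf N k f d (- c) z"
    using rowf_eq[OF inv is_row_S[OF row] z] by simp
  also have "\<dots> = z ^ k * rowf N k f (d mod int N) ((- c) mod int N) z"
    by (simp only: rowf_mod)
  also have "d mod int N = d" using cd by (auto simp: row_classes_def)
  finally show ?thesis .
qed

lemma qpar_add_nat: "qpar N (z + of_nat h) = exp (2 * of_real pi * \<i> * of_nat h / of_nat N) * qpar N z"
  unfolding qpar_def exp_add[symmetric] by (simp add: algebra_simps add_divide_distrib)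

text \<open>Translation by h multiplies the n-th coefficient by exp(2 pi i n h / N); where the
  coefficient is nonzero this factor has to be 1.\<close>

lemma periodic_qexp:
  assumes N: "N > 0" and F: "has_qexp N F g" and per: "\<And>z. Im z > 0 \<Longrightarrow> g (z + of_nat h) = g z"
    and n: "fps_nth F n \<noteq> 0"
  shows "N dvd n * h"
proof -
  define \<zeta> where "\<zeta> = exp (2 * of_real pi * \<i> * of_nat h / of_nat N)"
  have "2 * of_real pi * \<i> * of_nat h / of_nat N = \<i> * of_real (2 * pi * real h / real N)"
    by simp
  then have \<zeta>: "norm \<zeta> = 1" unfolding \<zeta>_def by (simp only: norm_exp_i_times)
  have "has_qexp N (fps_sub \<zeta> 1 F) (\<lambda>z. g (z + of_nat h))"
    by (rule has_qexp_subst[OF N _ F \<zeta>]) (auto simp: qpar_add_nat \<zeta>_def)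
  from has_qexp_unique[OF N this F] per have "fps_sub \<zeta> 1 F = F" by blast
  then have "fps_nth F n * \<zeta> ^ n = fps_nth F n"
    by (subst (asm) fps_eq_iff) (simp add: fps_sub_def)
  then have "\<zeta> ^ n = 1" using n by simp
  then have "exp (of_nat n * (2 * of_real pi * \<i> * of_nat h / of_nat N)) = exp 0"
    unfolding \<zeta>_def exp_of_nat_mult[symmetric] by (simp only: exp_zero)
  then obtain m :: int where "of_nat n * (2 * of_real pi * \<i> * of_nat h / of_nat N) = 0 + of_real (real_of_int (2 * m) * pi) * \<i>"
    unfolding exp_eq by blast
  then have "2 * of_real pi * \<i> * (of_nat n * of_nat h) = 2 * of_real pi * \<i> * (of_int m * of_nat N)"
    using N by (simp add: field_simps)
  then have "complex_of_nat n * of_nat h = of_int m * of_nat N"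
    by (subst (asm) mult_cancel_left) auto
  then have "complex_of_int (int (n * h)) = of_int (m * int N)" by simp
  then have "int (n * h) = m * int N" by (simp only: of_int_eq_iff)
  then show ?thesis by (metis dvd_triv_right int_dvd_int_iff)
qed

section \<open>Reduction to a strip and the vanishing bound in level one\<close>

lemma ex_equivalent_high_point:
  fixes \<Psi> :: "complex \<Rightarrow> real"
  assumes T: "\<And>z n. Im z > 0 \<Longrightarrow> \<Psi> (z + of_int n) = \<Psi> z" and S: "\<And>z. Im z > 0 \<Longrightarrow> \<Psi> (- 1 / z) = \<Psi> z"
    and z: "Im z > 0"
  shows "\<exists>z'. \<bar>Re z'\<bar> \<le> 1/2 \<and> Im z' \<ge> 43/50 \<and> \<Psi> z' = \<Psi> z"
proof -
  have shift: "\<exists>z'. \<bar>Re z'\<bar> \<le> 1/2 \<and> Im z' = Im z \<and> \<Psi> z' = \<Psi> z" if "Im z > 0" for z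
    using T[OF that, of "- round (Re z)"] of_int_round_abs_le[of "Re z"]
    by (intro exI[of _ "z + of_int (- round (Re z))"]) (auto simp: abs_minus_commute)
  \<comment> \<open>r = 1/4 + (43/50)^2 bounds |z|^2 for points of the strip below height 43/50. As
    43/50 lies strictly below sqrt(3)/2, r is smaller than 1, so each inversion raises the height by
    a factor of at least 1/r and the induction reaches every starting height.\<close>
  define r :: real where "r = 9896/10000"
  have main: "\<forall>z. Im z > 0 \<longrightarrow> Im z \<ge> 43/50 * r ^ n \<longrightarrow> (\<exists>z'. \<bar>Re z'\<bar> \<le> 1/2 \<and> Im z' \<ge> 43/50 \<and> \<Psi> z' = \<Psi> z)" for n
  proof (induction n)
    case 0
    then show ?case using shift by fastforce
  next
    case (Suc n)
    show ?case
    proof (intro allI impI)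
      fix z assume z: "Im z > 0" "Im z \<ge> 43/50 * r ^ Suc n"
      obtain z' where z': "\<bar>Re z'\<bar> \<le> 1/2" "Im z' = Im z" "\<Psi> z' = \<Psi> z" using shift[OF z(1)] by blast
      show "\<exists>z'. \<bar>Re z'\<bar> \<le> 1/2 \<and> Im z' \<ge> 43/50 \<and> \<Psi> z' = \<Psi> z"
      proof (cases "Im z' \<ge> 43/50")
        case True
        then show ?thesis using z' by blast
      next
        case False
        have "(Re z')\<^sup>2 \<le> (1/2)\<^sup>2" using z'(1) by (simp add: abs_le_square_iff[symmetric])
        moreover have "(Im z')\<^sup>2 \<le> (43/50)\<^sup>2" using False z z' by (intro power_mono) auto
        ultimately have n: "(Re z')\<^sup>2 + (Im z')\<^sup>2 \<le> r" by (simp add: r_def power2_eq_square)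
        have "(Im z')\<^sup>2 > 0" using z z' by simp
        then have n0: "(Re z')\<^sup>2 + (Im z')\<^sup>2 > 0" by (simp add: add_nonneg_pos)
        have "43/50 * r ^ n \<le> Im z' / r" using z z' by (simp add: r_def field_simps)
        also have "\<dots> \<le> Im z' / ((Re z')\<^sup>2 + (Im z')\<^sup>2)"
          using n n0 z z' by (intro divide_left_mono) (auto simp: r_def)
        also have "\<dots> = Im (- 1 / z')" by (simp add: Im_divide)
        finally have "43/50 * r ^ n \<le> Im (- 1 / z')" .
        moreover have "Im (- 1 / z') > 0" using z z' by (intro Im_neg_inverse_pos) simp
        ultimately obtain z'' where "\<bar>Re z''\<bar> \<le> 1/2" "Im z'' \<ge> 43/50" "\<Psi> z'' = \<Psi> (- 1 / z')"
          using Suc by blast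
        then show ?thesis using S[of z'] z z' by auto
      qed
    qed
  qed
  have "(0::real) < r" "r < 1" by (auto simp: r_def)
  then obtain n where "r ^ n < Im z" using real_arch_pow_inv[OF z] by blast
  moreover have "43/50 * r ^ n \<le> r ^ n" using \<open>0 < r\<close> by simp
  ultimately show ?thesis using main[of n] z by auto
qed

text \<open>At a maximum \<open>z\<^sub>0\<close> of the invariant function \<open>\<bar>P(z)\<bar> (Im z)\<^sup>s\<close> the maximum principle for \<open>P / q\<^sup>R\<close>
  on a slightly larger disc forces \<open>2 \<pi> R Im z\<^sub>0 \<le> s N\<close>, while \<open>Im z\<^sub>0 \<ge> 0.86\<close> may be assumed.
  This replaces the valence formula; it loses a factor \<open>2 \<pi> 0.86 / 6 < 1\<close>, which is affordable here.\<close>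
lemma level_one_vanishing:
  assumes N: "N > 0" and F: "has_qexp N F P" and ord: "\<And>i. i < R \<Longrightarrow> fps_nth F i = 0"
    and T: "\<And>z. Im z > 0 \<Longrightarrow> P (z + 1) = P z" and S: "\<And>z. Im z > 0 \<Longrightarrow> P (- 1 / z) = z ^ (2 * s) * P z"
    and less: "10 * s * N < 54 * R"
  shows "F = 0"
proof (rule ccontr)
  assume "F \<noteq> 0"
  define \<Psi> where "\<Psi> z = norm (P z) * Im z ^ s" for z
  have Tn: "P (z + of_nat n) = P z" if "Im z > 0" for z n
    using T that by (induction n) (auto simp: add.assoc[symmetric] add.commute[of 1])
  have Ti: "P (z + of_int n) = P z" if "Im z > 0" for z n
  proof (cases "n \<ge> 0")
    case True
    then show ?thesis using Tn[OF that, of "nat n"] by simp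
  next
    case False
    then show ?thesis using Tn[of "z + of_int n" "nat (- n)"] that by simp
  qed
  have \<Psi>T: "\<Psi> (z + of_int n) = \<Psi> z" if "Im z > 0" for z n
    using Ti[OF that] by (simp add: \<Psi>_def)
  have \<Psi>S: "\<Psi> (- 1 / z) = \<Psi> z" if z: "Im z > 0" for z
  proof -
    have "Im (- 1 / z) = Im z / (norm z)\<^sup>2" by (simp add: Im_divide cmod_power2)
    moreover have "norm z > 0" using z by auto
    ultimately show ?thesis
      unfolding \<Psi>_def S[OF z] by (simp add: norm_mult norm_power power_divide power_mult)
  qed
  \<comment> \<open>The series with its zero of order R at q = 0 divided out. It is holomorphic on
    the whole unit disc, including the point q = 0, so the maximum principle applies on discs around
    0.\<close>
  define G where "G = fps_shift R F"
  have radF: "fps_conv_radius F \<ge> 1" using F by (simp add: has_qexp_def)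
  then have radG: "fps_conv_radius G \<ge> 1" by (simp add: G_def)
  have FG: "F = G * fps_X ^ R"
    unfolding G_def using ord by (intro fps_shift_times_fps_X_power[symmetric] subdegree_geI) (use \<open>F \<noteq> 0\<close> in auto)
  have PG: "P z = eval_fps G (qpar N z) * qpar N z ^ R" if z: "Im z > 0" for z
  proof -
    have q: "norm (qpar N z) < 1" using norm_qpar_less_1[OF z N] .
    have "P z = eval_fps (G * fps_X ^ R) (qpar N z)" using F z FG by (simp add: has_qexp_def)
    also have "\<dots> = eval_fps G (qpar N z) * qpar N z ^ R"
      using less_fps_conv_radiusI[OF radG q] by (subst eval_fps_mult) auto
    finally show ?thesis .
  qed
  define \<alpha> where "\<alpha> = 2 * pi * real R / real N"
  have Rpos: "R > 0" using less by (cases R) auto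
  then have \<alpha>pos: "\<alpha> > 0" using N by (simp add: \<alpha>_def)
  have normq: "norm (qpar N z) ^ R = exp (- \<alpha> * Im z)" for z
    unfolding norm_qpar exp_of_nat_mult[symmetric] \<alpha>_def by (simp add: field_simps)
  have contG: "continuous_on (ball 0 1) (eval_fps G)"
    by (intro continuous_on_eval_fps') (auto simp: less_fps_conv_radiusI[OF radG] intro: continuous_on_id)
  have holG: "eval_fps G holomorphic_on ball 0 1"
    by (intro holomorphic_on_eval_fps) (auto simp: less_fps_conv_radiusI[OF radG])
  have holP: "P holomorphic_on {z. Im z > 0}" by (rule has_qexp_holomorphic[OF N F])
  obtain z1 where z1: "Im z1 > 0" "P z1 \<noteq> 0"
  proof -
    have "\<exists>z. Im z > 0 \<and> P z \<noteq> 0"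
    proof (rule ccontr)
      assume "\<not> ?thesis"
      then have "has_qexp N F (\<lambda>_. 0)" using F by (simp add: has_qexp_def)
      moreover have "has_qexp N 0 (\<lambda>_. 0)" using has_qexp_const[of N 0] by simp
      ultimately show False using has_qexp_unique[OF N] \<open>F \<noteq> 0\<close> by blast
    qed
    then show thesis using that by blast
  qed
  obtain z2 where z2: "\<bar>Re z2\<bar> \<le> 1/2" "Im z2 \<ge> 43/50" "\<Psi> z2 = \<Psi> z1"
    using ex_equivalent_high_point[OF \<Psi>T \<Psi>S z1(1)] by blast
  have \<Psi>1: "\<Psi> z1 > 0" using z1 by (simp add: \<Psi>_def)
  define \<rho> where "\<rho> = exp (- 2 * pi * (43/50) / real N)"
  have \<rho>: "\<rho> < 1" using N by (simp add: \<rho>_def)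
  have "compact (eval_fps G ` cball 0 \<rho>)"
    using \<rho> by (intro compact_continuous_image continuous_on_subset[OF contG]) auto
  then obtain C where C: "\<And>w. norm w \<le> \<rho> \<Longrightarrow> norm (eval_fps G w) \<le> C"
    by (force dest!: compact_imp_bounded simp: bounded_iff)
  have "C \<ge> 0" using C[of 0] norm_ge_zero by (metis \<rho>_def exp_ge_zero norm_zero order_trans)
  have \<Psi>le: "\<Psi> z \<le> C * (Im z ^ s * exp (- \<alpha> * Im z))" if z: "Im z \<ge> 43/50" for z
  proof -
    have "norm (qpar N z) \<le> \<rho>" unfolding norm_qpar \<rho>_def using z N by (simp add: field_simps)
    then have "norm (P z) \<le> C * exp (- \<alpha> * Im z)"
      using PG[of z] z C by (simp add: norm_mult norm_power normq mult_right_mono)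
    then have "norm (P z) * Im z ^ s \<le> (C * exp (- \<alpha> * Im z)) * Im z ^ s"
      using z by (intro mult_right_mono) auto
    then show ?thesis by (simp add: \<Psi>_def mult_ac)
  qed
  have "((\<lambda>y. C * (y ^ s * exp (- \<alpha> * y))) \<longlongrightarrow> C * 0) at_top"
  proof (intro tendsto_mult tendsto_const)
    have "((\<lambda>y. (\<alpha> * y) ^ s / exp (\<alpha> * y)) \<longlongrightarrow> 0) at_top"
      by (rule filterlim_compose[OF tendsto_power_div_exp_0])
         (intro filterlim_tendsto_pos_mult_at_top[OF tendsto_const \<alpha>pos] filterlim_ident)
    from tendsto_mult_left[OF this, of "1 / \<alpha> ^ s"] show "((\<lambda>y. y ^ s * exp (- \<alpha> * y)) \<longlongrightarrow> 0) at_top"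
      using \<alpha>pos by (simp add: power_mult_distrib exp_minus field_simps)
  qed
  then have "eventually (\<lambda>y. C * (y ^ s * exp (- \<alpha> * y)) < \<Psi> z1) at_top"
    using \<Psi>1 by (intro order_tendstoD) auto
  then obtain Y where Y: "\<And>y. y \<ge> Y \<Longrightarrow> C * (y ^ s * exp (- \<alpha> * y)) < \<Psi> z1"
    by (auto simp: eventually_at_top_linorder)
  \<comment> \<open>Above height Y the function \<Psi> stays below its positive value at z1. Its
    supremum over the half plane is therefore attained on this compact piece of the strip.\<close>
  define K where "K = cbox (Complex (- 1/2) (43/50)) (Complex (1/2) (max Y (43/50)))"
  have Kmem: "z \<in> K \<longleftrightarrow> \<bar>Re z\<bar> \<le> 1/2 \<and> 43/50 \<le> Im z \<and> Im z \<le> max Y (43/50)" for z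
    unfolding K_def in_cbox_complex_iff by auto
  have high: "z \<in> K" if "\<bar>Re z\<bar> \<le> 1/2" "Im z \<ge> 43/50" "\<Psi> z \<ge> \<Psi> z1" for z
    using that \<Psi>le[of z] Y[of "Im z"] unfolding Kmem by (cases "Im z \<ge> Y") auto
  have "continuous_on K \<Psi>"
    unfolding \<Psi>_def by (intro continuous_intros continuous_on_subset[OF holomorphic_on_imp_continuous_on[OF holP]]) (auto simp: Kmem)
  moreover have "compact K" by (simp add: K_def)
  moreover have "K \<noteq> {}" using high[of z2] z2 by auto
  ultimately obtain z0 where z0: "z0 \<in> K" "\<And>z. z \<in> K \<Longrightarrow> \<Psi> z \<le> \<Psi> z0"
    using continuous_attains_sup[of K \<Psi>] by blast
  define y0 where "y0 = Im z0"
  have y0: "y0 \<ge> 43/50" using z0 by (simp add: y0_def Kmem)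
  define M where "M = \<Psi> z0"
  have "\<Psi> z1 \<le> M" using z0(2)[OF high[of z2]] z2 by (simp add: M_def)
  then have Mpos: "M > 0" using \<Psi>1 by simp
  have max: "\<Psi> z \<le> M" if z: "Im z > 0" for z
  proof -
    obtain z' where z': "\<bar>Re z'\<bar> \<le> 1/2" "Im z' \<ge> 43/50" "\<Psi> z' = \<Psi> z"
      using ex_equivalent_high_point[OF \<Psi>T \<Psi>S z] by blast
    show ?thesis
    proof (cases "\<Psi> z \<ge> \<Psi> z1")
      case True
      then have "z' \<in> K" using high z' by simp
      then show ?thesis using z0(2)[of z'] z'(3) by (simp add: M_def)
    next
      case False
      then show ?thesis using \<open>\<Psi> z1 \<le> M\<close> by simp
    qed
  qed
  \<comment> \<open>The disc of radius r contains the parameter of z0, and its boundary circle is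
    the line Im z = y, where |P| <= M / y^s. Comparing with equality at z0, taking logarithms and
    using ln x <= x - 1 gives \<alpha> (y0 - y) <= s (y0 - y) / y.\<close>
  have key: "\<alpha> * y \<le> real s" if y: "0 < y" "y < y0" for y
  proof -
    define r where "r = exp (- 2 * pi * y / real N)"
    have r: "0 < r" "r < 1" using y N by (auto simp: r_def)
    have "norm (eval_fps G (qpar N z0)) \<le> M / (y ^ s * exp (- \<alpha> * y))"
    proof (rule maximum_modulus_frontier[where S = "ball 0 r" and f = "eval_fps G"])
      show "eval_fps G holomorphic_on interior (ball 0 r)"
        by (rule holomorphic_on_subset[OF holG]) (use r in auto)
      show "continuous_on (closure (ball 0 r)) (eval_fps G)"
        by (rule continuous_on_subset[OF contG]) (use r in auto)
      show "qpar N z0 \<in> ball 0 r"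
        using y N by (simp add: norm_qpar r_def y0_def divide_strict_right_mono)
      fix w :: complex assume "w \<in> frontier (ball 0 r)"
      then have w: "norm w = r" using r by simp
      have w': "w \<noteq> 0" "norm w < 1" using w r by auto
      obtain z where z: "Im z > 0" "qpar N z = w"
        using qpar_surj[OF w' N] .
      have "exp (- 2 * pi * Im z / real N) = exp (- 2 * pi * y / real N)"
        using norm_qpar[of N z] z w by (simp only: r_def)
      then have Imz: "Im z = y" using N by simp
      have "norm (P z) * y ^ s \<le> M" using max[OF z(1)] by (simp add: \<Psi>_def Imz)
      moreover have "norm (P z) = norm (eval_fps G w) * exp (- \<alpha> * y)"
        using PG[OF z(1)] normq[of z] by (simp add: norm_mult norm_power z Imz)
      ultimately show "norm (eval_fps G w) \<le> M / (y ^ s * exp (- \<alpha> * y))"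
        using y by (simp add: field_simps)
    qed auto
    moreover have "norm (eval_fps G (qpar N z0)) = M / (y0 ^ s * exp (- \<alpha> * y0))"
    proof -
      have "M = norm (eval_fps G (qpar N z0)) * exp (- \<alpha> * y0) * y0 ^ s"
        using PG[of z0] normq[of z0] y0 by (simp add: M_def \<Psi>_def norm_mult norm_power y0_def)
      then show ?thesis using y0 by simp
    qed
    ultimately have "M / (y0 ^ s * exp (- \<alpha> * y0)) \<le> M / (y ^ s * exp (- \<alpha> * y))" by simp
    then have "y ^ s * exp (- \<alpha> * y) \<le> y0 ^ s * exp (- \<alpha> * y0)"
      using Mpos y y0 by (simp add: divide_le_cancel frac_le_eq field_simps)
    then have "ln (y ^ s * exp (- \<alpha> * y)) \<le> ln (y0 ^ s * exp (- \<alpha> * y0))"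
      using y by simp
    then have "real s * ln y - \<alpha> * y \<le> real s * ln y0 - \<alpha> * y0"
      using y by (simp add: ln_mult ln_realpow)
    then have "\<alpha> * (y0 - y) \<le> real s * ln (y0 / y)"
      using y by (simp add: ln_div algebra_simps)
    also have "\<dots> \<le> real s * (y0 / y - 1)"
      using y by (intro mult_left_mono ln_le_minus_one) auto
    also have "\<dots> = real s / y * (y0 - y)" using y by (simp add: field_simps)
    finally have "\<alpha> * (y0 - y) \<le> real s / y * (y0 - y)" .
    then have "\<alpha> \<le> real s / y" by (rule mult_right_le_imp_le) (use y in simp)
    then show ?thesis using y by (simp add: field_simps)
  qed
  have "real s < \<alpha> * y0"
  proof -
    have "real (10 * s * N) < real (54 * R)" using less by (simp only: of_nat_less_iff)
    then have "real s * real N < 54/10 * real R" by (simp add: mult_ac)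
    \<comment> \<open>This is where the constant 54/10 of the hypothesis comes from: 2 pi 43/50 is
      slightly above 5.4.\<close>
    also have "\<dots> \<le> 2 * pi * (43/50) * real R"
      using pi_approx(1) by (intro mult_right_mono) auto
    finally have "real s < \<alpha> * (43/50)" using N by (simp add: \<alpha>_def field_simps)
    also have "\<dots> \<le> \<alpha> * y0" using \<alpha>pos y0 by (intro mult_left_mono) auto
    finally show ?thesis .
  qed
  then have "max (real s / \<alpha>) 0 < y0" using \<alpha>pos y0 by (simp add: field_simps)
  then obtain y where y: "max (real s / \<alpha>) 0 < y" "y < y0" using dense by blast
  then have "0 < y" "real s / \<alpha> < y" by auto
  then show False using key[of y] y(2) \<alpha>pos by (simp add: field_simps)
qed

section \<open>Orders of vanishing at all cusps\<close>

lemma cusp_form_inv_level: "N > 0 \<Longrightarrow> f \<in> cusp_forms k N \<Longrightarrow> inv_level k N f"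
  by (simp add: cusp_forms_iff inv_level_def)

lemma sl_id [simp]: "sl k f 1 0 0 1 = f"
  by (simp add: sl_def fun_eq_iff)

lemma sl_eq_0_imp:
  assumes det: "a * d - b * c = 1" and zero: "\<And>z. Im z > 0 \<Longrightarrow> sl k f a b c d z = 0" and z: "Im z > 0"
  shows "f z = 0"
proof -
  have det': "d * a - (- b) * (- c) = 1" using det by (simp add: algebra_simps)
  have "sl k (sl k f a b c d) d (- b) (- c) a z = sl k f 1 0 0 1 z"
    unfolding sl_comp[OF det' z] using det by (simp add: algebra_simps)
  moreover have "sl k (sl k f a b c d) d (- b) (- c) a z = 0"
    using zero[OF moebius_Im_pos[OF z det']] by (subst sl_def) simp
  ultimately show ?thesis by simp
qed

lemma inv_level_periodic:
  assumes "inv_level k N f" "Im z > 0"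
  shows "f (z + of_int e) = f z"
proof -
  have "sl k f 1 e 0 1 z = f z"
    using assms(1)[unfolded inv_level_def, rule_format, of 1 1 e 0 z] assms(2) by simp
  then show ?thesis by (simp add: sl_def)
qed

text \<open>The definition of a cusp form only provides an expansion of level N. Invariance under z
  + 1 removes the exponents that are not multiples of N.\<close>

lemma cusp_form_has_qexp:
  assumes N: "N > 0" and f: "f \<in> cusp_forms k N"
  obtains F where "has_qexp 1 F f" "fps_nth F 0 = 0"
proof -
  have "\<exists>F. has_qexp N F (sl k f 1 0 0 1) \<and> fps_nth F 0 = 0"
    using f N by (simp add: cusp_forms_iff del: sl_id)
  then obtain F0 where F0: "has_qexp N F0 f" "fps_nth F0 0 = 0" by auto
  have per: "f (z + of_nat 1) = f z" if "Im z > 0" for z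
    using inv_level_periodic[OF cusp_form_inv_level[OF N f] that, of 1] by simp
  have dvd: "N dvd n" if "fps_nth F0 n \<noteq> 0" for n
    using periodic_qexp[OF N F0(1) per that] by simp
  have "has_qexp 1 (Abs_fps (\<lambda>n. fps_nth F0 (n * N))) f"
  proof (rule has_qexpI_sums)
    fix z assume z: "Im z > 0"
    have "n \<in> range (\<lambda>n. n * N)" if "fps_nth F0 n \<noteq> 0" for n
      using dvd[OF that] by (auto elim!: dvdE simp: mult.commute)
    then have zero: "fps_nth F0 n * exp (2 * of_real pi * \<i> * of_nat n * z / of_nat N) = 0" if "n \<notin> range (\<lambda>n. n * N)" for n
      using that by auto
    have mono: "strict_mono (\<lambda>n. n * N)" using N by (auto simp: strict_mono_def)
    have "(\<lambda>n. fps_nth F0 (n * N) * exp (2 * of_real pi * \<i> * of_nat (n * N) * z / of_nat N)) sums f z"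
      using has_qexp_sums[OF N F0(1) z] iffD2[OF sums_mono_reindex[OF mono, where f = "\<lambda>n. fps_nth F0 n * exp (2 * of_real pi * \<i> * of_nat n * z / of_nat N)"]] zero by simp
    then show "(\<lambda>n. fps_nth F0 (n * N) * exp (2 * of_real pi * \<i> * of_nat n * z / of_nat 1)) sums f z"
      using N by (simp add: field_simps)
  qed simp
  then show thesis by (rule that) (simp add: F0)
qed

text \<open>Lower bounds for the orders of the translates in the parameter of level N. For c = 0,
  order m in q is order m N. For nonzero c the translate has period N / gcd(c^2, N), so its
  exponents are multiples of gcd(c^2, N), and for a cusp form the exponent 0 does not occur.\<close>

definition row_order :: "nat \<Rightarrow> nat \<Rightarrow> int \<times> int \<Rightarrow> nat" where
  "row_order N m = (\<lambda>(c, d). if c = 0 then m * N else nat (gcd (c * c) (int N)))"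

lemma rowf_qexp:
  assumes N: "N > 0" and f: "f \<in> cusp_forms k N" and Ff: "has_qexp 1 Ff f" "\<And>i. i < m \<Longrightarrow> fps_nth Ff i = 0"
    and cd: "(c, d) \<in> row_classes N"
  shows "\<exists>F. has_qexp N F (rowf N k f c d) \<and> (\<forall>i < row_order N m (c, d). fps_nth F i = 0)"
proof -
  note inv = cusp_form_inv_level[OF N f]
  from cd obtain a b c' d' where row: "is_row N c d (a, b, c', d')" by (auto simp: row_classes_def)
  then have det: "a * d' - b * c' = 1" and c': "int N dvd c' - c" by (auto simp: is_row_def)
  show ?thesis
  proof (cases "c = 0")
    case True
    have Nc: "int N dvd c'" using c' True by simp
    have eq: "rowf N k f c d z = f z" if z: "Im z > 0" for z
      using rowf_eq[OF inv row z] inv[unfolded inv_level_def, rule_format, OF det Nc z] by simp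
    have "has_qexp N (fps_sub 1 N Ff) f"
      by (rule has_qexp_subst[OF N N Ff(1), where \<phi> = "\<lambda>z. z"]) (use N in \<open>auto simp: qpar_power, simp add: qpar_def mult.assoc\<close>)
    then have "has_qexp N (fps_sub 1 N Ff) (rowf N k f c d)"
      by (rule has_qexp_cong) (simp add: eq)
    moreover have "fps_nth (fps_sub 1 N Ff) i = 0" if "i < row_order N m (c, d)" for i
      using that True N Ff(2)[of "i div N"] by (auto simp: fps_sub_def row_order_def div_less_iff_less_mult)
    ultimately show ?thesis by blast
  next
    case False
    obtain F where F: "has_qexp N F (sl k f a b c' d')" "fps_nth F 0 = 0"
      using f det unfolding cusp_forms_iff[OF N] by blast
    have F': "has_qexp N F (rowf N k f c d)"
      by (rule has_qexp_cong[OF F(1)]) (simp add: rowf_eq[OF inv row])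
    define g where "g = nat (gcd (c * c) (int N))"
    have g: "int g = gcd (c * c) (int N)" by (simp add: g_def)
    have "g dvd N" using g by (metis gcd_dvd2 int_dvd_int_iff)
    then obtain h where h: "N = g * h" by blast
    then have pos: "g > 0" "h > 0" using N by auto
    have "int N dvd c * c * int h"
    proof -
      have "int g dvd c * c" using g by (metis gcd_dvd1)
      then have "int g * int h dvd c * c * int h" by (intro mult_dvd_mono) auto
      then show ?thesis by (simp add: h)
    qed
    moreover have "int N dvd c' * c' * int h - c * c * int h"
    proof -
      have "c' * c' * int h - c * c * int h = (c' - c) * ((c' + c) * int h)" by (simp add: algebra_simps)
      then show ?thesis using c' by simp
    qed
    ultimately have "int N dvd c * c * int h + (c' * c' * int h - c * c * int h)" by (rule dvd_add)
    then have cc: "int N dvd c' * c' * int h" by simp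
    have per: "rowf N k f c d (z + of_nat h) = rowf N k f c d z" if z: "Im z > 0" for z
    proof -
      have "rowf N k f c d (z + of_nat h) = sl k f a b c' d' (z + of_nat h)"
        using z by (intro rowf_eq[OF inv row]) simp
      also have "\<dots> = sl k f a (b + int h * a) c' (d' + int h * c') z"
        by (simp add: sl_def algebra_simps)
      \<comment> \<open>The bottom row (c', d') becomes (c', d' + h c'); up to sign the quantity to
        be divisible by N is h c'^2.\<close>
      also have "\<dots> = sl k f a b c' d' z"
        using det cc by (intro sl_cong_row[OF inv _ _ _ z]) (simp_all add: algebra_simps)
      finally show ?thesis using rowf_eq[OF inv row z] by simp
    qed
    have "fps_nth F i = 0" if i: "i < row_order N m (c, d)" for i
    proof (rule ccontr)
      assume nz: "fps_nth F i \<noteq> 0"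
      have "g * h dvd i * h" using periodic_qexp[OF N F' per nz] h by simp
      then have "g dvd i" using pos by simp
      moreover have "i < g" using i False by (simp add: row_order_def g_def)
      ultimately have "i = 0" by (auto dest: dvd_imp_le)
      then show False using nz F by simp
    qed
    then show ?thesis using F' by blast
  qed
qed

lemma fps_prod_order:
  fixes F :: "'b \<Rightarrow> complex fps"
  assumes "finite A" "\<And>v. v \<in> A \<Longrightarrow> \<forall>i < r v. fps_nth (F v) i = 0"
  shows "\<forall>i < sum r A. fps_nth (prod F A) i = 0"
  using assms
proof (induction A rule: finite_induct)
  case (insert x A)
  show ?case
  proof (intro allI impI)
    fix i assume i: "i < sum r (insert x A)"
    have "fps_nth (F x) j * fps_nth (prod F A) (i - j) = 0" if "j \<le> i" for j
    proof (cases "j < r x")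
      case True
      then show ?thesis using insert.prems by simp
    next
      case False
      then have "i - j < sum r A" using i insert.hyps that by simp
      then show ?thesis using insert by simp
    qed
    then show "fps_nth (prod F (insert x A)) i = 0"
      using insert.hyps by (simp add: fps_mult_nth sum.neutral)
  qed
qed auto

text \<open>The product of all translates has weight 4 times the number of rows for the full modular
  group, so the level one bound applies with s equal to twice that number. A product of power series
  vanishes only if a factor does, and if one translate of \<open>f\<close> vanishes then so does
  \<open>f\<close>.\<close>

theorem sturm_vanishing:
  assumes N: "N > 0" and f: "f \<in> cusp_forms 4 N" and Ff: "has_qexp 1 Ff f" "\<And>i. i < m \<Longrightarrow> fps_nth Ff i = 0"
    and bound: "20 * card (row_classes N) * N < 54 * sum (row_order N m) (row_classes N)"
  shows "f = (\<lambda>_. 0)"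
proof -
  note inv = cusp_form_inv_level[OF N f]
  let ?V = "row_classes N"
  define h where "h v = rowf N 4 f (fst v) (snd v)" for v
  have "\<forall>v\<in>?V. \<exists>F. has_qexp N F (h v) \<and> (\<forall>i < row_order N m v. fps_nth F i = 0)"
    using rowf_qexp[OF N f Ff] by (auto simp: h_def)
  then obtain F where F: "\<And>v. v \<in> ?V \<Longrightarrow> has_qexp N (F v) (h v)" "\<And>v. v \<in> ?V \<Longrightarrow> \<forall>i < row_order N m v. fps_nth (F v) i = 0"
    by metis
  have prod_qexp: "has_qexp N (prod F A) (\<lambda>z. \<Prod>v\<in>A. h v z)" if "finite A" "A \<subseteq> ?V" for A
    using that
  proof (induction A rule: finite_induct)
    case empty
    then show ?case using has_qexp_const[of N 1] by simp
  next
    case (insert x A)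
    then show ?case using has_qexp_mult[OF N F(1)[of x]] by simp
  qed
  have "prod F ?V = 0"
  proof (rule level_one_vanishing[OF N prod_qexp[OF finite_row_classes order_refl], where R = "sum (row_order N m) ?V" and s = "2 * card ?V"])
    show "fps_nth (prod F ?V) i = 0" if "i < sum (row_order N m) ?V" for i
      using fps_prod_order[of ?V "row_order N m" F] finite_row_classes F(2) that by blast
    fix z assume z: "Im z > 0"
    have "(\<Prod>v\<in>?V. h v (z + 1)) = (\<Prod>v\<in>?V. h ((\<lambda>(c, d). (c, (d + c) mod int N)) v) z)"
      using rowf_T[OF inv _ z] by (intro prod.cong) (auto simp: h_def)
    also have "\<dots> = (\<Prod>v\<in>?V. h v z)"
      by (rule prod.reindex_bij_betw[OF bij_rows_T[OF N]])
    finally show "(\<Prod>v\<in>?V. h v (z + 1)) = (\<Prod>v\<in>?V. h v z)" .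
    have "(\<Prod>v\<in>?V. h v (- 1 / z)) = (\<Prod>v\<in>?V. z ^ 4 * h ((\<lambda>(c, d). (d, (- c) mod int N)) v) z)"
      using rowf_S[OF inv _ z] by (intro prod.cong) (auto simp: h_def)
    also have "\<dots> = z ^ (4 * card ?V) * (\<Prod>v\<in>?V. h ((\<lambda>(c, d). (d, (- c) mod int N)) v) z)"
      by (simp add: prod.distrib power_mult)
    also have "(\<Prod>v\<in>?V. h ((\<lambda>(c, d). (d, (- c) mod int N)) v) z) = (\<Prod>v\<in>?V. h v z)"
      by (rule prod.reindex_bij_betw[OF bij_rows_S[OF N]])
    finally show "(\<Prod>v\<in>?V. h v (- 1 / z)) = z ^ (2 * (2 * card ?V)) * (\<Prod>v\<in>?V. h v z)" by simp
  qed (use bound in simp)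
  then obtain v where v: "v \<in> ?V" "F v = 0" using finite_row_classes by auto
  obtain a b c d where row: "is_row N (fst v) (snd v) (a, b, c, d)" using v(1) by (auto simp: row_classes_def)
  then have det: "a * d - b * c = 1" by (simp add: is_row_def)
  have zero: "sl 4 f a b c d z = 0" if z: "Im z > 0" for z
    using F(1)[OF v(1)] v(2) z rowf_eq[OF inv row z] by (simp add: has_qexp_def h_def)
  have "f z = 0" for z
  proof (cases "Im z > 0")
    case True
    then show ?thesis using zero by (intro sl_eq_0_imp[OF det, where k = 4 and f = f]) auto
  next
    case False
    then show ?thesis using f N by (simp add: cusp_forms_iff)
  qed
  then show ?thesis by auto
qed

section \<open>Explicit rows, and the bound as a finite computation\<close>

lemma ex_coprime_translate:
  fixes c d N :: int
  assumes c: "c > 0" and cop: "gcd (gcd c d) N = 1"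
  shows "\<exists>t. coprime c (d + t * N)"
proof -
  \<comment> \<open>With t the product of the primes of c that do not divide d, each prime p of c
    divides exactly one of d and t N: if p divides d, then it divides neither t nor, by the gcd
    condition, N.\<close>
  define A where "A = {p \<in> prime_factors c. \<not> p dvd d}"
  have fin: "finite A" by (simp add: A_def)
  define t where "t = \<Prod>A"
  have "coprime c (d + t * N)"
  proof (rule ccontr)
    assume "\<not> coprime c (d + t * N)"
    then have "\<not> is_unit (gcd c (d + t * N))" by (simp add: is_unit_gcd_iff coprime_iff_gcd_eq_1)
    moreover have "gcd c (d + t * N) \<noteq> 0" using c by simp
    ultimately obtain p where p: "prime p" "p dvd gcd c (d + t * N)"
      using prime_divisor_exists by blast
    then have pc: "p dvd c" and pd: "p dvd d + t * N" by auto
    show False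
    proof (cases "p dvd d")
      case True
      then have "p dvd t * N" using pd by (simp add: dvd_add_right_iff)
      then have "p dvd t \<or> p dvd N" using p(1) by (simp add: prime_dvd_mult_iff)
      then show False
      proof
        assume "p dvd t"
        then obtain r where r: "r \<in> A" "p dvd r"
          unfolding t_def using prime_dvd_prod_iff[OF fin p(1)] by auto
        then have "prime r" by (auto simp: A_def)
        then have "p = r" using r p(1) primes_dvd_imp_eq by blast
        then show False using r True by (simp add: A_def)
      next
        assume "p dvd N"
        then have "p dvd gcd (gcd c d) N" using pc True by (intro gcd_greatest)
        then have "is_unit p" unfolding cop .
        then show False using p(1) not_prime_unit by blast
      qed
    next
      case False
      then have "p \<in> A" using p pc c by (auto simp: A_def prime_factors_dvd)
      then have "p dvd t" unfolding t_def using fin by (intro dvd_prodI)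
      then show False using pd False by (simp add: dvd_add_left_iff)
    qed
  qed
  then show ?thesis ..
qed

text \<open>Reduction modulo N maps SL(2,Z) onto all primitive bottom rows; the lift makes the two
  entries coprime and completes them to a matrix by Bezout.\<close>

lemma row_classes_eq:
  assumes N: "N > 0"
  shows "row_classes N = {(c, d). 0 \<le> c \<and> c < int N \<and> 0 \<le> d \<and> d < int N \<and> gcd (gcd c d) (int N) = 1}"
proof -
  have "(\<exists>t. is_row N c d t) \<longleftrightarrow> gcd (gcd c d) (int N) = 1" if cd: "0 \<le> c" for c d
  proof
    assume "\<exists>t. is_row N c d t"
    then obtain a b c' d' where row: "is_row N c d (a, b, c', d')" by auto
    let ?g = "gcd (gcd c d) (int N)"
    have g: "?g dvd c" "?g dvd d" "?g dvd int N" by (auto intro: dvd_trans)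
    have "?g dvd c' - c" "?g dvd d' - d" using row g(3) by (auto simp: is_row_def intro: dvd_trans)
    then have "?g dvd c'" "?g dvd d'" using g by (metis dvd_add diff_add_cancel)+
    then have "?g dvd a * d' - b * c'" by (intro dvd_diff dvd_mult)
    then show "?g = 1" using row by (simp add: is_row_def)
  next
    assume g: "gcd (gcd c d) (int N) = 1"
    \<comment> \<open>The residue 0 is represented by N, because the translation argument factors a
      positive number.\<close>
    define c1 where "c1 = (if c = 0 then int N else c)"
    have "c1 > 0" using cd N by (simp add: c1_def)
    moreover have "gcd (gcd c1 d) (int N) = 1"
      using g by (auto simp: c1_def gcd.commute gcd.left_commute)
    ultimately obtain t where t: "coprime c1 (d + t * int N)"
      using ex_coprime_translate[of c1 d "int N"] by auto
    then obtain u v where uv: "u * c1 + v * (d + t * int N) = 1"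
      using bezout_int[of c1 "d + t * int N"] by (auto simp: coprime_iff_gcd_eq_1)
    have "is_row N c d (v, - u, c1, d + t * int N)"
      using uv by (auto simp: is_row_def c1_def algebra_simps)
    then show "\<exists>t. is_row N c d t" by blast
  qed
  note * = this
  show ?thesis
  proof (rule set_eqI)
    fix x :: "int \<times> int"
    obtain c d where x: "x = (c, d)" by (cases x)
    show "x \<in> row_classes N \<longleftrightarrow> x \<in> {(c, d). 0 \<le> c \<and> c < int N \<and> 0 \<le> d \<and> d < int N \<and> gcd (gcd c d) (int N) = 1}"
      using *[of c d] unfolding x row_classes_def mem_Collect_eq prod.case
      by (cases "0 \<le> c") (simp_all del: split_paired_Ex)
  qed
qed

text \<open>The numerical hypothesis of \<open>sturm_vanishing\<close> as one signed sum over lists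
  of integers, a form that can be evaluated.\<close>

definition sturm_bound :: "int \<Rightarrow> int \<Rightarrow> bool" where
  "sturm_bound N m \<longleftrightarrow> N > 0 \<and> 0 < sum_list (map
     (\<lambda>(c, d). if gcd (gcd c d) N = 1 then 54 * (if c = 0 then m * N else gcd (c * c) N) - 20 * N else 0)
     (List.product [0..N - 1] [0..N - 1]))"

lemma sturm:
  assumes b: "sturm_bound (int N) (int m)" and f: "f \<in> cusp_forms 4 N" "has_qexp 1 F f" "\<And>i. i < m \<Longrightarrow> fps_nth F i = 0"
  shows "f = (\<lambda>_. 0)"
proof -
  have N: "N > 0" using b by (simp add: sturm_bound_def)
  let ?L = "List.product [0..int N - 1] [0..int N - 1]"
  let ?P = "\<lambda>(c, d). gcd (gcd c d) (int N) = 1"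
  let ?g = "\<lambda>v. 54 * int (row_order N m v) - 20 * int N"
  have set: "row_classes N = {v \<in> set ?L. ?P v}"
    unfolding row_classes_eq[OF N] by auto
  have "0 < sum_list (map (\<lambda>(c, d). if gcd (gcd c d) (int N) = 1 then 54 * (if c = 0 then int m * int N else gcd (c * c) (int N)) - 20 * int N else 0) ?L)"
    using b by (simp add: sturm_bound_def)
  also have "\<dots> = sum_list (map (\<lambda>v. if ?P v then ?g v else 0) ?L)"
    by (intro arg_cong[where f = sum_list] map_cong refl) (auto simp: row_order_def)
  also have "\<dots> = (\<Sum>v\<in>set ?L. if ?P v then ?g v else 0)"
    by (rule sum_list_distinct_conv_sum_set) (simp add: distinct_product)
  also have "\<dots> = (\<Sum>v\<in>row_classes N. ?g v)"
    unfolding set by (rule sum.inter_filter[symmetric]) simp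
  also have "\<dots> = 54 * int (sum (row_order N m) (row_classes N)) - 20 * int N * int (card (row_classes N))"
    by (simp add: sum_subtractf sum_distrib_left)
  finally have "int (20 * card (row_classes N) * N) < int (54 * sum (row_order N m) (row_classes N))"
    by (simp add: mult_ac)
  then show ?thesis
    by (intro sturm_vanishing[OF N f]) (simp_all only: of_nat_less_iff)
qed

text \<open>As the constant coefficient of a cusp form vanishes anyway, the second argument 1 means
  that there are no nonzero cusp forms, 2 that the space has dimension at most 1, and 4 that it has
  dimension at most 3. For level 7 the comparison is 20 48 7 = 6720 against 54 126 = 6804.\<close>

lemma sturm_bounds:
  "sturm_bound 2 1" "sturm_bound 3 1" "sturm_bound 4 1"
  "sturm_bound 5 2" "sturm_bound 6 2" "sturm_bound 7 2" "sturm_bound 8 2" "sturm_bound 9 2" "sturm_bound 10 4"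
  by code_simp+

section \<open>Uniqueness of the normalised cusp forms\<close>

lemma cusp_forms_lincomb:
  assumes N: "N > 0" and f: "f \<in> cusp_forms k N" and g: "g \<in> cusp_forms k N"
  shows "(\<lambda>z. x * f z + y * g z) \<in> cusp_forms k N"
proof -
  have sl: "sl k (\<lambda>z. x * f z + y * g z) a b c d = (\<lambda>z. x * sl k f a b c d z + y * sl k g a b c d z)" for a b c d
    by (simp add: sl_def fun_eq_iff add_divide_distrib)
  have "\<exists>F. has_qexp N F (sl k (\<lambda>z. x * f z + y * g z) a b c d) \<and> fps_nth F 0 = 0" if det: "a * d - b * c = 1" for a b c d
  proof -
    obtain F where F: "has_qexp N F (sl k f a b c d)" "fps_nth F 0 = 0"
      using f det unfolding cusp_forms_iff[OF N] by blast
    obtain G where G: "has_qexp N G (sl k g a b c d)" "fps_nth G 0 = 0"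
      using g det unfolding cusp_forms_iff[OF N] by blast
    have "has_qexp N (fps_const x * F + fps_const y * G) (sl k (\<lambda>z. x * f z + y * g z) a b c d)"
      unfolding sl by (intro has_qexp_add has_qexp_cmult F G N)
    then show ?thesis using F G by (intro exI[of _ "fps_const x * F + fps_const y * G"]) simp
  qed
  then show ?thesis
    using f g unfolding cusp_forms_iff[OF N] sl by (auto intro!: holomorphic_intros)
qed

lemma fourier_coeff_eq:
  assumes "has_qexp 1 F f"
  shows "fourier_coeff f = fps_nth F"
proof -
  have e: "exp (2 * of_real pi * \<i> * z) ^ n = exp (2 * of_real pi * \<i> * of_nat n * z / of_nat 1)" for z n
    unfolding exp_of_nat_mult[symmetric] by (simp add: mult_ac)
  show ?thesis
    unfolding fourier_coeff_def e
  proof (rule the_equality)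
    show "\<forall>z\<in>\<H>. (\<lambda>n. fps_nth F n * exp (2 * of_real pi * \<i> * of_nat n * z / of_nat 1)) sums f z"
      using has_qexp_sums[OF _ assms] by auto
    fix a assume "\<forall>z\<in>\<H>. (\<lambda>n. a n * exp (2 * of_real pi * \<i> * of_nat n * z / of_nat 1)) sums f z"
    then have "has_qexp 1 (Abs_fps a) f" by (intro has_qexpI_sums) auto
    then have "Abs_fps a = F" by (rule has_qexp_unique[OF zero_less_one _ assms]) simp
    then show "a = fps_nth F" by auto
  qed
qed

lemma Delta4_eq:
  assumes b: "sturm_bound (int N) 2" and g: "g \<in> cusp_forms 4 N" "has_qexp 1 G g" "fps_nth G 1 = 1"
  shows "\<Delta>4 N = g"
  unfolding \<Delta>4_def
proof (rule the_equality)
  have N: "N > 0" using b by (simp add: sturm_bound_def)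
  have G0: "fps_nth G 0 = 0"
  proof -
    obtain G' where G': "has_qexp 1 G' g" "fps_nth G' 0 = 0" using cusp_form_has_qexp[OF N g(1)] .
    have "G = G'" by (rule has_qexp_unique[OF zero_less_one g(2) G'(1)]) simp
    then show ?thesis using G' by simp
  qed
  show "g \<in> cusp_forms 4 N \<and> fourier_coeff g 0 = 0 \<and> fourier_coeff g 1 = 1"
    using g G0 by (simp add: fourier_coeff_eq[OF g(2)])
  fix f assume f: "f \<in> cusp_forms 4 N \<and> fourier_coeff f 0 = 0 \<and> fourier_coeff f 1 = 1"
  obtain F where F: "has_qexp 1 F f" using cusp_form_has_qexp[OF N] f by blast
  have cusp: "(\<lambda>z. 1 * f z + (- 1) * g z) \<in> cusp_forms 4 N"
    using f g by (intro cusp_forms_lincomb N) auto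
  have "has_qexp 1 (fps_const 1 * F + fps_const (- 1) * G) (\<lambda>z. 1 * f z + (- 1) * g z)"
    by (intro has_qexp_add has_qexp_cmult F g) auto
  from sturm[of N 2, OF _ cusp this] b have "(\<lambda>z. 1 * f z + (- 1) * g z) = (\<lambda>_. 0)"
    using f g G0 fourier_coeff_eq[OF F] by (force simp: less_2_cases_iff)
  then show "f = g" by (auto simp: fun_eq_iff)
qed

section \<open>Convolution sums of level up to 9\<close>

lemma sigma_of_nat: "\<sigma> j (real n) = fps_nth (sigma_fps j) n"
  by (simp add: divisor_sigma_def extend_zero_def sigma_fps_def)

lemma extend_zero_divide:
  assumes "\<delta> > 0" "n > 0"
  shows "extend_zero a (real n / real \<delta>) = (if \<delta> dvd n then a (n div \<delta>) else 0)"
proof (cases "\<delta> dvd n")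
  case True
  then obtain k where k: "n = \<delta> * k" by blast
  then have "real n / real \<delta> = real k" using assms by simp
  then show ?thesis using assms k by (simp add: extend_zero_def)
next
  case False
  have "real n / real \<delta> \<notin> \<nat>"
  proof
    assume "real n / real \<delta> \<in> \<nat>"
    then obtain k where "real n / real \<delta> = real k" by (auto elim: Nats_cases)
    then have "real n = real (\<delta> * k)" using assms by (simp add: field_simps)
    then have "n = \<delta> * k" by (simp only: of_nat_eq_iff)
    then show False using False by simp
  qed
  then show ?thesis using False by (simp add: extend_zero_def)
qed

lemma sigma_divide:
  assumes "\<delta> > 0" "n > 0"
  shows "\<sigma> j (real n / real \<delta>) = fps_nth (fps_dil \<delta> (sigma_fps j)) n"
  unfolding divisor_sigma_def extend_zero_divide[OF assms]
  using assms by (auto simp: fps_dil_def sigma_fps_def elim!: dvdE)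

lemma conv_sum_eq:
  assumes N: "N > 0"
  shows "W N n = fps_nth (fps_dil N (sigma_fps 1) * sigma_fps 1) n"
proof -
  have less: "real m < real n / real N \<longleftrightarrow> m * N < n" for m
    using N by (simp add: field_simps flip: of_nat_mult)
  let ?M = "{m. 0 < m \<and> m * N < n}"
  have "fps_nth (fps_dil N (sigma_fps 1) * sigma_fps 1) n =
      (\<Sum>i=0..n. fps_nth (fps_dil N (sigma_fps 1)) i * fps_nth (sigma_fps 1) (n - i))"
    by (rule fps_mult_nth)
  also have "\<dots> = (\<Sum>i\<in>(\<lambda>m. m * N) ` ?M. fps_nth (fps_dil N (sigma_fps 1)) i * fps_nth (sigma_fps 1) (n - i))"
  proof (rule sum.mono_neutral_right)
    show "\<forall>i\<in>{0..n} - (\<lambda>m. m * N) ` ?M. fps_nth (fps_dil N (sigma_fps 1)) i * fps_nth (sigma_fps 1) (n - i) = 0"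
    proof
      fix i assume i: "i \<in> {0..n} - (\<lambda>m. m * N) ` ?M"
      show "fps_nth (fps_dil N (sigma_fps 1)) i * fps_nth (sigma_fps 1) (n - i) = 0"
      proof (cases "N dvd i \<and> i > 0 \<and> i < n")
        case True
        then obtain k where "i = k * N" by (auto elim!: dvdE simp: mult.commute)
        then have "i \<in> (\<lambda>m. m * N) ` ?M" using True by auto
        then show ?thesis using i by blast
      next
        case False
        then show ?thesis using i by (auto simp: fps_dil_def sigma_fps_def)
      qed
    qed
  qed auto
  also have "\<dots> = (\<Sum>m\<in>?M. fps_nth (fps_dil N (sigma_fps 1)) (m * N) * fps_nth (sigma_fps 1) (n - m * N))"
    using N by (subst sum.reindex) (auto simp: inj_on_def)
  also have "\<dots> = (\<Sum>m\<in>?M. \<sigma> 1 (real m) * \<sigma> 1 (real n - real N * real m))"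
  proof (intro sum.cong refl)
    fix m assume m: "m \<in> ?M"
    then have "real n - real N * real m = real (n - m * N)" by (simp add: of_nat_diff mult.commute)
    then show "fps_nth (fps_dil N (sigma_fps 1)) (m * N) * fps_nth (sigma_fps 1) (n - m * N) =
        \<sigma> 1 (real m) * \<sigma> 1 (real n - real N * real m)"
      using N by (simp only: sigma_of_nat) (simp add: fps_dil_def)
  qed
  finally show ?thesis unfolding conv_sum_def less by simp
qed

text \<open>Dilation respects products. This is seen on the functions, by uniqueness of expansions,
  and not on the Cauchy product.\<close>

lemma fps_dil_E2_power2:
  assumes "N > 0"
  shows "(fps_dil N E2_fps)\<^sup>2 = fps_dil N (E2_fps\<^sup>2)"
  by (rule has_qexp_unique[OF zero_less_one has_qexp_power[OF zero_less_one has_qexp_dil[OF assms has_qexp_E2]]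
        has_qexp_dil[OF assms has_qexp_power[OF zero_less_one has_qexp_E2]]]) simp

lemma E2_fps_nth: "n > 0 \<Longrightarrow> fps_nth E2_fps n = - 24 * fps_nth (sigma_fps 1) n"
  by (simp add: E2_fps_def)

lemma E2_fps_power2_nth:
  assumes "n > 0"
  shows "fps_nth (E2_fps\<^sup>2) n = 240 * fps_nth (sigma_fps 3) n - 288 * of_nat n * fps_nth (sigma_fps 1) n"
proof -
  have "E2_fps\<^sup>2 = E4_fps + fps_const 12 * (fps_X * fps_deriv E2_fps)"
    using Ramanujan_fps by (simp add: algebra_simps)
  then have "fps_nth (E2_fps\<^sup>2) n = fps_nth E4_fps n + 12 * fps_nth (fps_X * fps_deriv E2_fps) n"
    by simp
  moreover have "fps_nth (fps_X * fps_deriv E2_fps) n = of_nat n * fps_nth E2_fps n"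
    using assms by (cases n) auto
  ultimately show ?thesis
    using assms by (simp add: E2_fps_nth E4_fps_def)
qed

text \<open>In E_2(z)^2 - 2 N E_2(z) E_2(N z) + N^2 E_2(N z)^2 the outer squares are known from
  Ramanujan's identity, the last one at n/N. The convolution sum enters only through the mixed
  product, with factor -2 N 576 = -1152 N.\<close>

lemma eis_comb_fps_nth:
  assumes N: "N > 0" and n: "n > 0"
  shows "fps_nth (eis_comb_fps N e) n =
     240 * \<sigma> 3 (real n) - 288 * of_nat n * \<sigma> 1 (real n)
     + 240 * of_nat N ^ 2 * \<sigma> 3 (real n / real N) - 288 * of_nat N * of_nat n * \<sigma> 1 (real n / real N)
     + 48 * of_nat N * (\<sigma> 1 (real n) + \<sigma> 1 (real n / real N)) - 1152 * of_nat N * W N n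
     - 240 * (\<Sum>\<delta> | \<delta> dvd N. e \<delta> * \<sigma> 3 (real n / real \<delta>))"
proof -
  let ?S = "sigma_fps 1"
  have V: "fps_dil N E2_fps = 1 - fps_const 24 * fps_dil N ?S"
    using N by (auto simp: fps_eq_iff fps_dil_def E2_fps_def elim!: dvdE)
  have "(a - c * b)\<^sup>2 = a\<^sup>2 - c * (a * b + a * b) + c * c * b\<^sup>2" for a b c :: "complex fps"
    by (simp add: power2_eq_square algebra_simps)
  then have sq: "(E2_fps - fps_const (of_nat N) * fps_dil N E2_fps)\<^sup>2 =
     E2_fps\<^sup>2 - fps_const (of_nat N) * (E2_fps * fps_dil N E2_fps + E2_fps * fps_dil N E2_fps)
     + fps_const (of_nat N) * fps_const (of_nat N) * fps_dil N (E2_fps\<^sup>2)"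
    unfolding fps_dil_E2_power2[OF N, symmetric] .
  have "(1 - c * a) * (1 - c * b) = 1 - c * a - c * b + c * c * (b * a)" for a b c :: "complex fps"
    by (simp add: algebra_simps)
  then have "E2_fps * fps_dil N E2_fps = 1 - fps_const 24 * ?S - fps_const 24 * fps_dil N ?S
      + fps_const 24 * fps_const 24 * (fps_dil N ?S * ?S)"
    unfolding V unfolding E2_fps_def .
  then have prod: "fps_nth (E2_fps * fps_dil N E2_fps) n = - 24 * \<sigma> 1 (real n) - 24 * \<sigma> 1 (real n / real N) + 576 * W N n"
    using n by (simp add: conv_sum_eq[OF N] sigma_of_nat sigma_divide[OF N n])
  have dil2: "fps_nth (fps_dil N (E2_fps\<^sup>2)) n = 240 * \<sigma> 3 (real n / real N) - 288 * of_nat n / of_nat N * \<sigma> 1 (real n / real N)"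
  proof (cases "N dvd n")
    case True
    then obtain k where k: "n = N * k" by blast
    then have "k > 0" using n by simp
    then show ?thesis
      using N k unfolding sigma_divide[OF N n] by (simp add: fps_dil_def E2_fps_power2_nth)
  next
    case False
    then show ?thesis unfolding sigma_divide[OF N n] by (simp add: fps_dil_def)
  qed
  have E4: "fps_nth (fps_dil \<delta> E4_fps) n = 240 * \<sigma> 3 (real n / real \<delta>)" if "\<delta> dvd N" for \<delta>
  proof -
    have "\<delta> > 0" using that N by (auto dest: dvd_pos_nat)
    then show ?thesis
      unfolding sigma_divide[OF \<open>\<delta> > 0\<close> n] using n by (auto simp: fps_dil_def E4_fps_def elim!: dvdE)
  qed
  have sums: "fps_nth (\<Sum>\<delta> | \<delta> dvd N. fps_const (e \<delta>) * fps_dil \<delta> E4_fps) n =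
      240 * (\<Sum>\<delta> | \<delta> dvd N. e \<delta> * \<sigma> 3 (real n / real \<delta>))"
    unfolding fps_sum_nth sum_distrib_left by (intro sum.cong refl) (simp add: E4)
  have sqn: "fps_nth ((E2_fps - fps_const (of_nat N) * fps_dil N E2_fps)\<^sup>2) n = fps_nth (E2_fps\<^sup>2) n
      - of_nat N * (fps_nth (E2_fps * fps_dil N E2_fps) n + fps_nth (E2_fps * fps_dil N E2_fps) n)
      + of_nat N * (of_nat N * fps_nth (fps_dil N (E2_fps\<^sup>2)) n)"
    by (simp only: sq fps_sub_nth fps_add_nth fps_mult_left_const_nth mult.assoc)
  show ?thesis
    unfolding eis_comb_fps_def fps_sub_nth[of "_\<^sup>2"] sqn sums prod dil2 E2_fps_power2_nth[OF n] sigma_of_nat using N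
    by (simp add: field_simps power2_eq_square)
qed

lemma conv_sum_eis_comb:
  assumes "N > 0" "n > 0"
  shows "W N n =
     (240 * \<sigma> 3 (real n) - 288 * of_nat n * \<sigma> 1 (real n)
     + 240 * of_nat N ^ 2 * \<sigma> 3 (real n / real N) - 288 * of_nat N * of_nat n * \<sigma> 1 (real n / real N)
     + 48 * of_nat N * (\<sigma> 1 (real n) + \<sigma> 1 (real n / real N))
     - 240 * (\<Sum>\<delta> | \<delta> dvd N. e \<delta> * \<sigma> 3 (real n / real \<delta>)) - fps_nth (eis_comb_fps N e) n) / (1152 * of_nat N)"
  using eis_comb_fps_nth[OF assms, of e] assms by (simp add: field_simps)

lemma conv_sum_1: "N > 0 \<Longrightarrow> W N 1 = 0"
  by (simp add: conv_sum_eq fps_mult_nth sigma_fps_def fps_dil_def)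

definition eis_cond :: "nat \<Rightarrow> (nat \<Rightarrow> complex) \<Rightarrow> bool" where
  "eis_cond N e \<longleftrightarrow> (\<forall>g\<in>{g. g dvd N}. (1 - of_nat g ^ 2 / of_nat N)\<^sup>2 = (\<Sum>\<delta> | \<delta> dvd N. e \<delta> * (of_nat (gcd g \<delta>) / of_nat \<delta>) ^ 4))"

lemma eis_comb_cusp_form': "N > 0 \<Longrightarrow> eis_cond N e \<Longrightarrow> eis_comb N e \<in> cusp_forms 4 N"
  by (rule eis_comb_cusp_form) (auto simp: eis_cond_def)

lemma eis_comb_fps_0:
  assumes N: "N > 0" and e: "eis_cond N e"
  shows "fps_nth (eis_comb_fps N e) 0 = 0"
proof -
  obtain F where F: "has_qexp 1 F (eis_comb N e)" "fps_nth F 0 = 0"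
    using cusp_form_has_qexp[OF N eis_comb_cusp_form'[OF N e]] .
  have "eis_comb_fps N e = F"
    by (rule has_qexp_unique[OF zero_less_one has_qexp_eis_comb[OF N] F(1)]) simp
  then show ?thesis using F by simp
qed

lemma eis_comb_fps_eq_0:
  assumes "sturm_bound (int N) 1" "eis_cond N e"
  shows "eis_comb_fps N e = 0"
proof -
  have N: "N > 0" using assms by (simp add: sturm_bound_def)
  have 0: "eis_comb N e = (\<lambda>_. 0)"
    using sturm[of N 1, OF _ eis_comb_cusp_form'[OF N assms(2)] has_qexp_eis_comb[OF N]] assms eis_comb_fps_0[OF N] by simp
  show ?thesis
    by (rule has_qexp_unique[OF zero_less_one has_qexp_eis_comb[OF N]]) (use has_qexp_const[of 1 0] 0 in auto)
qed

text \<open>The cusp space has dimension at most 1, so the combination is its first coefficient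
  \<kappa> times the normalised form. That \<kappa> is nonzero also shows that the normalised form
  exists.\<close>

lemma eis_comb_fps_tau:
  assumes b: "sturm_bound (int N) 2" and e: "eis_cond N e" and \<kappa>: "fps_nth (eis_comb_fps N e) 1 = \<kappa>" "\<kappa> \<noteq> 0"
  shows "\<Delta>4 N = (\<lambda>z. 1 / \<kappa> * eis_comb N e z)"
    and "\<Delta>4 N \<in> cusp_forms 4 N"
    and "has_qexp 1 (fps_const (1 / \<kappa>) * eis_comb_fps N e) (\<Delta>4 N)"
    and "n > 0 \<Longrightarrow> fps_nth (eis_comb_fps N e) n = \<kappa> * \<tau>4 N (real n)"
proof -
  have N: "N > 0" using b by (simp add: sturm_bound_def)
  let ?g = "\<lambda>z. 1 / \<kappa> * eis_comb N e z"
  have q: "has_qexp 1 (fps_const (1 / \<kappa>) * eis_comb_fps N e) ?g"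
    by (rule has_qexp_cmult[OF zero_less_one has_qexp_eis_comb[OF N]])
  have c: "?g \<in> cusp_forms 4 N"
    using cusp_forms_lincomb[OF N eis_comb_cusp_form'[OF N e] eis_comb_cusp_form'[OF N e], of "1 / \<kappa>" 0] by simp
  show D: "\<Delta>4 N = ?g"
    by (rule Delta4_eq[OF b c q]) (use \<kappa> in simp)
  show "\<Delta>4 N \<in> cusp_forms 4 N" "has_qexp 1 (fps_const (1 / \<kappa>) * eis_comb_fps N e) (\<Delta>4 N)"
    unfolding D by (rule c, rule q)
  show "fps_nth (eis_comb_fps N e) n = \<kappa> * \<tau>4 N (real n)" if "n > 0"
  proof -
    have "fourier_coeff (\<Delta>4 N) = fps_nth (fps_const (1 / \<kappa>) * eis_comb_fps N e)"
      unfolding D by (rule fourier_coeff_eq[OF q])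
    then show ?thesis using \<kappa> that by (simp add: \<tau>4_def extend_zero_def)
  qed
qed

section \<open>Coefficients of the Eisenstein parts and the formulas for each level\<close>

lemma divisors_code: "n > 0 \<Longrightarrow> {d. d dvd n} = set (filter (\<lambda>d. d dvd n) [1..<Suc n])"
  by (auto dest: dvd_imp_le dvd_pos_nat intro!: Suc_leI)

lemma divisors_eval:
  "{d. d dvd (2::nat)} = {1, 2}" "{d. d dvd (3::nat)} = {1, 3}" "{d. d dvd (4::nat)} = {1, 2, 4}"
  "{d. d dvd (5::nat)} = {1, 5}" "{d. d dvd (6::nat)} = {1, 2, 3, 6}" "{d. d dvd (7::nat)} = {1, 7}"
  "{d. d dvd (8::nat)} = {1, 2, 4, 8}" "{d. d dvd (9::nat)} = {1, 3, 9}" "{d. d dvd (10::nat)} = {1, 2, 5, 10}"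
  by (subst divisors_code, simp, code_simp)+

lemma gcd_nat_eval:
  "gcd 1 (x::nat) = 1" "gcd x (1::nat) = 1" "gcd (x::nat) x = x"
  "gcd 2 (3::nat) = 1" "gcd 3 (2::nat) = 1" "gcd 2 (4::nat) = 2" "gcd 4 (2::nat) = 2" "gcd 2 (5::nat) = 1" "gcd 5 (2::nat) = 1"
  "gcd 2 (6::nat) = 2" "gcd 6 (2::nat) = 2" "gcd 3 (6::nat) = 3" "gcd 6 (3::nat) = 3" "gcd 2 (8::nat) = 2" "gcd 8 (2::nat) = 2"
  "gcd 4 (8::nat) = 4" "gcd 8 (4::nat) = 4" "gcd 3 (9::nat) = 3" "gcd 9 (3::nat) = 3" "gcd 2 (10::nat) = 2" "gcd 10 (2::nat) = 2"
  "gcd 5 (10::nat) = 5" "gcd 10 (5::nat) = 5"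
  by (simp_all add: gcd_non_0_nat)

lemma sigma_1: "\<sigma> j 1 = 1"
  using sigma_of_nat[of j 1] by (simp add: sigma_fps_def)

lemma sigma_inverse: "\<sigma> j (1 / numeral (Num.Bit0 k)) = 0" "\<sigma> j (1 / numeral (Num.Bit1 k)) = 0"
  using sigma_divide[of "numeral (Num.Bit0 k)" 1 j] sigma_divide[of "numeral (Num.Bit1 k)" 1 j]
  by (simp_all add: fps_dil_def)

text \<open>The coefficients are the unique solutions of \<open>eis_cond\<close>, which says that the constant terms of
  \<open>(E\<^sub>2(z) - N E\<^sub>2(N z))\<^sup>2\<close> and of \<open>\<Sum>\<^sub>\<delta> e\<^sub>\<delta> E\<^sub>4(\<delta> z)\<close> agree at every cusp.\<close>
definition e2 :: "nat \<Rightarrow> complex" where "e2 = (\<lambda>\<delta>. if \<delta> = 1 then 1/5 else if \<delta> = 2 then 4/5 else 0)"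
definition e3 :: "nat \<Rightarrow> complex" where "e3 = (\<lambda>\<delta>. if \<delta> = 1 then 2/5 else if \<delta> = 3 then 18/5 else 0)"
definition e4 :: "nat \<Rightarrow> complex" where "e4 = (\<lambda>\<delta>. if \<delta> = 1 then 3/5 else if \<delta> = 2 then -6/5 else if \<delta> = 4 then 48/5 else 0)"
definition e5 :: "nat \<Rightarrow> complex" where "e5 = (\<lambda>\<delta>. if \<delta> = 1 then 8/13 else if \<delta> = 5 then 200/13 else 0)"
definition e6 :: "nat \<Rightarrow> complex" where "e6 = (\<lambda>\<delta>. if \<delta> = 1 then 19/25 else if \<delta> = 2 then -24/25 else if \<delta> = 3 then -54/25 else if \<delta> = 6 then 684/25 else 0)"
definition e7 :: "nat \<Rightarrow> complex" where "e7 = (\<lambda>\<delta>. if \<delta> = 1 then 18/25 else if \<delta> = 7 then 882/25 else 0)"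
definition e8 :: "nat \<Rightarrow> complex" where "e8 = (\<lambda>\<delta>. if \<delta> = 1 then 4/5 else if \<delta> = 2 then -3/5 else if \<delta> = 4 then -12/5 else if \<delta> = 8 then 256/5 else 0)"
definition e9 :: "nat \<Rightarrow> complex" where "e9 = (\<lambda>\<delta>. if \<delta> = 1 then 4/5 else if \<delta> = 3 then -8/5 else if \<delta> = 9 then 324/5 else 0)"
definition e10 :: "nat \<Rightarrow> complex" where "e10 = (\<lambda>\<delta>. if \<delta> = 1 then 11/13 else if \<delta> = 2 then -8/13 else if \<delta> = 5 then -50/13 else if \<delta> = 10 then 1100/13 else 0)"

lemma eis_conds:
  "eis_cond 2 e2" "eis_cond 3 e3" "eis_cond 4 e4" "eis_cond 5 e5" "eis_cond 6 e6" "eis_cond 7 e7" "eis_cond 8 e8" "eis_cond 9 e9" "eis_cond 10 e10"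
  by (simp_all add: eis_cond_def divisors_eval e2_def e3_def e4_def e5_def e6_def e7_def e8_def e9_def e10_def power2_eq_square power4_eq_xxxx gcd_nat_eval)

text \<open>At n = 1 the convolution sum is empty, so the general coefficient formula evaluates. For
  levels 5 to 9 these numbers divided by 1152 N are the weights of the cusp form in the identities,
  for example (576/13) / 5760 = 1/130.\<close>

lemma eis_comb_fps_1:
  "fps_nth (eis_comb_fps 5 e5) 1 = 576/13"
  "fps_nth (eis_comb_fps 6 e6) 1 = 288/5"
  "fps_nth (eis_comb_fps 7 e7) 1 = 576/5"
  "fps_nth (eis_comb_fps 8 e8) 1 = 144"
  "fps_nth (eis_comb_fps 9 e9) 1 = 192"
  "fps_nth (eis_comb_fps 10 e10) 1 = 2976/13"
  by (simp_all add: eis_comb_fps_nth conv_sum_1[unfolded One_nat_def] sigma_inverse sigma_1 divisors_eval e5_def e6_def e7_def e8_def e9_def e10_def)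

lemma conv_sum_1_formula:
  assumes n: "n > 0"
  shows "W 1 n = 5/12 * \<sigma> 3 (real n) - of_nat n / 2 * \<sigma> 1 (real n) + 1/12 * \<sigma> 1 (real n)"
proof -
  have d: "fps_dil 1 F = F" for F by (simp add: fps_dil_def fps_eq_iff)
  have "(1 - c * a)\<^sup>2 = 1 - (c * a + c * a) + c * c * (a * a)" for a c :: "complex fps"
    by (simp add: power2_eq_square algebra_simps)
  then have "E2_fps\<^sup>2 = 1 - (fps_const 24 * sigma_fps 1 + fps_const 24 * sigma_fps 1) + fps_const 24 * fps_const 24 * (sigma_fps 1 * sigma_fps 1)"
    unfolding E2_fps_def .
  then have "fps_nth (E2_fps\<^sup>2) n = - 48 * \<sigma> 1 (real n) + 576 * W 1 n"
    using n by (simp add: conv_sum_eq d[unfolded One_nat_def] sigma_of_nat)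
  then have w: "W 1 n = (240 * \<sigma> 3 (real n) - 288 * of_nat n * \<sigma> 1 (real n) + 48 * \<sigma> 1 (real n)) / 576"
    using E2_fps_power2_nth[OF n] by (simp add: sigma_of_nat eq_divide_eq)
  show ?thesis unfolding w by (simp add: field_simps)
qed

lemma conv_sum_2_formula:
  "n > 0 \<Longrightarrow> W 2 n =
        1/12 * \<sigma> 3 (real n) + 1/3 * \<sigma> 3 (real n / 2)
        - 1/8 * of_nat n * \<sigma> 1 (real n) - 1/4 * of_nat n * \<sigma> 1 (real n / 2)
        + 1/24 * \<sigma> 1 (real n) + 1/24 * \<sigma> 1 (real n / 2)"
  by (subst conv_sum_eis_comb[where e = e2], simp, simp)
     (simp add: eis_comb_fps_eq_0[OF _ eis_conds(1)] sturm_bounds, simp add: e2_def divisors_eval field_simps)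

lemma conv_sum_3_formula:
  "n > 0 \<Longrightarrow> W 3 n =
        1/24 * \<sigma> 3 (real n) + 3/8 * \<sigma> 3 (real n / 3)
        - 1/12 * of_nat n * \<sigma> 1 (real n) - 1/4 * of_nat n * \<sigma> 1 (real n / 3)
        + 1/24 * \<sigma> 1 (real n) + 1/24 * \<sigma> 1 (real n / 3)"
  by (subst conv_sum_eis_comb[where e = e3], simp, simp)
     (simp add: eis_comb_fps_eq_0[OF _ eis_conds(2)] sturm_bounds, simp add: e3_def divisors_eval field_simps)

lemma conv_sum_4_formula:
  "n > 0 \<Longrightarrow> W 4 n =
        1/48 * \<sigma> 3 (real n) + 1/16 * \<sigma> 3 (real n / 2) + 1/3 * \<sigma> 3 (real n / 4)
        - 1/16 * of_nat n * \<sigma> 1 (real n) - 1/4 * of_nat n * \<sigma> 1 (real n / 4)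
        + 1/24 * \<sigma> 1 (real n) + 1/24 * \<sigma> 1 (real n / 4)"
  by (subst conv_sum_eis_comb[where e = e4], simp, simp)
     (simp add: eis_comb_fps_eq_0[OF _ eis_conds(3)] sturm_bounds, simp add: e4_def divisors_eval field_simps)

lemma conv_sum_5_formula:
  "n > 0 \<Longrightarrow> W 5 n =
        5/312 * \<sigma> 3 (real n) + 125/312 * \<sigma> 3 (real n / 5)
        - 1/20 * of_nat n * \<sigma> 1 (real n) - 1/4 * of_nat n * \<sigma> 1 (real n / 5)
        + 1/24 * \<sigma> 1 (real n) + 1/24 * \<sigma> 1 (real n / 5)
        - 1/130 * \<tau>4 5 (real n)"
  by (subst conv_sum_eis_comb[where e = e5], simp, simp)
     (simp add: eis_comb_fps_tau(4)[OF _ eis_conds(4) eis_comb_fps_1(1)] sturm_bounds, simp add: e5_def divisors_eval field_simps)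

lemma conv_sum_6_formula:
  "n > 0 \<Longrightarrow> W 6 n =
        1/120 * \<sigma> 3 (real n) + 1/30 * \<sigma> 3 (real n / 2) + 3/40 * \<sigma> 3 (real n / 3) + 3/10 * \<sigma> 3 (real n / 6)
        - 1/24 * of_nat n * \<sigma> 1 (real n) - 1/4 * of_nat n * \<sigma> 1 (real n / 6)
        + 1/24 * \<sigma> 1 (real n) + 1/24 * \<sigma> 1 (real n / 6)
        - 1/120 * \<tau>4 6 (real n)"
  by (subst conv_sum_eis_comb[where e = e6], simp, simp)
     (simp add: eis_comb_fps_tau(4)[OF _ eis_conds(5) eis_comb_fps_1(2)] sturm_bounds, simp add: e6_def divisors_eval field_simps)

lemma conv_sum_7_formula:
  "n > 0 \<Longrightarrow> W 7 n =
        1/120 * \<sigma> 3 (real n) + 49/120 * \<sigma> 3 (real n / 7)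
        - 1/28 * of_nat n * \<sigma> 1 (real n) - 1/4 * of_nat n * \<sigma> 1 (real n / 7)
        + 1/24 * \<sigma> 1 (real n) + 1/24 * \<sigma> 1 (real n / 7)
        - 1/70 * \<tau>4 7 (real n)"
  by (subst conv_sum_eis_comb[where e = e7], simp, simp)
     (simp add: eis_comb_fps_tau(4)[OF _ eis_conds(6) eis_comb_fps_1(3)] sturm_bounds, simp add: e7_def divisors_eval field_simps)

lemma conv_sum_8_formula:
  "n > 0 \<Longrightarrow> W 8 n =
        1/192 * \<sigma> 3 (real n) + 1/64 * \<sigma> 3 (real n / 2) + 1/16 * \<sigma> 3 (real n / 4) + 1/3 * \<sigma> 3 (real n / 8)
        - 1/32 * of_nat n * \<sigma> 1 (real n) - 1/4 * of_nat n * \<sigma> 1 (real n / 8)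
        + 1/24 * \<sigma> 1 (real n) + 1/24 * \<sigma> 1 (real n / 8)
        - 1/64 * \<tau>4 8 (real n)"
  by (subst conv_sum_eis_comb[where e = e8], simp, simp)
     (simp add: eis_comb_fps_tau(4)[OF _ eis_conds(7) eis_comb_fps_1(4)] sturm_bounds, simp add: e8_def divisors_eval field_simps)

lemma conv_sum_9_formula:
  "n > 0 \<Longrightarrow> W 9 n =
        1/216 * \<sigma> 3 (real n) + 1/27 * \<sigma> 3 (real n / 3) + 3/8 * \<sigma> 3 (real n / 9)
        - 1/36 * of_nat n * \<sigma> 1 (real n) - 1/4 * of_nat n * \<sigma> 1 (real n / 9)
        + 1/24 * \<sigma> 1 (real n) + 1/24 * \<sigma> 1 (real n / 9)
        - 1/54 * \<tau>4 9 (real n)"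
  by (subst conv_sum_eis_comb[where e = e9], simp, simp)
     (simp add: eis_comb_fps_tau(4)[OF _ eis_conds(8) eis_comb_fps_1(5)] sturm_bounds, simp add: e9_def divisors_eval field_simps)

section \<open>Positivity of the Petersson product\<close>

abbreviation ent :: "'a^'n^'m \<Rightarrow> 'm \<Rightarrow> 'n \<Rightarrow> 'a" where
  "ent A i j \<equiv> vec_nth (vec_nth A i) j"

lemma mat22_cong:
  fixes A B :: "int^2^2"
  assumes "ent A 1 1 = ent B 1 1" "ent A 1 2 = ent B 1 2" "ent A 2 1 = ent B 2 1" "ent A 2 2 = ent B 2 2"
  shows "A = B"
proof -
  have "ent A i j = ent B i j" for i j
    using assms exhaust_2[of i] exhaust_2[of j] by fastforce
  then show ?thesis by (metis vec_eq_iff)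
qed

lemma mat22_mult_nth: "ent (A ** B) i j = ent A i 1 * ent B 1 j + ent A i 2 * ent (B :: int^2^2) 2 j"
  by (simp add: matrix_matrix_mult_def sum_2)

lemma Gamma0_coset_eq:
  assumes A: "A \<in> SL2Z"
  shows "(\<lambda>G. G ** A) ` Gamma0 N = {X \<in> SL2Z. int N dvd ent X 2 1 * ent A 2 2 - ent X 2 2 * ent A 2 1}"
proof -
  have detA: "ent A 1 1 * ent A 2 2 - ent A 1 2 * ent A 2 1 = 1" using A by (simp add: SL2Z_iff)
  show ?thesis
  proof (intro equalityI subsetI)
    fix X assume "X \<in> (\<lambda>G. G ** A) ` Gamma0 N"
    then obtain G :: "int^2^2" where G: "G \<in> SL2Z" "int N dvd ent G 2 1" "X = G ** A" by (auto simp: Gamma0_def)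
    have "det X = 1" using G A by (simp add: det_mul SL2Z_def)
    moreover have "ent X 2 1 * ent A 2 2 - ent X 2 2 * ent A 2 1 = ent G 2 1 * (ent A 1 1 * ent A 2 2 - ent A 1 2 * ent A 2 1)"
      unfolding G(3) mat22_mult_nth by (simp add: algebra_simps)
    ultimately show "X \<in> {X \<in> SL2Z. int N dvd ent X 2 1 * ent A 2 2 - ent X 2 2 * ent A 2 1}"
      using G(2) detA by (simp add: SL2Z_def)
  next
    fix X assume X: "X \<in> {X \<in> SL2Z. int N dvd ent X 2 1 * ent A 2 2 - ent X 2 2 * ent A 2 1}"
    define A' where "A' = mat22 (ent A 2 2) (- (ent A 1 2)) (- (ent A 2 1)) (ent A 1 1)"
    have A': "det A' = 1" using detA by (simp add: A'_def det_2 algebra_simps)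
    have "A' ** A = mat 1"
      by (rule mat22_cong; unfold mat22_mult_nth) (use detA in \<open>simp_all add: A'_def mat_def algebra_simps\<close>)
    then have "(X ** A') ** A = X" by (simp add: matrix_mul_assoc[symmetric])
    moreover have "X ** A' \<in> Gamma0 N"
      using X A' by (simp add: Gamma0_def SL2Z_def det_mul) (simp add: mat22_mult_nth A'_def algebra_simps)
    ultimately show "X \<in> (\<lambda>G. G ** A) ` Gamma0 N" by (metis image_eqI)
  qed
qed

text \<open>A coset is determined by the bottom row modulo N of any representative. Finiteness gives
  the sum over cosets its meaning, as \<open>sum\<close> over an infinite set is 0.\<close>

lemma finite_Gamma0_cosets:
  assumes N: "N > 0"
  shows "finite (Gamma0_cosets N)"
proof -
  define K where "K = (\<lambda>v :: int \<times> int. {X \<in> SL2Z. int N dvd ent X 2 1 * snd v - ent X 2 2 * fst v})"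
  have "(\<lambda>G. G ** A) ` Gamma0 N \<in> K ` ({0..<int N} \<times> {0..<int N})" if A: "A \<in> SL2Z" for A
  proof -
    define c d where "c = ent A 2 1" and "d = ent A 2 2"
    have "int N dvd x * d - y * c \<longleftrightarrow> int N dvd x * (d mod int N) - y * (c mod int N)" for x y
    proof -
      have "(x * d - y * c) mod int N = (x * (d mod int N) - y * (c mod int N)) mod int N"
        by (intro mod_diff_cong) (simp_all add: mod_mult_right_eq)
      then show ?thesis by (simp only: dvd_eq_mod_eq_0)
    qed
    then have "(\<lambda>G. G ** A) ` Gamma0 N = K (c mod int N, d mod int N)"
      unfolding Gamma0_coset_eq[OF A] K_def c_def d_def by simp
    then show ?thesis using N by auto
  qed
  then have "Gamma0_cosets N \<subseteq> K ` ({0..<int N} \<times> {0..<int N})"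
    by (auto simp: Gamma0_cosets_def)
  then show ?thesis by (rule finite_subset) simp
qed

lemma some_in_Gamma0_coset:
  assumes "C \<in> Gamma0_cosets N"
  shows "(SOME A. A \<in> C) \<in> SL2Z"
proof -
  obtain A where A: "A \<in> SL2Z" "C = (\<lambda>G. G ** A) ` Gamma0 N" using assms by (auto simp: Gamma0_cosets_def)
  have "A \<in> C" unfolding A(2) Gamma0_coset_eq[OF A(1)] using A(1) by (simp add: algebra_simps)
  then have "(SOME A. A \<in> C) \<in> C" by (rule someI)
  then show ?thesis unfolding A(2) Gamma0_coset_eq[OF A(1)] by simp
qed

text \<open>The conditions on Re z and |z| keep Im z away from 0, so the open condition Im z > 0 can
  be exchanged for a closed one. This yields closedness and a uniform bound for q.\<close>

lemma modular_fundamental_domain_eq: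
  "modular_fundamental_domain = {z. 1/2 \<le> Im z} \<inter> {z. \<bar>Re z\<bar> \<le> 1/2} \<inter> {z. 1 \<le> norm z}"
proof -
  have "1/2 \<le> Im z" if "Im z > 0" "\<bar>Re z\<bar> \<le> 1/2" "1 \<le> norm z" for z
  proof -
    have "1 \<le> (norm z)\<^sup>2" using that by simp
    then have "1 \<le> (Re z)\<^sup>2 + (Im z)\<^sup>2" by (simp add: cmod_power2)
    moreover have "(Re z)\<^sup>2 \<le> (1/2)\<^sup>2" using that(2) by (simp add: abs_le_square_iff[symmetric])
    ultimately have "(1/2)\<^sup>2 \<le> (Im z)\<^sup>2" by (simp add: power2_eq_square)
    then show ?thesis using that(1) by (intro power2_le_imp_le[of "1/2"]) auto
  qed
  then show ?thesis by (auto simp: modular_fundamental_domain_def)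
qed

lemma closed_modular_fundamental_domain: "closed modular_fundamental_domain"
  unfolding modular_fundamental_domain_eq
  by (intro closed_Int closed_Collect_le continuous_intros)

lemma emeasure_box_complex:
  "emeasure lborel (cbox (Complex (-1/2) (real n)) (Complex (1/2) (real n + 1))) = 1"
proof -
  have "emeasure lborel (cbox (Complex (-1/2) (real n)) (Complex (1/2) (real n + 1))) = ennreal (\<Prod>b\<in>Basis. (Complex (1/2) (real n + 1) - Complex (-1/2) (real n)) \<bullet> b)"
    by (rule emeasure_lborel_cbox) (auto simp: Basis_complex_def)
  also have "(\<Prod>b\<in>Basis. (Complex (1/2) (real n + 1) - Complex (-1/2) (real n)) \<bullet> b) = 1"
    by (simp add: Basis_complex_def)
  finally show ?thesis by simp
qed

text \<open>The integral of a function that is not integrable is 0 by convention, so a vanishing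
  integral carries no information until integrability is known. A cusp form decays at least like its
  parameter; cutting the strip into boxes of area 1 dominates the integral by a multiple of the
  series of (n + 1)^2 r^n.\<close>

lemma petersson_integrable:
  assumes N: "N > 0" and F: "has_qexp N F g" "fps_nth F 0 = 0"
  shows "integrable lborel (\<lambda>z. indicator modular_fundamental_domain z * ((norm (g z))\<^sup>2 * (Im z ^ 4 / Im z ^ 2)))"
proof (rule integrableI_bounded)
  let ?D = modular_fundamental_domain
  have DH: "Im z \<ge> 1/2" if "z \<in> ?D" for z using that by (simp add: modular_fundamental_domain_eq)
  have cont: "continuous_on ?D g"
    by (rule continuous_on_subset[OF holomorphic_on_imp_continuous_on[OF has_qexp_holomorphic[OF N F(1)]]])
       (use DH in fastforce)
  have "continuous_on ?D (\<lambda>z. (norm (g z))\<^sup>2 * (Im z ^ 4 / Im z ^ 2))"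
    by (intro continuous_intros cont) (use DH in fastforce)
  from borel_measurable_continuous_on_indicator[OF _ this]
  show "(\<lambda>z. indicator ?D z * ((norm (g z))\<^sup>2 * (Im z ^ 4 / Im z ^ 2))) \<in> borel_measurable lborel"
    using closed_modular_fundamental_domain by simp
  define G where "G = fps_shift 1 F"
  have radG: "fps_conv_radius G \<ge> 1" using F(1) by (simp add: G_def has_qexp_def)
  have FG: "F = G * fps_X" unfolding G_def using F(2)
    by (simp add: fps_eq_iff)
  have gG: "g z = eval_fps G (qpar N z) * qpar N z" if z: "Im z > 0" for z
    using F(1) z less_fps_conv_radiusI[OF radG norm_qpar_less_1[OF z N]]
    by (simp add: has_qexp_def FG eval_fps_mult)
  define \<rho> where "\<rho> = exp (- 2 * pi * (1/2) / real N)"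
  have \<rho>: "\<rho> < 1" using N by (simp add: \<rho>_def)
  have "continuous_on (cball 0 \<rho>) (eval_fps G)"
    using \<rho> by (intro continuous_on_eval_fps') (auto simp: intro!: less_fps_conv_radiusI[OF radG] continuous_on_id)
  then have "bounded (eval_fps G ` cball 0 \<rho>)"
    by (intro compact_imp_bounded compact_continuous_image) auto
  then obtain C where C: "\<And>w. norm w \<le> \<rho> \<Longrightarrow> norm (eval_fps G w) \<le> C"
    by (force simp: bounded_iff)
  \<comment> \<open>The square of the modulus of the parameter shrinks by this factor when Im z
    grows by 1.\<close>
  define r where "r = exp (- 4 * pi / real N)"
  have r: "0 < r" "r < 1" using N by (auto simp: r_def)
  define c where "c n = C\<^sup>2 * (real (Suc n) ^ 2 * r ^ n)" for n
  define B where "B n = cbox (Complex (-1/2) (real n)) (Complex (1/2) (real n + 1))" for n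
  have csum: "summable c"
  proof -
    have "norm (of_real r :: complex) < fps_conv_radius (Abs_fps (\<lambda>n. of_nat n ^ 2 :: complex))"
      using r by (intro less_fps_conv_radiusI[OF fps_conv_radius_powers]) simp
    from norm_summable_fps[OF this] have "summable (\<lambda>n. real n ^ 2 * r ^ n)"
      using r by (simp add: norm_mult norm_power)
    then have "summable (\<lambda>n. real (Suc n) ^ 2 * r ^ Suc n)" by (subst summable_Suc_iff)
    then have "summable (\<lambda>n. 1 / r * (real (Suc n) ^ 2 * r ^ Suc n))" by (rule summable_mult)
    then show ?thesis unfolding c_def using r by (intro summable_mult) (simp add: field_simps)
  qed
  have pt: "ennreal (norm (indicator ?D z * ((norm (g z))\<^sup>2 * (Im z ^ 4 / Im z ^ 2)))) \<le> (\<Sum>n. ennreal (c n) * indicator (B n) z)" for z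
  proof (cases "z \<in> ?D")
    case True
    then have z: "Im z \<ge> 1/2" "\<bar>Re z\<bar> \<le> 1/2" by (auto simp: modular_fundamental_domain_eq)
    define n where "n = nat \<lfloor>Im z\<rfloor>"
    have n: "real n \<le> Im z" "Im z \<le> real n + 1" using z unfolding n_def by linarith+
    have zB: "z \<in> B n" using z n by (auto simp: B_def in_cbox_complex_iff)
    have "norm (qpar N z) \<le> \<rho>" unfolding norm_qpar \<rho>_def using z N by (simp add: field_simps)
    then have "norm (g z) \<le> C * norm (qpar N z)"
      using gG[of z] z C by (simp add: norm_mult mult_right_mono)
    then have "(norm (g z))\<^sup>2 \<le> (C * norm (qpar N z))\<^sup>2" by (intro power_mono) auto
    also have "\<dots> = C\<^sup>2 * exp (- 4 * pi * Im z / real N)"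
      by (simp add: power_mult_distrib norm_qpar exp_double[symmetric])
    also have "exp (- 4 * pi * Im z / real N) \<le> r ^ n"
      unfolding r_def exp_of_nat_mult[symmetric] using n N by (simp add: field_simps)
    finally have 1: "(norm (g z))\<^sup>2 \<le> C\<^sup>2 * r ^ n" by (simp add: mult_left_mono)
    have "Im z ^ 4 / Im z ^ 2 = (Im z)\<^sup>2" using z by (simp add: field_simps power2_eq_square power4_eq_xxxx)
    also have "\<dots> \<le> real (Suc n) ^ 2" using z n by (intro power_mono) auto
    finally have "(norm (g z))\<^sup>2 * (Im z ^ 4 / Im z ^ 2) \<le> C\<^sup>2 * r ^ n * real (Suc n) ^ 2"
      using 1 r by (intro mult_mono) auto
    then have "ennreal (norm (indicator ?D z * ((norm (g z))\<^sup>2 * (Im z ^ 4 / Im z ^ 2)))) \<le> ennreal (c n) * indicator (B n) z"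
      using True zB by (simp add: c_def mult_ac abs_mult ennreal_leI)
    also have "\<dots> \<le> (\<Sum>n. ennreal (c n) * indicator (B n) z)"
    proof -
      define u where "u = (\<lambda>n. ennreal (c n) * indicator (B n) z)"
      have "sum u {n} \<le> suminf u" by (intro sum_le_suminf) auto
      then have "u n \<le> suminf u" by simp
      then show ?thesis by (simp only: u_def)
    qed
    finally show ?thesis .
  qed simp
  have "(\<integral>\<^sup>+ z. ennreal (norm (indicator ?D z * ((norm (g z))\<^sup>2 * (Im z ^ 4 / Im z ^ 2)))) \<partial>lborel)
      \<le> (\<integral>\<^sup>+ z. (\<Sum>n. ennreal (c n) * indicator (B n) z) \<partial>lborel)"
    by (intro nn_integral_mono pt)
  also have "\<dots> = (\<Sum>n. \<integral>\<^sup>+ z. ennreal (c n) * indicator (B n) z \<partial>lborel)"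
    by (rule nn_integral_suminf) (auto simp: B_def)
  also have "\<dots> = (\<Sum>n. ennreal (c n))"
    by (intro suminf_cong) (simp add: B_def nn_integral_cmult emeasure_box_complex[simplified])
  also have "\<dots> = ennreal (\<Sum>n. c n)"
  proof (rule suminf_ennreal2[OF _ csum])
    show "0 \<le> c n" for n using r by (simp add: c_def)
  qed
  finally have "(\<integral>\<^sup>+ z. ennreal (norm (indicator ?D z * ((norm (g z))\<^sup>2 * (Im z ^ 4 / Im z ^ 2)))) \<partial>lborel) \<le> ennreal (\<Sum>n. c n)" .
  then show "(\<integral>\<^sup>+ z. ennreal (norm (indicator ?D z * ((norm (g z))\<^sup>2 * (Im z ^ 4 / Im z ^ 2)))) \<partial>lborel) < \<infinity>"
    unfolding infinity_ennreal_def by (rule le_less_trans[OF _ ennreal_less_top])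
qed

text \<open>The integrand vanishes almost everywhere, so by continuity \<open>g\<close> vanishes on
  a disc inside the domain, and the identity theorem extends this to the half plane.\<close>

lemma petersson_integral_zero:
  assumes N: "N > 0" and F: "has_qexp N F g" "fps_nth F 0 = 0"
    and zero: "(LINT z|lborel. indicator modular_fundamental_domain z * ((norm (g z))\<^sup>2 * (Im z ^ 4 / Im z ^ 2))) = 0"
    and z: "Im z > 0"
  shows "g z = 0"
proof -
  let ?h = "\<lambda>z. indicator modular_fundamental_domain z * ((norm (g z))\<^sup>2 * (Im z ^ 4 / Im z ^ 2)) :: real"
  have ae: "AE z in lborel. ?h z = 0"
    using integral_nonneg_eq_0_iff_AE[OF petersson_integrable[OF N F]] zero by (simp add: zero_le_mult_iff)
  have hol: "g holomorphic_on {z. Im z > 0}" by (rule has_qexp_holomorphic[OF N F(1)])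
  define U where "U = ball (2 * \<i>) (1/4)"
  have UD: "w \<in> modular_fundamental_domain" "Im w > 0" if "w \<in> U" for w
  proof -
    have "norm (2 * \<i> - w) < 1/4" using that by (simp add: U_def dist_norm)
    then have "\<bar>Re (2 * \<i> - w)\<bar> < 1/4" "\<bar>Im (2 * \<i> - w)\<bar> < 1/4"
      using abs_Re_le_cmod[of "2 * \<i> - w"] abs_Im_le_cmod[of "2 * \<i> - w"] by linarith+
    then have "\<bar>Re w\<bar> < 1/4" "\<bar>2 - Im w\<bar> < 1/4" by simp_all
    then have *: "\<bar>Re w\<bar> \<le> 1/2" "Im w > 1" by linarith+
    moreover have "1 \<le> norm w" using abs_Im_le_cmod[of w] * by linarith
    ultimately show "w \<in> modular_fundamental_domain" "Im w > 0" by (auto simp: modular_fundamental_domain_eq)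
  qed
  have "g w = 0" if w: "w \<in> U" for w
  proof (rule ccontr)
    assume nz: "g w \<noteq> 0"
    have "continuous_on U g"
      by (rule continuous_on_subset[OF holomorphic_on_imp_continuous_on[OF hol]]) (use UD in auto)
    then have "open (U \<inter> g -` (- {0}))"
      by (intro continuous_open_preimage) (auto simp: U_def)
    then obtain s where s: "s > 0" "ball w s \<subseteq> U \<inter> g -` (- {0})"
      using w nz by (metis ComplI IntI open_contains_ball singletonD vimageI)
    have "AE x in lborel. x \<notin> ball w s"
      using ae
    proof (rule AE_mp, intro AE_I2 impI)
      fix x assume h: "?h x = 0"
      show "x \<notin> ball w s"
      proof
        assume "x \<in> ball w s"
        then have "x \<in> U" "g x \<noteq> 0" using s by auto
        then show False using h UD[of x] by auto
      qed
    qed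
    then have "emeasure lborel (ball w s) = 0"
      by (subst (asm) AE_iff_measurable[where N = "ball w s"]) auto
    then show False using s unit_ball_vol_pos[of 2] by (simp add: emeasure_ball)
  qed
  note gU = this
  show ?thesis
  proof (rule analytic_continuation[OF hol, where U = U and \<xi> = "2 * \<i>"])
    show "g w = 0" if "w \<in> U" for w using gU that .
    show "2 * \<i> islimpt U" unfolding U_def by (simp add: islimpt_ball)
  qed (use z UD in \<open>auto simp: U_def open_halfspace_Im_gt convex_connected convex_halfspace_Im_gt\<close>)
qed

text \<open>The product of a form with itself is a finite sum of nonnegative integrals, so each of
  them is 0. The integral for the coset of the identity already makes a translate of
  \<open>f\<close> vanish, and with it \<open>f\<close>.\<close>

lemma petersson_self_eq_0:
  assumes N: "N > 0" and f: "f \<in> cusp_forms 4 N" and zero: "petersson 4 N f f = 0"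
  shows "f = (\<lambda>_. 0)"
proof -
  define I where "I C = (LINT z|lborel. indicator modular_fundamental_domain z *
      ((norm (slash 4 f (SOME A. A \<in> C) z))\<^sup>2 * (Im z ^ 4 / Im z ^ 2)) :: real)" for C
  have "petersson 4 N f f = (\<Sum>C\<in>Gamma0_cosets N. of_real (I C))"
    unfolding petersson_def Let_def
  proof (intro sum.cong refl)
    fix C
    let ?g = "slash 4 f (SOME A. A \<in> C)"
    have "indicator modular_fundamental_domain z *\<^sub>R (?g z * cnj (?g z) * of_real (Im z ^ 4 / Im z ^ 2)) =
        complex_of_real (indicator modular_fundamental_domain z * ((norm (?g z))\<^sup>2 * (Im z ^ 4 / Im z ^ 2)))" for z
      by (simp only: complex_norm_square[symmetric] scaleR_conv_of_real of_real_mult of_real_power)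
    then show "(LINT z:modular_fundamental_domain|lborel. ?g z * cnj (?g z) * of_real (Im z ^ 4 / Im z ^ 2)) = of_real (I C)"
      unfolding set_lebesgue_integral_def I_def by (simp only: integral_complex_of_real)
  qed
  then have "complex_of_real (\<Sum>C\<in>Gamma0_cosets N. I C) = 0" using zero by simp
  then have "(\<Sum>C\<in>Gamma0_cosets N. I C) = 0" by (simp only: of_real_eq_0_iff)
  moreover have "I C \<ge> 0" for C
    unfolding I_def by (intro Bochner_Integration.integral_nonneg) (auto intro!: mult_nonneg_nonneg)
  ultimately have I0: "I C = 0" if "C \<in> Gamma0_cosets N" for C
    using sum_nonneg_eq_0_iff[OF finite_Gamma0_cosets[OF N], of I] that by simp
  have 1: "mat 1 \<in> SL2Z" by (simp add: SL2Z_def)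
  define C where "C = (\<lambda>G. G ** mat 1) ` Gamma0 N"
  have C: "C \<in> Gamma0_cosets N" unfolding C_def Gamma0_cosets_def using 1 by blast
  define A where "A = (SOME A. A \<in> C)"
  define a b c d where "a = ent A 1 1" and "b = ent A 1 2" and "c = ent A 2 1" and "d = ent A 2 2"
  have det: "a * d - b * c = 1"
    using some_in_Gamma0_coset[OF C] by (simp add: SL2Z_iff A_def a_def b_def c_def d_def)
  have sl: "slash 4 f A = sl 4 f a b c d" by (simp add: slash_eq_sl a_def b_def c_def d_def)
  obtain F where F: "has_qexp N F (sl 4 f a b c d)" "fps_nth F 0 = 0"
    using f det unfolding cusp_forms_iff[OF N] by blast
  have slz: "sl 4 f a b c d z = 0" if "Im z > 0" for z
    by (rule petersson_integral_zero[OF N F _ that])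
       (use I0[OF C] in \<open>simp only: I_def sl[symmetric] A_def\<close>)
  have "f z = 0" for z
  proof (cases "Im z > 0")
    case True
    then show ?thesis using slz by (intro sl_eq_0_imp[OF det, where k = 4 and f = f]) auto
  next
    case False
    then show ?thesis using f by (simp add: cusp_forms_iff[OF N])
  qed
  then show ?thesis by auto
qed

section \<open>Level 10\<close>

text \<open>The factorisation of \<open>moebius_dilation\<close> again. If N divides c, then h
  divides c, which forces g = h and m = 1, and M divides \<gamma>, so the factor in SL(2,Z) lies in
  Gamma0(M).\<close>

lemma cusp_forms_lift:
  fixes M N h :: nat
  assumes f: "f \<in> cusp_forms k M" and pos: "M > 0" "N > 0" "h > 0" and dvd: "M * h dvd N"
  shows "(\<lambda>z. f (of_nat h * z)) \<in> cusp_forms k N"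
proof -
  note inv = cusp_form_inv_level[OF pos(1) f]
  have main: "\<exists>g m \<alpha> \<delta> \<beta> \<gamma> e. int g = gcd c (int h) \<and> h = g * m \<and> \<alpha> * \<delta> - \<beta> * \<gamma> = 1 \<and> c = \<gamma> * int g \<and>
      (\<forall>z. Im z > 0 \<longrightarrow> sl k (\<lambda>z. f (of_nat h * z)) a b c d z =
         1 / of_nat m ^ k * sl k f \<alpha> \<beta> \<gamma> \<delta> ((of_nat g * z + of_int e) / of_nat m))"
    if det: "a * d - b * c = 1" for a b c d
  proof -
    obtain g m \<alpha> \<delta> \<beta> \<gamma> e where *: "int g = gcd c (int h)" "h = g * m" "\<alpha> * \<delta> - \<beta> * \<gamma> = 1" "c = \<gamma> * int g"
      "\<forall>z \<tau> :: complex. \<tau> = (of_nat g * z + of_int e) / of_nat m \<longrightarrow>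
         of_int \<gamma> * \<tau> + of_int \<delta> = (of_int c * z + of_int d) / of_nat m"
      "\<forall>z \<tau> :: complex. \<tau> = (of_nat g * z + of_int e) / of_nat m \<longrightarrow>
         of_nat h * ((of_int a * z + of_int b) / (of_int c * z + of_int d)) = (of_int \<alpha> * \<tau> + of_int \<beta>) / (of_int \<gamma> * \<tau> + of_int \<delta>)"
      using moebius_dilation[OF det pos(3)] .
    have m: "m > 0" using *(2) pos(3) by simp
    have "sl k (\<lambda>z. f (of_nat h * z)) a b c d z =
         1 / of_nat m ^ k * sl k f \<alpha> \<beta> \<gamma> \<delta> ((of_nat g * z + of_int e) / of_nat m)" for z
      unfolding sl_def *(6)[rule_format, OF refl] *(5)[rule_format, OF refl] using m
      by (simp add: power_divide)
    then show ?thesis using *(1-4) by blast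
  qed
  have inv': "sl k (\<lambda>z. f (of_nat h * z)) a b c d z = f (of_nat h * z)"
    if det: "a * d - b * c = 1" and c: "int N dvd c" and z: "Im z > 0" for a b c d z
  proof -
    obtain g m \<alpha> \<delta> \<beta> \<gamma> e where *: "int g = gcd c (int h)" "h = g * m" "\<alpha> * \<delta> - \<beta> * \<gamma> = 1" "c = \<gamma> * int g"
      "\<forall>z. Im z > 0 \<longrightarrow> sl k (\<lambda>z. f (of_nat h * z)) a b c d z =
         1 / of_nat m ^ k * sl k f \<alpha> \<beta> \<gamma> \<delta> ((of_nat g * z + of_int e) / of_nat m)"
      using main[OF det] by blast
    have Mh: "int M * int h dvd c" using dvd c by (metis dvd_trans int_dvd_int_iff of_nat_mult)
    then have "int h dvd c" using dvd_mult_right by blast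
    then have gh: "g = h" using *(1) by (simp add: gcd_proj2_iff gcd.commute)
    then have m: "m = 1" using *(2) pos(3) by simp
    have "int M dvd \<gamma>" using Mh *(4) gh pos(3) by simp
    moreover have "Im (of_nat h * z + of_int e) > 0" using z pos(3) by simp
    ultimately have "sl k f \<alpha> \<beta> \<gamma> \<delta> (of_nat h * z + of_int e) = f (of_nat h * z + of_int e)"
      using inv[unfolded inv_level_def, rule_format, OF *(3)] by simp
    also have "\<dots> = f (of_nat h * z)"
      using z pos(3) by (intro inv_level_periodic[OF inv]) simp
    finally show ?thesis using *(5) z gh m by simp
  qed
  have cusp: "\<exists>F. has_qexp N F (sl k (\<lambda>z. f (of_nat h * z)) a b c d) \<and> fps_nth F 0 = 0"
    if det: "a * d - b * c = 1" for a b c d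
  proof -
    obtain g m \<alpha> \<delta> \<beta> \<gamma> e where *: "int g = gcd c (int h)" "h = g * m" "\<alpha> * \<delta> - \<beta> * \<gamma> = 1" "c = \<gamma> * int g"
      "\<forall>z. Im z > 0 \<longrightarrow> sl k (\<lambda>z. f (of_nat h * z)) a b c d z =
         1 / of_nat m ^ k * sl k f \<alpha> \<beta> \<gamma> \<delta> ((of_nat g * z + of_int e) / of_nat m)"
      using main[OF det] by blast
    have gm: "g > 0" "m > 0" using *(2) pos(3) by auto
    obtain F where F: "has_qexp M F (sl k f \<alpha> \<beta> \<gamma> \<delta>)" "fps_nth F 0 = 0"
      using f *(3) unfolding cusp_forms_iff[OF pos(1)] by blast
    have "M * m dvd N" using dvd *(2) by (metis dvd_trans dvd_triv_right mult.assoc mult.commute)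
    then obtain F' where F': "has_qexp N F' (\<lambda>z. sl k f \<alpha> \<beta> \<gamma> \<delta> ((of_nat g * z + of_int e) / of_nat m))" "fps_nth F' 0 = 0"
      using has_qexp_affine[OF F(1) gm pos(1,2), of e] F(2) by auto
    have "has_qexp N (fps_const (1 / of_nat m ^ k) * F') (sl k (\<lambda>z. f (of_nat h * z)) a b c d)"
      by (rule has_qexp_cong[OF has_qexp_cmult[OF pos(2) F'(1)]]) (simp add: *(5))
    then show ?thesis using F'(2) by (intro exI[of _ "fps_const (1 / of_nat m ^ k) * F'"]) simp
  qed
  have hol: "f holomorphic_on {z. Im z > 0}" using f by (simp add: cusp_forms_iff[OF pos(1)])
  have "(f \<circ> (\<lambda>z. of_nat h * z)) holomorphic_on {z. Im z > 0}"
    by (rule holomorphic_on_compose_gen[OF _ hol]) (use pos(3) in \<open>auto intro!: holomorphic_intros\<close>)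
  then show ?thesis
    using f inv' cusp by (simp add: cusp_forms_iff[OF pos(1)] cusp_forms_iff[OF pos(2)] o_def mult_nonneg_nonpos)
qed

text \<open>Everything is expanded in the parameter of level 3, in which f((z + b)/3), f(3 z) and
  f(z) have the exponents n, 9 n and 3 n. At exponent 3 m the three cube roots of unity are raised
  to a multiple of 3, so their average leaves the coefficient of F unchanged. The factor 27 is 3^(4
  - 1).\<close>

lemma hecke_3_coeff:
  assumes F: "has_qexp 1 F f" and eig: "\<forall>z\<in>\<H>. hecke 4 10 3 f z = c * f z"
  shows "fps_nth F (3 * m) + 27 * (if 3 dvd m then fps_nth F (m div 3) else 0) = c * fps_nth F m"
proof -
  define \<zeta> where "\<zeta> b = exp (2 * of_real pi * \<i> * of_nat b / 3)" for b :: nat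
  have \<zeta>: "norm (\<zeta> b) = 1" for b
  proof -
    have "2 * of_real pi * \<i> * of_nat b / 3 = \<i> * of_real (2 * pi * real b / 3)" by simp
    then show ?thesis unfolding \<zeta>_def by (simp only: norm_exp_i_times)
  qed
  have \<zeta>3: "\<zeta> b ^ (3 * m) = 1" for b m
  proof -
    have "\<zeta> b ^ (3 * m) = exp (of_nat (3 * m) * (2 * of_real pi * \<i> * of_nat b / 3))"
      unfolding \<zeta>_def exp_of_nat_mult ..
    also have "of_nat (3 * m) * (2 * of_real pi * \<i> * of_nat b / 3) = \<i> * (of_nat (m * b) * (of_real pi * 2))"
      by simp
    finally show ?thesis by (simp only: exp_2pi_1_nat)
  qed
  have "{a::nat. a dvd 3 \<and> coprime a 10} = {1, 3}"
  proof -
    have "{a::nat. a dvd 3 \<and> coprime a 10} = {a \<in> {a. a dvd 3}. coprime a 10}" by blast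
    also have "\<dots> = {a \<in> {1, 3::nat}. coprime a 10}" by (simp only: divisors_eval)
    also have "\<dots> = {1, 3}" by (auto simp: coprime_iff_gcd_eq_1 gcd_non_0_nat)
    finally show ?thesis .
  qed
  moreover have sum3: "(\<Sum>b<3. u b) = u 0 + u 1 + u 2" for u :: "nat \<Rightarrow> complex"
    by (simp add: eval_nat_numeral)
  ultimately have hecke: "hecke 4 10 3 f z = 1/3 * f (z / 3) + 1/3 * f ((z + 1) / 3) + 1/3 * f ((z + 2) / 3) + 27 * f (3 * z)" for z
    unfolding hecke_def by (simp add: sum3 distrib_left)
  have q: "has_qexp 3 (fps_sub (\<zeta> b) 1 F) (\<lambda>z. f ((z + of_nat b) / 3))" for b
    by (rule has_qexp_subst[OF _ _ F \<zeta>]) (auto simp: qpar_def \<zeta>_def exp_add[symmetric] add_divide_distrib algebra_simps)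
  have q3: "has_qexp 3 (fps_sub 1 9 F) (\<lambda>z. f (3 * z))"
    by (rule has_qexp_subst[OF _ _ F]) (auto simp: qpar_power, simp add: qpar_def mult_ac)
  have q1: "has_qexp 3 (fps_sub 1 3 F) f"
    by (rule has_qexp_subst[OF _ _ F, where \<phi> = "\<lambda>z. z"]) (auto simp: qpar_power, simp add: qpar_def mult_ac)
  define G where "G = fps_const (1/3) * fps_sub (\<zeta> 0) 1 F + fps_const (1/3) * fps_sub (\<zeta> 1) 1 F
      + fps_const (1/3) * fps_sub (\<zeta> 2) 1 F + fps_const 27 * fps_sub 1 9 F"
  have "has_qexp 3 G (\<lambda>z. 1/3 * f ((z + of_nat 0) / 3) + 1/3 * f ((z + of_nat 1) / 3) + 1/3 * f ((z + of_nat 2) / 3) + 27 * f (3 * z))"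
    unfolding G_def by (intro has_qexp_add has_qexp_cmult q q3) auto
  note qG = this
  have "G = fps_const c * fps_sub 1 3 F"
    by (rule has_qexp_unique[OF _ qG has_qexp_cmult[OF _ q1]]) (use eig in \<open>auto simp: hecke\<close>)
  then have "fps_nth G (3 * m) = fps_nth (fps_const c * fps_sub 1 3 F) (3 * m)" by simp
  moreover have "9 dvd 3 * m \<longleftrightarrow> 3 dvd m"
    using dvd_mult_cancel_left[of 3 3 m] by auto
  ultimately have "fps_nth F (3 * m) + 27 * (if 3 dvd m then fps_nth F (3 * m div 9) else 0) = c * fps_nth F m"
    by (simp add: G_def fps_sub_def \<zeta>3 cong: if_cong)
  then show ?thesis by (auto elim!: dvdE)
qed

section \<open>Small coefficients of the forms of levels 5 and 10\<close>

lemma conv_sum_small: "N > 0 \<Longrightarrow> n \<le> N \<Longrightarrow> W N n = 0"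
proof -
  assume "N > 0" "n \<le> N"
  have "\<not> real m < real n / real N" if "0 < m" for m
  proof
    assume "real m < real n / real N"
    then have "real (m * N) < real n" using \<open>N > 0\<close> by (simp add: field_simps)
    then have "m * N < n" by (simp only: of_nat_less_iff)
    moreover have "1 * N \<le> m * N" using that by (intro mult_le_mono) auto
    ultimately show False using \<open>n \<le> N\<close> by simp
  qed
  then have E: "{m. 0 < m \<and> real m < real n / real N} = {}" by blast
  show ?thesis unfolding conv_sum_def E by simp
qed

lemma conv_sum_single:
  assumes "N > 0" "N < n" "n \<le> 2 * N"
  shows "W N n = \<sigma> 1 (real n - real N)"
proof -
  have "real m < real n / real N \<longleftrightarrow> m * N < n" for m
    using assms by (simp add: field_simps flip: of_nat_mult)
  moreover have "0 < m \<and> m * N < n \<longleftrightarrow> m = 1" for m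
  proof
    assume m: "0 < m \<and> m * N < n"
    show "m = 1"
    proof (rule ccontr)
      assume "m \<noteq> 1"
      then have "2 * N \<le> m * N" using m by (intro mult_le_mono) auto
      then show False using conjunct2[OF m] assms(3) by linarith
    qed
  qed (use assms in auto)
  ultimately have E: "{m. 0 < m \<and> real m < real n / real N} = {1}" by auto
  show ?thesis unfolding conv_sum_def E by (simp add: sigma_1)
qed

lemma sigma_values:
  "\<sigma> j 2 = 1 + 2 ^ j" "\<sigma> j 3 = 1 + 3 ^ j" "\<sigma> j 4 = 1 + (2 ^ j + 4 ^ j)"
  "\<sigma> j 6 = 1 + (2 ^ j + (3 ^ j + 6 ^ j))" "\<sigma> j 9 = 1 + (3 ^ j + 9 ^ j)"
  using sigma_of_nat[of j 2] sigma_of_nat[of j 3] sigma_of_nat[of j 4] sigma_of_nat[of j 6] sigma_of_nat[of j 9]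
  by (simp_all add: sigma_fps_def divisors_eval)

lemma sigma_fractions:
  "\<sigma> j (2/5) = 0" "\<sigma> j (3/5) = 0" "\<sigma> j (6/5) = 0" "\<sigma> j (9/5) = 0" "\<sigma> j (3/2) = 0" "\<sigma> j (9/2) = 0"
  "\<sigma> j (3/10) = 0" "\<sigma> j (9/10) = 0"
  using sigma_divide[of 5 2 j] sigma_divide[of 5 3 j] sigma_divide[of 5 6 j] sigma_divide[of 5 9 j]
    sigma_divide[of 2 3 j] sigma_divide[of 2 9 j] sigma_divide[of 10 3 j] sigma_divide[of 10 9 j]
  by (simp_all add: fps_dil_def)

text \<open>The indices 2, 3, 6 and 9 are those entering the T_3 relations. Up to n = 10 the sum
  W_5(n) has at most one term.\<close>

lemma eis_comb_fps_5_values: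
  "fps_nth (eis_comb_fps 5 e5) 2 = - 2304/13" "fps_nth (eis_comb_fps 5 e5) 3 = 1152/13"
  "fps_nth (eis_comb_fps 5 e5) 6 = - 4608/13" "fps_nth (eis_comb_fps 5 e5) 9 = - 13248/13"
  by (simp_all add: eis_comb_fps_nth conv_sum_small conv_sum_single divisors_eval e5_def sigma_1 sigma_values sigma_inverse sigma_fractions)

lemma eis_comb_fps_10_values:
  "fps_nth (eis_comb_fps 10 e10) 2 = 192" "fps_nth (eis_comb_fps 10 e10) 3 = - 6528/13"
  "fps_nth (eis_comb_fps 10 e10) 6 = - 1536" "fps_nth (eis_comb_fps 10 e10) 9 = 6432/13"
  by (simp_all add: eis_comb_fps_nth conv_sum_small divisors_eval e10_def sigma_1 sigma_values sigma_inverse sigma_fractions)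

definition T5_fps :: "complex fps" where
  "T5_fps = fps_const (13/576) * eis_comb_fps 5 e5"

text \<open>The normalisation of \<open>newform10_fps\<close> is read off the formula for \<open>W\<^sub>1\<^sub>0\<close>.\<close>
definition newform10_fps :: "complex fps" where
  "newform10_fps = fps_const (1/96) * eis_comb_fps 10 e10 + (fps_const (- 18/13) * T5_fps + fps_const (- 72/13) * fps_dil 2 T5_fps)"

lemma Delta4_5: "\<Delta>4 5 \<in> cusp_forms 4 5" "has_qexp 1 T5_fps (\<Delta>4 5)"
  using eis_comb_fps_tau(2,3)[OF _ eis_conds(4) eis_comb_fps_1(1)] sturm_bounds(4) by (simp_all add: T5_fps_def)

lemma tau4_5: "n > 0 \<Longrightarrow> \<tau>4 5 (real n) = fps_nth T5_fps n"
  "n > 0 \<Longrightarrow> \<tau>4 5 (real n / 2) = fps_nth (fps_dil 2 T5_fps) n"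
  using extend_zero_divide[of 1 n "fps_nth T5_fps"] extend_zero_divide[of 2 n "fps_nth T5_fps"]
  by (simp_all add: \<tau>4_def fourier_coeff_eq[OF Delta4_5(2)] fps_dil_def)

lemma T5_fps_values:
  "fps_nth T5_fps 0 = 0" "fps_nth T5_fps 1 = 1" "fps_nth T5_fps 2 = - 4" "fps_nth T5_fps 3 = 2" "fps_nth T5_fps 6 = - 8" "fps_nth T5_fps 9 = - 23"
  using eis_comb_fps_0[OF _ eis_conds(4)]
  by (simp_all add: T5_fps_def eis_comb_fps_5_values eis_comb_fps_1[unfolded One_nat_def])

lemma dil_T5_fps_values:
  "fps_nth (fps_dil 2 T5_fps) 0 = 0" "fps_nth (fps_dil 2 T5_fps) 1 = 0" "fps_nth (fps_dil 2 T5_fps) 2 = 1"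
  "fps_nth (fps_dil 2 T5_fps) 3 = 0" "fps_nth (fps_dil 2 T5_fps) 6 = 2" "fps_nth (fps_dil 2 T5_fps) 9 = 0"
  using T5_fps_values by (simp_all add: fps_dil_def)

lemma newform10_fps_values:
  "fps_nth newform10_fps 0 = 0" "fps_nth newform10_fps 1 = 1" "fps_nth newform10_fps 2 = 2" "fps_nth newform10_fps 3 = - 8"
  "fps_nth newform10_fps 6 = - 16" "fps_nth newform10_fps 9 = 37"
  using eis_comb_fps_0[OF _ eis_conds(9)] T5_fps_values dil_T5_fps_values
  by (simp_all add: newform10_fps_def eis_comb_fps_10_values eis_comb_fps_1[unfolded One_nat_def])

section \<open>Identification of the primitive form and the formula of level 10\<close>

lemma primitive_form_10_coeff:
  assumes prim: "primitive_form 4 10 \<Delta>"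
  shows "fourier_coeff \<Delta> = fps_nth newform10_fps"
proof -
  have \<Delta>: "\<Delta> \<in> cusp_forms 4 10" and new: "\<forall>g\<in>oldforms 4 10. petersson 4 10 \<Delta> g = 0"
    using prim by (auto simp: primitive_form_def newspace_def)
  obtain D where D: "has_qexp 1 D \<Delta>" "fps_nth D 0 = 0" using cusp_form_has_qexp[OF _ \<Delta>] by auto
  have coeff: "fourier_coeff \<Delta> = fps_nth D" by (rule fourier_coeff_eq[OF D(1)])
  have D1: "fps_nth D 1 = 1" using prim coeff by (simp add: primitive_form_def)
  have "\<exists>c. \<forall>z\<in>\<H>. hecke 4 10 3 \<Delta> z = c * \<Delta> z" using prim by (simp add: primitive_form_def)
  then obtain c where "\<forall>z\<in>\<H>. hecke 4 10 3 \<Delta> z = c * \<Delta> z" ..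
  \<comment> \<open>At m = 1, 2, 3 these relations express the coefficients 3, 6 and 9 through the
    eigenvalue c and the second coefficient.\<close>
  note T3 = hecke_3_coeff[OF D(1) this]
  have c: "fps_nth D 3 = c" using T3[of 1] D1 by simp
  have D6: "fps_nth D 6 = c * fps_nth D 2" using T3[of 2] by simp
  have D9: "fps_nth D 9 + 27 = c * c" using T3[of 3] D1 c by simp
  define H where "H = (\<lambda>z. 1/96 * eis_comb 10 e10 z + 1 * (- 18/13 * \<Delta>4 5 z + - 72/13 * \<Delta>4 5 (2 * z)))"
  have f5: "\<Delta>4 5 \<in> cusp_forms 4 10" using cusp_forms_lift[OF Delta4_5(1), of 10 1] by simp
  have f5': "(\<lambda>z. \<Delta>4 5 (2 * z)) \<in> cusp_forms 4 10" using cusp_forms_lift[OF Delta4_5(1), of 10 2] by simp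
  have q5': "has_qexp 1 (fps_dil 2 T5_fps) (\<lambda>z. \<Delta>4 5 (2 * z))" using has_qexp_dil[OF _ Delta4_5(2), of 2] by simp
  have H: "H \<in> cusp_forms 4 10"
    unfolding H_def by (intro cusp_forms_lincomb eis_comb_cusp_form' eis_conds f5 f5') auto
  have "has_qexp 1 newform10_fps (\<lambda>z. 1/96 * eis_comb 10 e10 z + (- 18/13 * \<Delta>4 5 z + - 72/13 * \<Delta>4 5 (2 * z)))"
    unfolding newform10_fps_def by (intro has_qexp_add has_qexp_cmult has_qexp_eis_comb Delta4_5 q5') auto
  then have qH: "has_qexp 1 newform10_fps H" by (simp add: H_def)
  \<comment> \<open>The primitive form is fitted by x H + y D(z) + t D(2 z), with D the normalised
    form of level 5. The first coefficient gives x + y = 1, the third gives -8 x + 2 y = c, hence x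
    = (2 - c)/10, and the second determines t. The remainder \<open>R\<close> has four vanishing
    coefficients, so it is zero.\<close>
  define x where "x = (2 - c) / 10"
  define y where "y = 1 - x"
  define t where "t = fps_nth D 2 - 2 * x + 4 * y"
  define R where "R = (\<lambda>z. 1 * \<Delta> z + (- 1) * (x * H z + 1 * (y * \<Delta>4 5 z + t * \<Delta>4 5 (2 * z))))"
  have R: "R \<in> cusp_forms 4 10" unfolding R_def by (intro cusp_forms_lincomb \<Delta> H f5 f5') auto
  define Rf where "Rf = fps_const 1 * D + fps_const (- 1) * (fps_const x * newform10_fps + fps_const 1 * (fps_const y * T5_fps + fps_const t * fps_dil 2 T5_fps))"
  have qR: "has_qexp 1 Rf R"
    unfolding Rf_def R_def by (intro has_qexp_add has_qexp_cmult D qH Delta4_5 q5') auto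
  have Rf_nth: "fps_nth Rf i = fps_nth D i - (x * fps_nth newform10_fps i + y * fps_nth T5_fps i + t * fps_nth (fps_dil 2 T5_fps) i)" for i
    by (simp add: Rf_def)
  have cx: "c = 2 - 10 * x" by (simp add: x_def field_simps)
  have "fps_nth Rf i = 0" if "i < 4" for i
  proof -
    have "i \<in> {0, 1, 2, 3}" using that by auto
    then show ?thesis
      unfolding Rf_nth using D D1 c
      by (auto simp: newform10_fps_values[unfolded One_nat_def] T5_fps_values[unfolded One_nat_def] dil_T5_fps_values[unfolded One_nat_def] t_def y_def cx algebra_simps)
  qed
  then have R0: "R = (\<lambda>_. 0)" using sturm[of 10 4, OF _ R qR] sturm_bounds(9) by simp
  have "Rf = 0"
    by (rule has_qexp_unique[OF zero_less_one qR]) (use has_qexp_const[of 1 0] R0 in auto)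
  then have Dn: "fps_nth D i = x * fps_nth newform10_fps i + y * fps_nth T5_fps i + t * fps_nth (fps_dil 2 T5_fps) i" for i
    using Rf_nth[of i] by simp
  \<comment> \<open>The ninth coefficient: 37 x - 23 (1 - x) + 27 = c^2. The roots x = 0 and x = 1
    belong to the eigenvalues 2, that of the level 5 form, and -8.\<close>
  have "60 * x + 4 = (2 - 10 * x) * (2 - 10 * x)"
    using D9 unfolding Dn[of 9] cx newform10_fps_values T5_fps_values dil_T5_fps_values y_def by (simp add: algebra_simps)
  then have "100 * (x * (x - 1)) = 0" by (simp add: algebra_simps)
  then consider "x = 0" | "x = 1" by auto
  then show ?thesis
  proof cases
    \<comment> \<open>Here the primitive form is a combination of lifts from level 5, hence
      orthogonal to itself and zero, against its first coefficient 1.\<close>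
    case 1
    have "\<Delta> z = (0 + 1 * \<Delta>4 5 (of_nat 1 * z)) + t * \<Delta>4 5 (of_nat 2 * z)" for z
      using fun_cong[OF R0, of z] by (simp add: R_def y_def 1 algebra_simps)
    then have eq: "\<Delta> = (\<lambda>z. (0 + 1 * \<Delta>4 5 (of_nat 1 * z)) + t * \<Delta>4 5 (of_nat 2 * z))" by blast
    have "(\<lambda>z. 0 + 1 * \<Delta>4 5 (of_nat 1 * z)) \<in> oldforms 4 10"
      by (rule oldforms.add_lift[OF oldforms.zero, where M = 5]) (use Delta4_5 in auto)
    then have "\<Delta> \<in> oldforms 4 10"
      unfolding eq by (rule oldforms.add_lift[where M = 5]) (use Delta4_5 in auto)
    then have "petersson 4 10 \<Delta> \<Delta> = 0" using new by blast
    then have "\<Delta> = (\<lambda>_. 0)" using petersson_self_eq_0[OF _ \<Delta>] by simp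
    then have "D = fps_const 0"
      by (intro has_qexp_unique[OF zero_less_one D(1) has_qexp_const]) simp
    then show ?thesis using D1 by simp
  next
    case 2
    then have y0: "y = 0" and c8: "c = - 8" by (simp_all add: y_def cx)
    have "fps_nth D 2 = 2 + t" "fps_nth D 6 = - 16 + 2 * t"
      unfolding Dn newform10_fps_values T5_fps_values dil_T5_fps_values y0 2 by simp_all
    \<comment> \<open>The sixth coefficient removes the remaining oldform: -16 + 2 t = -8 (2 +
      t).\<close>
    then have "10 * t = 0" using D6 c8 by (simp add: algebra_simps)
    then have "t = 0" by simp
    then have "fps_nth D i = fps_nth newform10_fps i" for i unfolding Dn by (simp add: y0 2)
    then show ?thesis using coeff by auto
  qed
qed

text \<open>The definition of \<open>newform10_fps\<close> is solved for the cusp form coefficient.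
  The factor 96 / (1152 10) = 1/120 turns the weights 1, 18/13 and 72/13 into 1/120, 3/260 and
  3/65.\<close>

lemma conv_sum_10_formula:
  assumes n: "n > 0" and prim: "primitive_form 4 10 \<Delta>"
  shows "W 10 n =
        1/312 * \<sigma> 3 (real n) + 1/78 * \<sigma> 3 (real n / 2) + 25/312 * \<sigma> 3 (real n / 5) + 25/78 * \<sigma> 3 (real n / 10)
        - 1/40 * of_nat n * \<sigma> 1 (real n) - 1/4 * of_nat n * \<sigma> 1 (real n / 10)
        + 1/24 * \<sigma> 1 (real n) + 1/24 * \<sigma> 1 (real n / 10)
        - 1/120 * extend_zero (fourier_coeff \<Delta>) (real n)
        - 3/260 * \<tau>4 5 (real n) - 3/65 * \<tau>4 5 (real n / 2)"
proof -
  have F: "extend_zero (fourier_coeff \<Delta>) (real n) = 1/96 * fps_nth (eis_comb_fps 10 e10) n - 18/13 * \<tau>4 5 (real n) - 72/13 * \<tau>4 5 (real n / 2)"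
    using n by (simp add: extend_zero_def primitive_form_10_coeff[OF prim] newform10_fps_def tau4_5[OF n])
  have "(10::nat) > 0" by simp
  note w = conv_sum_eis_comb[OF this n, of e10]
  define G where "G = fps_nth (eis_comb_fps 10 e10) n"
  show ?thesis
    unfolding F w G_def[symmetric] by (simp add: divisors_eval e10_def field_simps)
qed

theorem theorem1:
  fixes n :: nat
  assumes "n > 0"
  shows
    "W 1 n = 5/12 * \<sigma> 3 (real n) - of_nat n / 2 * \<sigma> 1 (real n) + 1/12 * \<sigma> 1 (real n) \<and>
     W 2 n =
        1/12 * \<sigma> 3 (real n) + 1/3 * \<sigma> 3 (real n / 2)
        - 1/8 * of_nat n * \<sigma> 1 (real n) - 1/4 * of_nat n * \<sigma> 1 (real n / 2)
        + 1/24 * \<sigma> 1 (real n) + 1/24 * \<sigma> 1 (real n / 2) \<and>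
     W 3 n =
        1/24 * \<sigma> 3 (real n) + 3/8 * \<sigma> 3 (real n / 3)
        - 1/12 * of_nat n * \<sigma> 1 (real n) - 1/4 * of_nat n * \<sigma> 1 (real n / 3)
        + 1/24 * \<sigma> 1 (real n) + 1/24 * \<sigma> 1 (real n / 3) \<and>
     W 4 n =
        1/48 * \<sigma> 3 (real n) + 1/16 * \<sigma> 3 (real n / 2) + 1/3 * \<sigma> 3 (real n / 4)
        - 1/16 * of_nat n * \<sigma> 1 (real n) - 1/4 * of_nat n * \<sigma> 1 (real n / 4)
        + 1/24 * \<sigma> 1 (real n) + 1/24 * \<sigma> 1 (real n / 4) \<and>
     W 5 n =
        5/312 * \<sigma> 3 (real n) + 125/312 * \<sigma> 3 (real n / 5)
        - 1/20 * of_nat n * \<sigma> 1 (real n) - 1/4 * of_nat n * \<sigma> 1 (real n / 5)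
        + 1/24 * \<sigma> 1 (real n) + 1/24 * \<sigma> 1 (real n / 5)
        - 1/130 * \<tau>4 5 (real n) \<and>
     W 6 n =
        1/120 * \<sigma> 3 (real n) + 1/30 * \<sigma> 3 (real n / 2) + 3/40 * \<sigma> 3 (real n / 3) + 3/10 * \<sigma> 3 (real n / 6)
        - 1/24 * of_nat n * \<sigma> 1 (real n) - 1/4 * of_nat n * \<sigma> 1 (real n / 6)
        + 1/24 * \<sigma> 1 (real n) + 1/24 * \<sigma> 1 (real n / 6)
        - 1/120 * \<tau>4 6 (real n) \<and>
     W 7 n =
        1/120 * \<sigma> 3 (real n) + 49/120 * \<sigma> 3 (real n / 7)
        - 1/28 * of_nat n * \<sigma> 1 (real n) - 1/4 * of_nat n * \<sigma> 1 (real n / 7)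
        + 1/24 * \<sigma> 1 (real n) + 1/24 * \<sigma> 1 (real n / 7)
        - 1/70 * \<tau>4 7 (real n) \<and>
     W 8 n =
        1/192 * \<sigma> 3 (real n) + 1/64 * \<sigma> 3 (real n / 2) + 1/16 * \<sigma> 3 (real n / 4) + 1/3 * \<sigma> 3 (real n / 8)
        - 1/32 * of_nat n * \<sigma> 1 (real n) - 1/4 * of_nat n * \<sigma> 1 (real n / 8)
        + 1/24 * \<sigma> 1 (real n) + 1/24 * \<sigma> 1 (real n / 8)
        - 1/64 * \<tau>4 8 (real n) \<and>
     W 9 n =
        1/216 * \<sigma> 3 (real n) + 1/27 * \<sigma> 3 (real n / 3) + 3/8 * \<sigma> 3 (real n / 9)
        - 1/36 * of_nat n * \<sigma> 1 (real n) - 1/4 * of_nat n * \<sigma> 1 (real n / 9)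
        + 1/24 * \<sigma> 1 (real n) + 1/24 * \<sigma> 1 (real n / 9)
        - 1/54 * \<tau>4 9 (real n) \<and>
     (\<forall>\<Delta>. primitive_form 4 10 \<Delta> \<longrightarrow>
      W 10 n =
        1/312 * \<sigma> 3 (real n) + 1/78 * \<sigma> 3 (real n / 2) + 25/312 * \<sigma> 3 (real n / 5) + 25/78 * \<sigma> 3 (real n / 10)
        - 1/40 * of_nat n * \<sigma> 1 (real n) - 1/4 * of_nat n * \<sigma> 1 (real n / 10)
        + 1/24 * \<sigma> 1 (real n) + 1/24 * \<sigma> 1 (real n / 10)
        - 1/120 * extend_zero (fourier_coeff \<Delta>) (real n)
        - 3/260 * \<tau>4 5 (real n) - 3/65 * \<tau>4 5 (real n / 2))"
  by (intro conjI allI impI)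
     (rule conv_sum_1_formula conv_sum_2_formula conv_sum_3_formula conv_sum_4_formula conv_sum_5_formula conv_sum_6_formula
        conv_sum_7_formula conv_sum_8_formula conv_sum_9_formula conv_sum_10_formula assms | assumption)+

end
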